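(* Let $\mathbb{K}$ be an algebraically closed field, let $m>1$ be an odd integer, and let $q\in\mathbb{K}^*$ be a primitive $m$-th root of unity. Let $n, p$ be integers with $2\le p\le n-1$. Then the factor algebra $\mathcal{O}_q(\mathfrak{o}\mathbb{K}^{2n})/\langle \omega_p\rangle$ is a prime PI ring, and its PI degree is $$\text{PI-deg}\big(\mathcal{O}_q(\mathfrak{o}\mathbb{K}^{2n})/\langle \omega_p\rangle\big)=m^{n-2}.$$
   Context: The coordinate ring $\mathcal{O}_{q}(\mathfrak{o}\mathbb{K}^{2n})$ of quantum euclidean $2n$-space is the associative unital $\mathbb{K}$-algebra generated by $x_1,\dots,x_n,y_1,\dots,y_n$ subject to the relations $x_ix_j=q\,x_jx_i$ for all $i<j$; $y_iy_j=q^{-1}y_jy_i$ for all $i<j$; $x_iy_j=q^{-1}y_jx_i$ for all $i\neq j$; and $x_iy_i=y_ix_i+\sum_{l<i}(1-q^{-2})y_lx_l$ for all $i$. For $1\le i\le n$ put $\omega_i:=\sum_{l\le i}(1-q^{-2})y_lx_l$. Each $\omega_i$ is a normal element of the algebra, and $\langle\omega_p\rangle$ denotes the two-sided ideal generated by $\omega_p$. A PI ring is a ring $R$ satisfying some monic polynomial $f\in\mathbb{Z}\langle t_1,\dots,t_k\rangle$, i.e. $f(r_1,\dots,r_k)=0$ for all $r_i\in R$; its minimal degree is the least degree of such an $f$. The PI degree of a prime PI ring of minimal degree $d$ is $d/2$. *)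

theory Defs
  imports
    "HOL-Algebra.Algebra"
    "HOL-Library.Poly_Mapping"
    "HOL-Computational_Algebra.Polynomial"
begin

section \<open>Free associative algebras\<close>

text \<open>
  The free monoid is written additively only because \<^typ>\<open>'a \<Rightarrow>\<^sub>0 'b\<close> takes its convolution
  product from a \<^class>\<open>monoid_add\<close> on the index type; \<open>+\<close> is concatenation of words.
\<close>

datatype 'g free_monoid = Word (letters: "'g list")

instantiation free_monoid :: (type) monoid_add
begin

definition zero_free_monoid :: "'a free_monoid"
  where "0 = Word []"

definition plus_free_monoid :: "'a free_monoid \<Rightarrow> 'a free_monoid \<Rightarrow> 'a free_monoid"
  where "u + v = Word (letters u @ letters v)"

instance
  by standard (simp_all add: zero_free_monoid_def plus_free_monoid_def)

end

lemma letters_zero [simp]: "letters 0 = []"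
  by (simp add: zero_free_monoid_def)

lemma letters_plus [simp]: "letters (u + v) = letters u @ letters v"
  by (simp add: plus_free_monoid_def)

type_synonym ('g, 'k) nc_poly = "'g free_monoid \<Rightarrow>\<^sub>0 'k"

definition nc_const :: "'k \<Rightarrow> ('g, 'k::comm_ring_1) nc_poly"
  where "nc_const c = Poly_Mapping.single 0 c"

definition nc_var :: "'g \<Rightarrow> ('g, 'k::comm_ring_1) nc_poly"
  where "nc_var g = Poly_Mapping.single (Word [g]) 1"

definition free_algebra :: "'g set \<Rightarrow> ('g, 'k::comm_ring_1) nc_poly ring"
  where "free_algebra G =
    \<lparr> carrier = {f. \<forall>w \<in> Poly_Mapping.keys f. set (letters w) \<subseteq> G},
      monoid.mult = (*), one = 1, ring.zero = 0, add = (+) \<rparr>"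

lemma carrier_free_algebra:
  "f \<in> carrier (free_algebra G) \<longleftrightarrow> (\<forall>w \<in> Poly_Mapping.keys f. set (letters w) \<subseteq> G)"
  by (simp add: free_algebra_def)

lemma free_algebra_simps [simp]:
  "monoid.mult (free_algebra G) = (*)" "one (free_algebra G) = 1"
  "ring.zero (free_algebra G) = 0" "add (free_algebra G) = (+)"
  by (simp_all add: free_algebra_def)

lemma nc_closed_add:
  assumes "f \<in> carrier (free_algebra G)" "g \<in> carrier (free_algebra G)"
  shows "f + g \<in> carrier (free_algebra G)"
  using assms Poly_Mapping.keys_add[of f g] unfolding carrier_free_algebra by blast

lemma nc_closed_diff:
  assumes "f \<in> carrier (free_algebra G)" "g \<in> carrier (free_algebra G)"
  shows "f - g \<in> carrier (free_algebra G)"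
  using assms Poly_Mapping.keys_diff[of f g] unfolding carrier_free_algebra by blast

lemma nc_closed_mult:
  assumes "f \<in> carrier (free_algebra G)" "g \<in> carrier (free_algebra G)"
  shows "f * g \<in> carrier (free_algebra G)"
  unfolding carrier_free_algebra
proof
  fix w assume "w \<in> Poly_Mapping.keys (f * g)"
  then obtain u v where "w = u + v" "u \<in> Poly_Mapping.keys f" "v \<in> Poly_Mapping.keys g"
    using Poly_Mapping.keys_mult[of f g] by blast
  with assms show "set (letters w) \<subseteq> G"
    unfolding carrier_free_algebra by simp
qed

lemma nc_closed_const: "nc_const c \<in> carrier (free_algebra G)"
  by (simp add: carrier_free_algebra nc_const_def)

lemma nc_closed_var: "x \<in> G \<Longrightarrow> nc_var x \<in> carrier (free_algebra G)"
  by (simp add: carrier_free_algebra nc_var_def)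

lemma nc_closed_one: "1 \<in> carrier (free_algebra G)"
  using nc_closed_const[of 1 G] by (simp add: nc_const_def)

lemma nc_closed_zero: "0 \<in> carrier (free_algebra G)"
  by (simp add: carrier_free_algebra)

lemmas nc_closed =
  nc_closed_add nc_closed_diff nc_closed_mult nc_closed_const nc_closed_var nc_closed_one
  nc_closed_zero

lemma ring_free_algebra: "ring (free_algebra G :: ('g, 'k::comm_ring_1) nc_poly ring)"
proof (rule ringI)
  show "abelian_group (free_algebra G :: ('g, 'k) nc_poly ring)"
  proof (rule abelian_groupI)
    fix f :: "('g, 'k) nc_poly" assume "f \<in> carrier (free_algebra G)"
    then show "\<exists>g\<in>carrier (free_algebra G). g \<oplus>\<^bsub>free_algebra G\<^esub> f = \<zero>\<^bsub>free_algebra G\<^esub>"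
      using nc_closed_diff[OF nc_closed_zero] by (intro bexI[of _ "0 - f"]) simp_all
  qed (simp_all add: nc_closed add_ac)
  show "monoid (free_algebra G :: ('g, 'k) nc_poly ring)"
    by (rule monoidI) (simp_all add: nc_closed mult.assoc)
qed (simp_all add: distrib_left distrib_right)

section \<open>Polynomial identities\<close>

definition nc_degree :: "('g, 'k::zero) nc_poly \<Rightarrow> nat"
  where "nc_degree f = Max ((\<lambda>w. length (letters w)) ` Poly_Mapping.keys f)"

text \<open>
  With several words of top degree there is no distinguished leading term: a noncommutative
  polynomial is monic if at least one word of top degree has coefficient 1.
\<close>

definition nc_monic :: "('g, 'k::zero_neq_one) nc_poly \<Rightarrow> bool"
  where "nc_monic f \<longleftrightarrow> (\<exists>w. length (letters w) = nc_degree f \<and> Poly_Mapping.lookup f w = 1)"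

definition nc_eval :: "('a, 'b) ring_scheme \<Rightarrow> ('g \<Rightarrow> 'a) \<Rightarrow> ('g, int) nc_poly \<Rightarrow> 'a"
  where "nc_eval R r f =
    (\<Oplus>\<^bsub>R\<^esub>w\<in>Poly_Mapping.keys f.
       [Poly_Mapping.lookup f w] \<cdot>\<^bsub>R\<^esub> foldr (\<lambda>g a. r g \<otimes>\<^bsub>R\<^esub> a) (letters w) \<one>\<^bsub>R\<^esub>)"

definition satisfies_monic_identity :: "('a, 'b) ring_scheme \<Rightarrow> nat \<Rightarrow> bool"
  where "satisfies_monic_identity R d \<longleftrightarrow>
    (\<exists>k::nat. \<exists>f \<in> carrier (free_algebra {1..k}). nc_monic f \<and> nc_degree f = d \<and>
       (\<forall>r \<in> {1..k} \<rightarrow> carrier R. nc_eval R r f = \<zero>\<^bsub>R\<^esub>))"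

definition PI_ring :: "('a, 'b) ring_scheme \<Rightarrow> bool"
  where "PI_ring R \<longleftrightarrow> ring R \<and> (\<exists>d. satisfies_monic_identity R d)"

definition PI_min_degree :: "('a, 'b) ring_scheme \<Rightarrow> nat"
  where "PI_min_degree R = (LEAST d. satisfies_monic_identity R d)"

definition PI_degree :: "('a, 'b) ring_scheme \<Rightarrow> rat"
  where "PI_degree R = of_nat (PI_min_degree R) / 2"

text \<open>
  The library's prime ideals are confined to commutative rings; this is primeness of a possibly
  noncommutative ring, in terms of two-sided ideals.
\<close>

definition prime_ring :: "('a, 'b) ring_scheme \<Rightarrow> bool"
  where "prime_ring R \<longleftrightarrow> ring R \<and> \<one>\<^bsub>R\<^esub> \<noteq> \<zero>\<^bsub>R\<^esub> \<and>
    (\<forall>I J. ideal I R \<longrightarrow> ideal J R \<longrightarrow> I \<cdot>\<^bsub>R\<^esub> J = {\<zero>\<^bsub>R\<^esub>} \<longrightarrow>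
       I = {\<zero>\<^bsub>R\<^esub>} \<or> J = {\<zero>\<^bsub>R\<^esub>})"

section \<open>Quantum euclidean space\<close>

definition primitive_root_of_unity :: "nat \<Rightarrow> 'k::field \<Rightarrow> bool"
  where "primitive_root_of_unity m q \<longleftrightarrow> m > 0 \<and> q ^ m = 1 \<and> (\<forall>k. 0 < k \<and> k < m \<longrightarrow> q ^ k \<noteq> 1)"

datatype euclidean_gen = GenX nat | GenY nat

abbreviation var_x :: "nat \<Rightarrow> (euclidean_gen, 'k::field) nc_poly"
  where "var_x i \<equiv> nc_var (GenX i)"

abbreviation var_y :: "nat \<Rightarrow> (euclidean_gen, 'k::field) nc_poly"
  where "var_y i \<equiv> nc_var (GenY i)"

definition euclidean_free :: "nat \<Rightarrow> (euclidean_gen, 'k::field) nc_poly ring"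
  where "euclidean_free n = free_algebra (GenX ` {1..n} \<union> GenY ` {1..n})"

definition euclidean_relators :: "'k::field \<Rightarrow> nat \<Rightarrow> (euclidean_gen, 'k) nc_poly set"
  where "euclidean_relators q n =
    {var_x i * var_x j - nc_const q * var_x j * var_x i | i j.
       i \<in> {1..n} \<and> j \<in> {1..n} \<and> i < j} \<union>
    {var_y i * var_y j - nc_const (inverse q) * var_y j * var_y i | i j.
       i \<in> {1..n} \<and> j \<in> {1..n} \<and> i < j} \<union>
    {var_x i * var_y j - nc_const (inverse q) * var_y j * var_x i | i j.
       i \<in> {1..n} \<and> j \<in> {1..n} \<and> i \<noteq> j} \<union>
    {var_x i * var_y i -
       (var_y i * var_x i + (\<Sum>l\<in>{1..<i}. nc_const (1 - inverse (q\<^sup>2)) * var_y l * var_x l)) | i.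
       i \<in> {1..n}}"

definition euclidean_ideal :: "'k::field \<Rightarrow> nat \<Rightarrow> (euclidean_gen, 'k) nc_poly set"
  where "euclidean_ideal q n = Idl\<^bsub>euclidean_free n\<^esub> (euclidean_relators q n)"

definition quantum_euclidean :: "'k::field \<Rightarrow> nat \<Rightarrow> (euclidean_gen, 'k) nc_poly set ring"
  where "quantum_euclidean q n = euclidean_free n Quot euclidean_ideal q n"

definition omega :: "'k::field \<Rightarrow> nat \<Rightarrow> nat \<Rightarrow> (euclidean_gen, 'k) nc_poly set"
  where "omega q n i =
    euclidean_ideal q n +>\<^bsub>euclidean_free n\<^esub>
      (\<Sum>l\<in>{1..i}. nc_const (1 - inverse (q\<^sup>2)) * var_y l * var_x l)"

definition omega_factor ::
  "'k::field \<Rightarrow> nat \<Rightarrow> nat \<Rightarrow> (euclidean_gen, 'k) nc_poly set set ring"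
  where "omega_factor q n p =
    quantum_euclidean q n Quot (Idl\<^bsub>quantum_euclidean q n\<^esub> {omega q n p})"

text \<open>
  The relators and the representatives of the \<open>\<omega>\<^sub>i\<close> lie in the free algebra, so the ideals above
  are generated by subsets of the respective carriers.
\<close>

lemma nc_sum_closed:
  "(\<And>l. l \<in> A \<Longrightarrow> f l \<in> carrier (free_algebra G)) \<Longrightarrow> sum f A \<in> carrier (free_algebra G)"
  by (induction A rule: infinite_finite_induct)
     (simp_all add: nc_closed)

lemma euclidean_relators_closed: "euclidean_relators q n \<subseteq> carrier (euclidean_free n)"
  unfolding euclidean_relators_def euclidean_free_def
  by (auto intro!: nc_closed nc_sum_closed)

lemma ideal_euclidean_ideal: "ideal (euclidean_ideal q n) (euclidean_free n)"
  unfolding euclidean_ideal_def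
  by (rule ring.genideal_ideal)
     (use ring_free_algebra euclidean_relators_closed in \<open>auto simp: euclidean_free_def\<close>)

lemma ring_quantum_euclidean: "ring (quantum_euclidean q n)"
  unfolding quantum_euclidean_def by (rule ideal.quotient_is_ring[OF ideal_euclidean_ideal])

lemma omega_closed: "i \<le> n \<Longrightarrow> omega q n i \<in> carrier (quantum_euclidean q n)"
proof -
  assume "i \<le> n"
  then have "(\<Sum>l\<in>{1..i}. nc_const (1 - inverse (q\<^sup>2)) * var_y l * var_x l)
      \<in> carrier (euclidean_free n)"
    unfolding euclidean_free_def by (intro nc_sum_closed nc_closed) auto
  then show ?thesis
    unfolding omega_def quantum_euclidean_def FactRing_def A_RCOSETS_def' by auto
qed

end

theory Submission
  imports Defs
begin

text \<open>
  Put \<open>c = 1 - q\<^sup>-\<^sup>2\<close>. The elements \<open>\<omega>\<^sub>i\<close> commute with each other, they commute with the generators up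
  to powers of \<open>q\<^sup>2\<close>, and \<open>y\<^sub>i x\<^sub>i = (\<omega>\<^sub>i - \<omega>\<^sub>i\<^sub>-\<^sub>1) / c\<close>, \<open>x\<^sub>i y\<^sub>i = (\<omega>\<^sub>i - q\<^sup>-\<^sup>2 \<omega>\<^sub>i\<^sub>-\<^sub>1) / c\<close>. Hence the
  factor algebra is spanned by the products of a monomial in the \<open>\<omega>\<^sub>i\<close> with \<open>i \<noteq> p\<close> and a word which
  for each \<open>i\<close> contains only \<open>x\<^sub>i\<close> or only \<open>y\<^sub>i\<close>.

  For parameters \<open>W\<^sub>i\<close> and \<open>V\<^sub>i \<noteq> 0\<close> there is a representation by matrices of size \<open>m ^ (n - 2)\<close> in which
  \<open>\<omega>\<^sub>i\<close> is diagonal, with eigenvalues \<open>W\<^sub>i\<close> times even powers of \<open>q\<close>, and \<open>x\<^sub>i\<close> is \<open>V\<^sub>i\<close> times a monomial matrix.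
  The matrix entries of a nonzero element are Laurent polynomials in the parameters which do not all
  vanish, so the element is nonzero at generic parameters; and the representation is onto the full
  matrix algebra if all parameters are nonzero. Primeness follows: two nonzero elements are nonzero
  in a common surjective representation, where a matrix unit connects them. The standard identity
  of degree \<open>2 m ^ (n - 2)\<close> holds by the Amitsur--Levitzki theorem, and a full matrix algebra of this size
  satisfies no monic identity of smaller degree.
\<close>

section \<open>The Amitsur--Levitzki theorem\<close>

text \<open>The exponent counts eigenvalues. \<open>\<omega>\<^sub>p\<close> is 0 and
  \<open>\<omega>\<^sub>n\<close> commutes with all generators, so \<open>n - 2\<close> of the
  \<open>\<omega>\<^sub>i\<close> vary along the basis vectors; as \<open>m\<close> is odd,
  \<open>q\<^sup>2\<close> is still a primitive \<open>m\<close>-th root of unity, and each of them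
  takes \<open>m\<close> distinct eigenvalues. The \<open>x\<^sub>i\<close> need no further
  coordinates: their mutual factors \<open>q\<close> come from diagonal coefficients in the same
  coordinates. The obstacle is that the algebra is given by generators and relations, so it is not
  known in advance which elements are nonzero. Rewriting shows only that the standard monomials
  span; independence is read off from the representations, where the exponents of
  \<open>x\<^sub>i\<close>, \<open>y\<^sub>i\<close> reappear as exponents of
  \<open>V\<^sub>i\<close> and those of \<open>\<omega>\<^sub>i\<close> as exponents of
  \<open>W\<^sub>i\<close>. So no confluence has to be checked, and the ideal of relations turns out
  to be the common kernel of the matrix representations. Generic points over the field itself take
  the place of a function field; algebraic closedness makes the field infinite.\<close>

text \<open>
  Razmyslov's argument over the integers. A cycle of \<open>\<nu>\<close> stands for the trace of a product of matrices,
  so \<open>cyc_sum B L M \<nu>\<close> alternates a product of traces; the matrix \<open>M L\<close> is not permuted. Alternating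
  \<open>\<mu> \<circ> cyc_step L\<close> over the permutations \<open>\<mu>\<close> of the \<open>N + 1\<close> even positions gives \<open>0\<close>, because \<open>N + 1\<close> indices in a
  set of \<open>N\<close> elements are not distinct. In this sum, a cycle avoiding \<open>L\<close> alternates between even
  and odd positions, hence it is an odd permutation commuting with \<open>\<mu> \<circ> cyc_step L\<close> and the term vanishes;
  all other terms agree with the one for \<open>\<mu> = id\<close>.
\<close>

definition cyc_sum :: "'b set \<Rightarrow> nat \<Rightarrow> (nat \<Rightarrow> 'b \<Rightarrow> 'b \<Rightarrow> int) \<Rightarrow> (nat \<Rightarrow> nat) \<Rightarrow> int"
  where "cyc_sum B L M \<nu> =
    (\<Sum>\<tau> | \<tau> permutes {..<L}. sign \<tau> * (\<Sum>v\<in>{..L} \<rightarrow>\<^sub>E B. \<Prod>k\<le>L. M (\<tau> k) (v k) (v (\<nu> k))))"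

lemma permutes_lessThan_atMost: "\<kappa> permutes {..<L} \<Longrightarrow> \<kappa> permutes {..(L::nat)}"
  by (erule permutes_subset) auto

lemma sum_PiE_compose:
  assumes \<kappa>: "\<kappa> permutes A"
  shows "(\<Sum>v\<in>A \<rightarrow>\<^sub>E B. G (v \<circ> \<kappa>)) = (\<Sum>v\<in>A \<rightarrow>\<^sub>E B. G v)"
proof (rule sum.reindex_bij_witness[where i = "\<lambda>v. v \<circ> Hilbert_Choice.inv \<kappa>" and j = "\<lambda>v. v \<circ> \<kappa>"])
  fix v assume v: "v \<in> A \<rightarrow>\<^sub>E B"
  have inv: "Hilbert_Choice.inv \<kappa> permutes A" using \<kappa> by (rule permutes_inv)
  show "v \<circ> \<kappa> \<circ> Hilbert_Choice.inv \<kappa> = v" "v \<circ> Hilbert_Choice.inv \<kappa> \<circ> \<kappa> = v"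
    using permutes_inv_o[OF \<kappa>] by (simp_all add: comp_assoc)
  show "v \<circ> \<kappa> \<in> A \<rightarrow>\<^sub>E B"
    using v permutes_in_image[OF \<kappa>] by (auto simp: PiE_iff extensional_def)
  show "v \<circ> Hilbert_Choice.inv \<kappa> \<in> A \<rightarrow>\<^sub>E B"
    using v permutes_in_image[OF inv] by (auto simp: PiE_iff extensional_def)
qed simp

text \<open>Relabelling the positions by \<open>\<kappa>\<close> replaces \<open>v\<close> by
  \<open>v \<circ> \<kappa>\<close> and \<open>\<tau>\<close> by
  \<open>\<tau> \<circ> \<kappa>\<close>, and the sign of \<open>\<kappa>\<close> is left over.
  Because \<open>\<kappa>\<close> fixes \<open>L\<close>, \<open>\<tau> \<circ> \<kappa>\<close>
  again leaves the last matrix in place.\<close>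

lemma cyc_sum_conjugate:
  assumes \<kappa>: "\<kappa> permutes {..<L}"
  shows "cyc_sum B L M (\<kappa> \<circ> \<nu> \<circ> Hilbert_Choice.inv \<kappa>) = sign \<kappa> * cyc_sum B L M \<nu>"
proof -
  let ?T = "{\<tau>. \<tau> permutes {..<L}}"
  have \<kappa>': "\<kappa> permutes {..L}" using \<kappa> by (rule permutes_lessThan_atMost)
  have \<kappa>p: "permutation \<kappa>" using \<kappa> by (auto simp: permutation_permutes)
  have prod: "(\<Prod>k\<le>L. M (\<tau> k) (v k) (v ((\<kappa> \<circ> \<nu> \<circ> Hilbert_Choice.inv \<kappa>) k))) =
      (\<Prod>k\<le>L. M ((\<tau> \<circ> \<kappa>) k) ((v \<circ> \<kappa>) k) ((v \<circ> \<kappa>) (\<nu> k)))" for \<tau> v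
    by (subst prod.permute[OF \<kappa>']) (simp add: o_def permutes_inverses[OF \<kappa>])
  have inner: "(\<Sum>v\<in>{..L} \<rightarrow>\<^sub>E B. \<Prod>k\<le>L. M (\<tau> k) (v k) (v ((\<kappa> \<circ> \<nu> \<circ> Hilbert_Choice.inv \<kappa>) k))) =
      (\<Sum>v\<in>{..L} \<rightarrow>\<^sub>E B. \<Prod>k\<le>L. M ((\<tau> \<circ> \<kappa>) k) (v k) (v (\<nu> k)))" for \<tau>
    unfolding prod
    by (rule sum_PiE_compose[OF \<kappa>', where G = "\<lambda>v. \<Prod>k\<le>L. M ((\<tau> \<circ> \<kappa>) k) (v k) (v (\<nu> k))"])
  have sgn: "sign \<tau> = sign \<kappa> * sign (\<tau> \<circ> \<kappa>)" if "\<tau> \<in> ?T" for \<tau>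
  proof -
    have "permutation \<tau>" using that by (auto simp: permutation_permutes)
    then show ?thesis by (simp add: sign_compose \<kappa>p)
  qed
  have "cyc_sum B L M (\<kappa> \<circ> \<nu> \<circ> Hilbert_Choice.inv \<kappa>) = (\<Sum>\<tau>\<in>?T. sign \<kappa> * (sign (\<tau> \<circ> \<kappa>) *
      (\<Sum>v\<in>{..L} \<rightarrow>\<^sub>E B. \<Prod>k\<le>L. M ((\<tau> \<circ> \<kappa>) k) (v k) (v (\<nu> k)))))"
    unfolding cyc_sum_def inner by (rule sum.cong) (use sgn in \<open>auto simp: mult.assoc\<close>)
  also have "\<dots> = sign \<kappa> * cyc_sum B L M \<nu>"
    unfolding cyc_sum_def sum_distrib_left[symmetric]
    by (simp only: sum_permutations_compose_right[OF \<kappa>, where f =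
          "\<lambda>\<tau>. sign \<tau> * (\<Sum>v\<in>{..L} \<rightarrow>\<^sub>E B. \<Prod>k\<le>L. M (\<tau> k) (v k) (v (\<nu> k)))"])
  finally show ?thesis .
qed

text \<open>Composing \<open>\<mu>\<close> with the transposition of two points that
  \<open>v\<close> identifies does not change \<open>v \<circ> \<mu>\<close> but flips the sign, so
  the sum equals its negative.\<close>

lemma sum_sign_compose_eq_0:
  fixes v :: "'a \<Rightarrow> 'b" and g :: "('a \<Rightarrow> 'b) \<Rightarrow> int"
  assumes "finite H" "\<not> inj_on v H"
  shows "(\<Sum>\<mu> | \<mu> permutes H. sign \<mu> * g (v \<circ> \<mu>)) = 0"
proof -
  obtain u w where uw: "u \<in> H" "w \<in> H" "u \<noteq> w" "v u = v w"
    using assms(2) by (auto simp: inj_on_def)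
  let ?t = "Transposition.transpose u w"
  let ?S = "\<Sum>\<mu> | \<mu> permutes H. sign \<mu> * g (v \<circ> \<mu>)"
  have t: "?t permutes H" using uw by (intro permutes_swap_id)
  have vt: "v \<circ> ?t = v" using uw by (auto simp: fun_eq_iff Transposition.transpose_def)
  have "?S = (\<Sum>\<mu> | \<mu> permutes H. sign (?t \<circ> \<mu>) * g (v \<circ> (?t \<circ> \<mu>)))"
    by (rule setum_permutations_compose_left[OF t])
  also have "\<dots> = (\<Sum>\<mu> | \<mu> permutes H. - (sign \<mu> * g (v \<circ> \<mu>)))"
  proof (rule sum.cong[OF refl])
    fix \<mu> assume "\<mu> \<in> {\<mu>. \<mu> permutes H}"
    then have "permutation \<mu>" using assms(1) by (auto simp: permutation_permutes)
    then have "sign (?t \<circ> \<mu>) = - sign \<mu>"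
      using uw by (simp add: sign_compose permutation_swap_id sign_swap_id)
    moreover have "v \<circ> (?t \<circ> \<mu>) = v \<circ> \<mu>" by (metis comp_assoc vt)
    ultimately show "sign (?t \<circ> \<mu>) * g (v \<circ> (?t \<circ> \<mu>)) = - (sign \<mu> * g (v \<circ> \<mu>))"
      by simp
  qed
  also have "\<dots> = - ?S" by (simp add: sum_negf)
  finally show ?thesis by simp
qed

lemma alternating_sum_cyc_sum:
  assumes "finite B" "H \<subseteq> {..L}" "card B < card H" "finite H"
  shows "(\<Sum>\<mu> | \<mu> permutes H. sign \<mu> * cyc_sum B L M (\<mu> \<circ> \<nu>)) = 0"
proof -
  let ?H = "{\<mu>. \<mu> permutes H}" and ?T = "{\<tau>. \<tau> permutes {..<L}}"
  have fin: "finite ?H" "finite ?T" using assms(4) by (auto intro: finite_permutations)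
  have z: "(\<Sum>\<mu>\<in>?H. sign \<mu> * (\<Prod>k\<le>L. M (\<tau> k) (v k) (v ((\<mu> \<circ> \<nu>) k)))) = 0"
    if "v \<in> {..L} \<rightarrow>\<^sub>E B" for v \<tau>
  proof -
    have "\<not> inj_on v H"
    proof
      assume "inj_on v H"
      then have "card H \<le> card B"
        by (rule card_inj_on_le) (use that assms in auto)
      then show False using assms by simp
    qed
    from sum_sign_compose_eq_0[OF assms(4) this, where g = "\<lambda>w. \<Prod>k\<le>L. M (\<tau> k) (v k) (w (\<nu> k))"]
    show ?thesis by (simp add: o_def)
  qed
  have "(\<Sum>\<mu>\<in>?H. sign \<mu> * cyc_sum B L M (\<mu> \<circ> \<nu>)) =
     (\<Sum>\<mu>\<in>?H. \<Sum>\<tau>\<in>?T. \<Sum>v\<in>{..L} \<rightarrow>\<^sub>E B. sign \<tau> * (sign \<mu> * (\<Prod>k\<le>L. M (\<tau> k) (v k) (v ((\<mu> \<circ> \<nu>) k)))))"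
    unfolding cyc_sum_def by (simp add: sum_distrib_left mult_ac)
  also have "\<dots> = (\<Sum>\<tau>\<in>?T. \<Sum>v\<in>{..L} \<rightarrow>\<^sub>E B. \<Sum>\<mu>\<in>?H. sign \<tau> * (sign \<mu> * (\<Prod>k\<le>L. M (\<tau> k) (v k) (v ((\<mu> \<circ> \<nu>) k)))))"
    by (subst sum.swap, rule sum.cong[OF refl], subst sum.swap, rule refl)
  also have "\<dots> = 0"
    by (rule sum.neutral, rule ballI, rule sum.neutral, rule ballI)
       (simp only: sum_distrib_left[symmetric] z mult_zero_right)
  finally show ?thesis .
qed

lemma sign_cycle_of_list:
  "distinct cs \<Longrightarrow> cs \<noteq> [] \<Longrightarrow> sign (cycle_of_list cs) = (- 1) ^ (length cs - 1)"
proof (induction cs rule: cycle_of_list.induct)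
  case (1 i j cs)
  have "sign (cycle_of_list (i # j # cs)) =
      sign (Transposition.transpose i j) * sign (cycle_of_list (j # cs))"
    unfolding cycle_of_list.simps
    by (rule sign_compose[OF permutation_swap_id permutation_of_cycle])
  then show ?case using 1 by (simp add: sign_swap_id del: cycle_of_list.simps)
qed auto

text \<open>\<open>\<kappa>\<close> moves the pairs \<open>2 i, 2 i + 1\<close> as blocks. Its
  effects \<open>e\<close> on the even and \<open>o'\<close> on the odd positions are conjugate by
  the involution \<open>\<theta>\<close> that swaps the members of each pair, so the two signs agree
  and their product is 1.\<close>

lemma sign_pair_permutation:
  assumes \<kappa>: "\<kappa> permutes {..<2 * N}"
    and even: "\<And>k. k < 2 * N \<Longrightarrow> even k \<Longrightarrow> even (\<kappa> k) \<and> \<kappa> (Suc k) = Suc (\<kappa> k)"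
  shows "sign \<kappa> = 1"
proof -
  define e where "e k = (if even k then \<kappa> k else k)" for k
  define o' where "o' k = (if odd k then \<kappa> k else k)" for k
  define \<theta> where "\<theta> k = (if k < 2 * N then if even k then Suc k else k - 1 else k)" for k
  have \<kappa>out: "\<kappa> k = k" if "k \<ge> 2 * N" for k
    using \<kappa> that by (auto simp: permutes_def)
  have \<kappa>in: "\<kappa> k < 2 * N" if "k < 2 * N" for k
    using permutes_in_image[OF \<kappa>, of k] that by simp
  have \<kappa>odd: "odd (\<kappa> k) \<and> \<kappa> k = Suc (\<kappa> (k - 1))" if "k < 2 * N" "odd k" for k
    using even[of "k - 1"] that by (cases k) auto
  have inj: "\<kappa> x = \<kappa> y \<longleftrightarrow> x = y" for x y
    using permutes_inj[OF \<kappa>] by (auto dest: injD)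
  have \<theta>: "\<theta> permutes {..<2 * N}"
  proof (rule bij_imp_permutes)
    have "Suc k < 2 * N" if "k < 2 * N" "even k" for k
      using that by presburger
    then have "\<theta> (\<theta> k) = k" for k
      by (cases k) (auto simp: \<theta>_def)
    moreover have "\<theta> ` {..<2 * N} \<subseteq> {..<2 * N}"
      by (auto simp: \<theta>_def)
    ultimately show "bij_betw \<theta> {..<2 * N} {..<2 * N}"
      by (intro bij_betw_byWitness[where f' = \<theta>]) auto
  qed (auto simp: \<theta>_def)
  have e: "e permutes {..<2 * N}"
  proof (rule bij_imp_permutes)
    have "inj_on e {..<2 * N}"
      using even by (auto simp: inj_on_def e_def inj split: if_splits)
    moreover have "e ` {..<2 * N} \<subseteq> {..<2 * N}" by (auto simp: e_def \<kappa>in)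
    ultimately show "bij_betw e {..<2 * N} {..<2 * N}"
      by (simp add: bij_betw_def endo_inj_surj)
  qed (auto simp: e_def \<kappa>out)
  have o_eq: "o' = \<theta> \<circ> e \<circ> \<theta>"
  proof
    fix k
    show "o' k = (\<theta> \<circ> e \<circ> \<theta>) k"
    proof (cases "k < 2 * N")
      case True
      show ?thesis
      proof (cases "even k")
        case True
        then show ?thesis using \<open>k < 2 * N\<close> by (auto simp: o'_def \<theta>_def e_def elim!: evenE)
      next
        case False
        then have "\<theta> k = k - 1" "even (k - 1)" "k - 1 < 2 * N"
          using \<open>k < 2 * N\<close> by (auto simp: \<theta>_def)
        moreover have "even (\<kappa> (k - 1))" "\<kappa> (k - 1) < 2 * N"
          using even[of "k - 1"] \<kappa>in[of "k - 1"] calculation by auto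
        moreover have "\<kappa> k = Suc (\<kappa> (k - 1))" using \<kappa>odd[of k] False True by simp
        ultimately show ?thesis using False by (simp add: o'_def e_def \<theta>_def)
      qed
    qed (simp add: o'_def \<theta>_def e_def \<kappa>out)
  qed
  have perms: "permutation \<theta>" "permutation e"
    using \<theta> e by (auto simp: permutation_permutes)
  have "\<kappa> = e \<circ> o'"
  proof
    fix k
    show "\<kappa> k = (e \<circ> o') k"
      using \<kappa>odd[of k] \<kappa>out[of k] by (cases "k < 2 * N") (auto simp: e_def o'_def)
  qed
  also have "\<dots> = e \<circ> (\<theta> \<circ> (e \<circ> \<theta>))" unfolding o_eq by (simp add: comp_assoc)
  finally have "sign \<kappa> = sign e * (sign \<theta> * (sign e * sign \<theta>))"
    using perms by (simp add: sign_compose permutation_compose)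
  then show ?thesis by (simp add: mult.left_commute)
qed

definition cyc_step :: "nat \<Rightarrow> nat \<Rightarrow> nat"
  where "cyc_step L k = (if k < L then Suc k else if k = L then 0 else k)"

lemma cyc_step_permutes: "cyc_step L permutes {..L}"
proof (rule bij_imp_permutes)
  have "inj_on (cyc_step L) {..L}"
    by (auto simp: inj_on_def cyc_step_def split: if_splits)
  moreover have "cyc_step L ` {..L} \<subseteq> {..L}" by (auto simp: cyc_step_def)
  ultimately show "bij_betw (cyc_step L) {..L} {..L}"
    by (simp add: bij_betw_def endo_inj_surj)
qed (auto simp: cyc_step_def)

lemma cyc_sum_eq_0_if_not_transitive:
  assumes \<mu>: "\<mu> permutes {k. k \<le> 2 * N \<and> even k}" and k0: "k0 \<le> 2 * N"
    and avoid: "\<And>i. ((\<mu> \<circ> cyc_step (2 * N)) ^^ i) k0 \<noteq> 2 * N"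
  shows "cyc_sum B (2 * N) M (\<mu> \<circ> cyc_step (2 * N)) = 0"
proof -
  let ?L = "2 * N"
  define \<nu> where "\<nu> = \<mu> \<circ> cyc_step ?L"
  have \<nu>: "\<nu> permutes {..?L}"
    unfolding \<nu>_def
    by (rule permutes_compose[OF cyc_step_permutes permutes_subset[OF \<mu>]]) auto
  have \<nu>p: "permutation \<nu>" using \<nu> by (auto simp: permutation_permutes)
  \<comment> \<open>\<open>\<mu>\<close> fixes odd positions, so an even \<open>k < 2 * N\<close>
    goes to \<open>k + 1\<close>, while an odd one goes to an even position.\<close>
  have parity: "even (\<nu> k) \<longleftrightarrow> odd k" if "k < ?L" for k
  proof (cases "even k")
    case True
    then have "\<nu> k = Suc k" using that \<mu> by (simp add: \<nu>_def cyc_step_def permutes_def)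
    then show ?thesis using True by simp
  next
    case False
    then have "Suc k \<in> {k. k \<le> ?L \<and> even k}" using that by simp
    then have "\<mu> (Suc k) \<in> {k. k \<le> ?L \<and> even k}" using permutes_in_image[OF \<mu>] by blast
    then show ?thesis using that False by (simp add: \<nu>_def cyc_step_def)
  qed
  have below: "(\<nu> ^^ i) k0 < ?L" for i
  proof -
    have "(\<nu> ^^ i) k0 \<in> {..?L}" using permutes_in_image[OF permutes_funpow[OF \<nu>]] k0 by simp
    then show ?thesis using avoid[of i] unfolding \<nu>_def[symmetric] by (simp add: le_less)
  qed
  have par: "even ((\<nu> ^^ i) k0) \<longleftrightarrow> (even i \<longleftrightarrow> even k0)" for i
    by (induction i) (use parity[OF below] in auto)
  define cs where "cs = support \<nu> k0"
  have len: "length cs = least_power \<nu> k0" by (simp add: cs_def)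
  have "even (length cs)"
    using par[of "least_power \<nu> k0"] least_power_of_permutation(1)[OF \<nu>p, of k0] len by auto
  moreover have ne: "length cs > 0"
    using least_power_of_permutation(2)[OF \<nu>p, of k0] len by simp
  moreover have dist: "distinct cs" unfolding cs_def by (rule cycle_of_permutation[OF \<nu>p])
  ultimately have sgn: "sign (cycle_of_list cs) = - 1"
    by (subst sign_cycle_of_list) (auto elim!: evenE)
  let ?\<kappa> = "cycle_of_list cs"
  have set_cs: "set cs = range (\<lambda>i. (\<nu> ^^ i) k0)"
    unfolding cs_def by (rule support_set[OF \<nu>p])
  have \<kappa>: "?\<kappa> permutes {..<?L}"
    by (rule permutes_subset[OF cycle_permutes]) (use below in \<open>auto simp: set_cs\<close>)
  have mem: "\<nu> x \<in> set cs \<longleftrightarrow> x \<in> set cs" for x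
  proof
    assume "x \<in> set cs"
    then obtain i where "x = (\<nu> ^^ i) k0" by (auto simp: set_cs)
    then have "\<nu> x = (\<nu> ^^ Suc i) k0" by simp
    then show "\<nu> x \<in> set cs" unfolding set_cs by blast
  next
    assume "\<nu> x \<in> set cs"
    then obtain i where i: "\<nu> x = (\<nu> ^^ i) k0" by (auto simp: set_cs)
    have inj: "inj \<nu>" using \<nu> by (rule permutes_inj)
    show "x \<in> set cs"
    proof (cases i)
      case 0
      have "\<nu> x = (\<nu> ^^ least_power \<nu> k0) k0"
        using i 0 least_power_of_permutation(1)[OF \<nu>p, of k0] by simp
      also have "\<dots> = \<nu> ((\<nu> ^^ (least_power \<nu> k0 - 1)) k0)"
        using ne len by (cases "least_power \<nu> k0") auto
      finally have "x = (\<nu> ^^ (least_power \<nu> k0 - 1)) k0" using inj by (auto dest: injD)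
      then show ?thesis unfolding set_cs by blast
    next
      case (Suc j)
      then have "x = (\<nu> ^^ j) k0" using i inj by (auto dest: injD)
      then show ?thesis unfolding set_cs by blast
    qed
  qed
  have "?\<kappa> (\<nu> x) = \<nu> (?\<kappa> x)" for x
  proof (cases "x \<in> set cs")
    case True
    then show ?thesis
      using cycle_restrict[OF \<nu>p, of x k0] cycle_restrict[OF \<nu>p, of "\<nu> x" k0] mem[of x]
      unfolding cs_def[symmetric] by metis
  next
    case False
    then show ?thesis using mem by (simp add: id_outside_supp)
  qed
  then have "?\<kappa> \<circ> \<nu> \<circ> Hilbert_Choice.inv ?\<kappa> = \<nu>"
    using permutes_inverses(1)[OF \<kappa>] by (metis (no_types, lifting) comp_apply ext)
  \<comment> \<open>The conjugating cycle is odd and commutes with \<open>\<nu>\<close>, so the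
    integer equals its own negative; here the factor 2 is cancelled.\<close>
  then have "cyc_sum B ?L M \<nu> = - cyc_sum B ?L M \<nu>"
    using cyc_sum_conjugate[OF \<kappa>, of B M \<nu>] sgn by simp
  then show ?thesis unfolding \<nu>_def by simp
qed

text \<open>Transitivity makes \<open>\<nu>\<close> a single cycle of length \<open>L + 1\<close>,
  hence conjugate to \<open>cyc_step L\<close>. The conjugating \<open>\<kappa>\<close> can be
  chosen to fix \<open>L\<close>; it then carries pairs \<open>2 i, 2 i + 1\<close> to such pairs
  and is even. This gives both \<open>sign \<mu> = 1\<close> and the equality of the two values of
  \<open>cyc_sum\<close>.\<close>

lemma cyc_sum_transitive:
  assumes \<mu>: "\<mu> permutes {k. k \<le> 2 * N \<and> even k}"
    and trans: "\<And>k. k \<le> 2 * N \<Longrightarrow> \<exists>i. ((\<mu> \<circ> cyc_step (2 * N)) ^^ i) k = 2 * N"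
  shows "sign \<mu> * cyc_sum B (2 * N) M (\<mu> \<circ> cyc_step (2 * N)) = cyc_sum B (2 * N) M (cyc_step (2 * N))"
proof -
  let ?L = "2 * N" and ?c = "cyc_step (2 * N)"
  define \<nu> where "\<nu> = \<mu> \<circ> cyc_step ?L"
  have \<nu>: "\<nu> permutes {..?L}"
    unfolding \<nu>_def
    by (rule permutes_compose[OF cyc_step_permutes permutes_subset[OF \<mu>]]) auto
  have \<nu>p: "permutation \<nu>" using \<nu> by (auto simp: permutation_permutes)
  define r where "r = least_power \<nu> ?L"
  have r: "(\<nu> ^^ r) ?L = ?L" "r > 0"
    unfolding r_def using least_power_of_permutation[OF \<nu>p] by auto
  have set_sup: "set (support \<nu> ?L) = range (\<lambda>i. (\<nu> ^^ i) ?L)"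
    by (rule support_set[OF \<nu>p])
  have "set (support \<nu> ?L) = {..?L}"
  proof
    show "set (support \<nu> ?L) \<subseteq> {..?L}"
      unfolding set_sup using permutes_in_image[OF permutes_funpow[OF \<nu>]] by auto
    show "{..?L} \<subseteq> set (support \<nu> ?L)"
    proof
      fix k assume "k \<in> {..?L}"
      then obtain i where i: "(\<nu> ^^ i) k = ?L" using trans unfolding \<nu>_def by auto
      obtain n where n: "(\<nu> ^^ n) = id" "n > i" using permutation_is_nilpotent'[OF \<nu>p] by blast
      have "(\<nu> ^^ (n - i)) ?L = (\<nu> ^^ (n - i)) ((\<nu> ^^ i) k)" by (simp add: i)
      also have "\<dots> = (\<nu> ^^ (n - i + i)) k" by (simp add: funpow_add)
      also have "\<dots> = k" using n by simp
      finally show "k \<in> set (support \<nu> ?L)" unfolding set_sup by (metis rangeI)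
    qed
  qed
  then have "length (support \<nu> ?L) = card {..?L}"
    using distinct_card[OF cycle_of_permutation[OF \<nu>p], of ?L] by simp
  then have rL: "r = Suc ?L" by (simp add: r_def)
  \<comment> \<open>The exponent \<open>Suc j\<close> makes \<open>\<kappa>\<close> fix
    \<open>L\<close>, since \<open>\<nu>\<close> returns to \<open>L\<close> after
    \<open>L + 1\<close> steps.\<close>
  define \<kappa> where "\<kappa> j = (if j \<le> ?L then (\<nu> ^^ Suc j) ?L else j)" for j
  have \<kappa>L: "\<kappa> ?L = ?L" using r rL by (simp add: \<kappa>_def)
  have "\<kappa> permutes {..?L}"
  proof (rule bij_imp_permutes)
    have "\<kappa> ` {..?L} = {..?L}"
    proof
      show "\<kappa> ` {..?L} \<subseteq> {..?L}"
        using permutes_in_image[OF permutes_funpow[OF \<nu>]] by (auto simp: \<kappa>_def simp del: funpow.simps)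
      show "{..?L} \<subseteq> \<kappa> ` {..?L}"
      proof
        fix k assume "k \<in> {..?L}"
        then obtain i where i: "i < r" "k = (\<nu> ^^ i) ?L"
          using \<open>set (support \<nu> ?L) = {..?L}\<close> unfolding r_def by (fastforce simp: set_eq_iff image_iff)
        show "k \<in> \<kappa> ` {..?L}"
        proof (cases i)
          case 0
          then show ?thesis using i \<kappa>L by (auto intro!: image_eqI[of _ _ ?L])
        next
          case (Suc j)
          then show ?thesis using i rL by (intro image_eqI[of _ _ j]) (auto simp: \<kappa>_def)
        qed
      qed
    qed
    then show "bij_betw \<kappa> {..?L} {..?L}"
      by (simp add: bij_betw_def eq_card_imp_inj_on)
  qed (auto simp: \<kappa>_def)
  then have \<kappa>: "\<kappa> permutes {..<?L}"
    by (rule permutes_superset) (use \<kappa>L in auto)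
  have comm: "\<kappa> (?c j) = \<nu> (\<kappa> j)" for j
  proof (cases "j < ?L")
    case False
    show ?thesis
    proof (cases "j = ?L")
      case True
      then show ?thesis using \<kappa>L by (simp add: cyc_step_def \<kappa>_def)
    next
      case False
      then show ?thesis using \<open>\<not> j < ?L\<close> permutes_not_in[OF \<nu>, of j] by (simp add: cyc_step_def \<kappa>_def)
    qed
  qed (simp add: cyc_step_def \<kappa>_def)
  have sgn\<kappa>: "sign \<kappa> = 1"
  proof (rule sign_pair_permutation[OF \<kappa>])
    fix k assume k: "k < ?L" "even k"
    have lt: "\<kappa> j < ?L" if "j < ?L" for j using permutes_in_image[OF \<kappa>, of j] that by simp
    have \<mu>H: "even (\<mu> j)" if "even j" for j
      using permutes_in_image[OF \<mu>, of j] permutes_not_in[OF \<mu>, of j] that by (cases "j \<le> ?L") auto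
    have "even (\<kappa> (2 * i))" if "2 * i < ?L" for i
      using that
    proof (induction i)
      case 0
      then show ?case using \<mu>H by (simp add: \<kappa>_def \<nu>_def cyc_step_def)
    next
      case (Suc i)
      then have i: "2 * i < ?L" "even (\<kappa> (2 * i))" "Suc (2 * i) < ?L" by auto
      have "\<kappa> (Suc (2 * i)) = Suc (\<kappa> (2 * i))"
        using comm[of "2 * i"] i lt[OF i(1)] \<mu> by (simp add: \<nu>_def cyc_step_def permutes_def)
      moreover have "\<kappa> (2 * Suc i) = \<mu> (?c (\<kappa> (Suc (2 * i))))"
        using comm[of "Suc (2 * i)"] i by (simp add: \<nu>_def cyc_step_def)
      ultimately show ?case using i lt[OF i(3)] by (simp add: cyc_step_def \<mu>H)
    qed
    then have ev: "even (\<kappa> k)" using k by (auto elim!: evenE)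
    then have "\<nu> (\<kappa> k) = Suc (\<kappa> k)" using lt[OF k(1)] \<mu> by (simp add: \<nu>_def cyc_step_def permutes_def)
    then show "even (\<kappa> k) \<and> \<kappa> (Suc k) = Suc (\<kappa> k)"
      using ev comm[of k] k by (simp add: cyc_step_def)
  qed
  have eq: "\<nu> = \<kappa> \<circ> ?c \<circ> Hilbert_Choice.inv \<kappa>"
    using comm permutes_inverses(1)[OF \<kappa>] by (metis (no_types, lifting) comp_apply ext)
  have \<kappa>p: "permutation \<kappa>" "permutation \<mu>" "permutation ?c"
    using \<kappa> permutation_permutes cyc_step_permutes permutes_subset[OF \<mu>, of "{..?L}"] by blast+
  have "sign \<nu> = sign ?c"
    unfolding eq using \<kappa>p sgn\<kappa> by (simp add: sign_compose permutation_compose permutation_inverse sign_inverse)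
  moreover have "sign \<nu> = sign \<mu> * sign ?c" unfolding \<nu>_def using \<kappa>p by (simp add: sign_compose)
  ultimately have "sign \<mu> = 1" by simp
  moreover have "cyc_sum B ?L M \<nu> = cyc_sum B ?L M ?c"
    unfolding eq using cyc_sum_conjugate[OF \<kappa>] sgn\<kappa> by simp
  ultimately show ?thesis by (simp add: \<nu>_def)
qed

text \<open>The vanishing alternating sum is the wanted value times the number of transitive
  \<open>\<mu>\<close>, and this number is positive because \<open>id\<close> is one of
  them.\<close>

lemma cyc_sum_cyc_step_eq_0:
  assumes "finite B" "card B = N"
  shows "cyc_sum B (2 * N) M (cyc_step (2 * N)) = 0"
proof -
  let ?H = "{k. k \<le> 2 * N \<and> even k}" and ?c = "cyc_step (2 * N)"
  define good where "good \<mu> \<longleftrightarrow> (\<forall>k\<le>2 * N. \<exists>i. ((\<mu> \<circ> ?c) ^^ i) k = 2 * N)" for \<mu>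
  have "?H = (\<lambda>i. 2 * i) ` {..N}" by (auto elim!: evenE)
  then have H: "card ?H = Suc N" "finite ?H"
    by (simp_all add: card_image inj_on_def)
  have fin: "finite {\<mu>. \<mu> permutes ?H}" using H by (simp add: finite_permutations)
  have "0 = (\<Sum>\<mu> | \<mu> permutes ?H. sign \<mu> * cyc_sum B (2 * N) M (\<mu> \<circ> ?c))"
    by (rule alternating_sum_cyc_sum[symmetric]) (use assms H in auto)
  also have "\<dots> = (\<Sum>\<mu> | \<mu> permutes ?H. if good \<mu> then cyc_sum B (2 * N) M ?c else 0)"
  proof (rule sum.cong[OF refl], clarify)
    fix \<mu> assume \<mu>: "\<mu> permutes ?H"
    show "sign \<mu> * cyc_sum B (2 * N) M (\<mu> \<circ> ?c) = (if good \<mu> then cyc_sum B (2 * N) M ?c else 0)"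
      using cyc_sum_transitive[OF \<mu>, of B M] cyc_sum_eq_0_if_not_transitive[OF \<mu>, of _ B M]
      unfolding good_def by (auto simp: mult_eq_0_iff)
  qed
  also have "\<dots> = (\<Sum>\<mu> | \<mu> permutes ?H \<and> good \<mu>. cyc_sum B (2 * N) M ?c)"
    using sum.inter_filter[OF fin, of "\<lambda>_. cyc_sum B (2 * N) M ?c" good] by simp
  also have "\<dots> = of_nat (card {\<mu>. \<mu> permutes ?H \<and> good \<mu>}) * cyc_sum B (2 * N) M ?c" by simp
  finally have "card {\<mu>. \<mu> permutes ?H \<and> good \<mu>} = 0 \<or> cyc_sum B (2 * N) M ?c = 0" by auto
  moreover have "id \<in> {\<mu>. \<mu> permutes ?H \<and> good \<mu>}"
  proof -
    have "(?c ^^ i) k = k + i" if "k + i \<le> 2 * N" for i k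
      using that by (induction i) (auto simp: cyc_step_def)
    then have "(?c ^^ (2 * N - k)) k = 2 * N" if "k \<le> 2 * N" for k using that by simp
    then have "good id" unfolding good_def by (auto simp del: funpow.simps)
    then show ?thesis by (simp add: permutes_id)
  qed
  moreover have "finite {\<mu>. \<mu> permutes ?H \<and> good \<mu>}" using fin by simp
  ultimately show ?thesis by auto
qed

section \<open>Matrix products as sums over index paths\<close>

fun mat_prod :: "'b set \<Rightarrow> ('b \<Rightarrow> 'b \<Rightarrow> 'k::comm_ring_1) list \<Rightarrow> 'b \<Rightarrow> 'b \<Rightarrow> 'k"
  where
    "mat_prod B [] a b = (if a = b then 1 else 0)"
  | "mat_prod B (M # Ms) a b = (\<Sum>c\<in>B. M a c * mat_prod B Ms c b)"

lemma mat_prod_append: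
  assumes "finite B" "a \<in> B"
  shows "mat_prod B (Ms @ Ns) a b = (\<Sum>c\<in>B. mat_prod B Ms a c * mat_prod B Ns c b)"
  using assms(2)
proof (induction Ms arbitrary: a)
  case Nil
  then show ?case using assms(1) by (simp add: if_distrib if_distribR sum.delta cong: if_cong)
next
  case (Cons M Ms)
  have "mat_prod B ((M # Ms) @ Ns) a b =
      (\<Sum>c\<in>B. \<Sum>d\<in>B. M a c * (mat_prod B Ms c d * mat_prod B Ns d b))"
    using Cons.IH by (simp add: sum_distrib_left)
  also have "\<dots> = (\<Sum>d\<in>B. \<Sum>c\<in>B. M a c * (mat_prod B Ms c d * mat_prod B Ns d b))"
    by (rule sum.swap)
  finally show ?case by (simp add: sum_distrib_right mult.assoc)
qed

definition paths :: "'b set \<Rightarrow> nat \<Rightarrow> 'b \<Rightarrow> 'b \<Rightarrow> (nat \<Rightarrow> 'b) set"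
  where "paths B L a b = {v \<in> {..L} \<rightarrow>\<^sub>E B. v 0 = a \<and> v L = b}"

lemma mat_prod_eq_sum_paths:
  assumes "finite B" "a \<in> B" "b \<in> B"
  shows "mat_prod B (map M [0..<L]) a b = (\<Sum>v\<in>paths B L a b. \<Prod>k<L. M k (v k) (v (Suc k)))"
  using assms(3)
proof (induction L arbitrary: b)
  case 0
  show ?case
  proof (cases "a = b")
    case True
    have "paths B 0 a b = {\<lambda>k. if k = 0 then a else undefined}"
      using True assms by (auto simp: paths_def PiE_iff extensional_def fun_eq_iff)
    then show ?thesis using True by simp
  next
    case False
    then have "paths B 0 a b = {}" by (auto simp: paths_def)
    then show ?thesis using False by simp
  qed
next
  case (Suc L)
  have fin: "finite (paths B L a c)" for c
    unfolding paths_def using assms(1) by (simp add: finite_PiE)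
  have "mat_prod B (map M [0..<Suc L]) a b = (\<Sum>c\<in>B. mat_prod B (map M [0..<L]) a c * M L c b)"
    using Suc.prems assms by (simp add: mat_prod_append if_distrib sum.delta' cong: if_cong)
  also have "\<dots> = (\<Sum>c\<in>B. \<Sum>v\<in>paths B L a c. (\<Prod>k<L. M k (v k) (v (Suc k))) * M L (v L) b)"
    using Suc.IH by (intro sum.cong) (auto simp: sum_distrib_right paths_def)
  also have "\<dots> = (\<Sum>(c, v)\<in>(SIGMA c:B. paths B L a c). (\<Prod>k<L. M k (v k) (v (Suc k))) * M L (v L) b)"
    by (rule sum.Sigma) (use assms fin in auto)
  also have "\<dots> = (\<Sum>v\<in>paths B (Suc L) a b. \<Prod>k<Suc L. M k (v k) (v (Suc k)))"
  proof (rule sum.reindex_bij_witness[where i = "\<lambda>w. (w L, w(Suc L := undefined))"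
        and j = "\<lambda>(c, v). v(Suc L := b)"])
    fix x assume "x \<in> (SIGMA c:B. paths B L a c)"
    then obtain c v where x: "x = (c, v)" "c \<in> B" "v \<in> paths B L a c" by auto
    then have v: "v \<in> {..L} \<rightarrow>\<^sub>E B" "v 0 = a" "v L = c" by (auto simp: paths_def)
    have und: "v (Suc L) = undefined" using v by (auto simp: PiE_iff extensional_def)
    show "((case x of (c, v) \<Rightarrow> v(Suc L := b)) L, (case x of (c, v) \<Rightarrow> v(Suc L := b))(Suc L := undefined)) = x"
      using x v und by (auto simp: fun_eq_iff)
    show "(case x of (c, v) \<Rightarrow> v(Suc L := b)) \<in> paths B (Suc L) a b"
      using x v Suc.prems by (auto simp: paths_def PiE_iff extensional_def le_Suc_eq)
    show "(\<Prod>k<Suc L. M k ((case x of (c, v) \<Rightarrow> v(Suc L := b)) k) ((case x of (c, v) \<Rightarrow> v(Suc L := b)) (Suc k))) =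
        (case x of (c, v) \<Rightarrow> (\<Prod>k<L. M k (v k) (v (Suc k))) * M L (v L) b)"
      using x by (auto intro!: arg_cong2[where f = "(*)"] prod.cong)
  next
    fix w assume "w \<in> paths B (Suc L) a b"
    then have w: "w \<in> {..Suc L} \<rightarrow>\<^sub>E B" "w 0 = a" "w (Suc L) = b" by (auto simp: paths_def)
    then show "(case (w L, w(Suc L := undefined)) of (c, v) \<Rightarrow> v(Suc L := b)) = w"
      by (auto simp: fun_eq_iff)
    show "(w L, w(Suc L := undefined)) \<in> (SIGMA c:B. paths B L a c)"
      using w by (auto simp: paths_def PiE_iff extensional_def)
  qed
  finally show ?case .
qed

text \<open>The entry \<open>(a, b)\<close> of a product becomes a trace after multiplication with
  the matrix unit at \<open>(b, a)\<close>; this unit serves as the unpermuted last factor of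
  \<open>cyc_sum\<close>.\<close>

lemma amitsur_levitzki_int:
  fixes M :: "nat \<Rightarrow> 'b \<Rightarrow> 'b \<Rightarrow> int"
  assumes "finite B" "a \<in> B" "b \<in> B"
  defines "L \<equiv> 2 * card B"
  shows "(\<Sum>\<tau> | \<tau> permutes {..<L}. sign \<tau> *
    (\<Sum>v\<in>paths B L a b. \<Prod>k<L. M (\<tau> k) (v k) (v (Suc k)))) = 0"
proof -
  define M' where "M' k = (if k < L then M k else (\<lambda>x y. if x = b \<and> y = a then 1 else 0))" for k
  have "(\<Sum>v\<in>paths B L a b. \<Prod>k<L. M (\<tau> k) (v k) (v (Suc k))) =
      (\<Sum>v\<in>{..L} \<rightarrow>\<^sub>E B. \<Prod>k\<le>L. M' (\<tau> k) (v k) (v (cyc_step L k)))" if "\<tau> permutes {..<L}" for \<tau>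
  proof (rule sum.mono_neutral_cong_left)
    have \<tau>L: "\<tau> L = L" using that by (simp add: permutes_def)
    have \<tau>: "\<tau> k < L" if "k < L" for k using permutes_in_image[OF \<open>\<tau> permutes {..<L}\<close>, of k] that by simp
    have split: "(\<Prod>k\<le>L. M' (\<tau> k) (v k) (v (cyc_step L k))) =
       (\<Prod>k<L. M (\<tau> k) (v k) (v (Suc k))) * (if v L = b \<and> v 0 = a then 1 else 0)" for v
      unfolding lessThan_Suc_atMost[symmetric] prod.lessThan_Suc
      by (intro arg_cong2[where f = "(*)"] prod.cong) (auto simp: M'_def \<tau> \<tau>L cyc_step_def)
    show "finite ({..L} \<rightarrow>\<^sub>E B)" using assms by (simp add: finite_PiE)
    show "paths B L a b \<subseteq> {..L} \<rightarrow>\<^sub>E B" by (auto simp: paths_def)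
    show "\<forall>v\<in>({..L} \<rightarrow>\<^sub>E B) - paths B L a b. (\<Prod>k\<le>L. M' (\<tau> k) (v k) (v (cyc_step L k))) = 0"
      unfolding split by (auto simp: paths_def)
    show "(\<Prod>k<L. M (\<tau> k) (v k) (v (Suc k))) = (\<Prod>k\<le>L. M' (\<tau> k) (v k) (v (cyc_step L k)))"
      if "v \<in> paths B L a b" for v
      unfolding split using that by (auto simp: paths_def)
  qed
  then have "(\<Sum>\<tau> | \<tau> permutes {..<L}. sign \<tau> * (\<Sum>v\<in>paths B L a b. \<Prod>k<L. M (\<tau> k) (v k) (v (Suc k)))) =
      cyc_sum B L M' (cyc_step L)"
    unfolding cyc_sum_def by (intro sum.cong) auto
  then show ?thesis using cyc_sum_cyc_step_eq_0[OF assms(1) refl, of M'] unfolding L_def by simp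
qed

text \<open>
  Expanding in matrix units reduces the theorem to integer matrices; over the integers, the factor
  \<open>2\<close> and the number of terms could be cancelled.
\<close>

theorem amitsur_levitzki:
  fixes M :: "nat \<Rightarrow> 'b \<Rightarrow> 'b \<Rightarrow> 'k::comm_ring_1"
  assumes "finite B" "a \<in> B" "b \<in> B"
  defines "L \<equiv> 2 * card B"
  shows "(\<Sum>\<tau> | \<tau> permutes {..<L}. of_int (sign \<tau>) * mat_prod B (map (\<lambda>k. M (\<tau> k)) [0..<L]) a b) = 0"
proof -
  let ?T = "{\<tau>. \<tau> permutes {..<L}}" and ?V = "paths B L a b" and ?E = "{..<L} \<rightarrow>\<^sub>E B \<times> B"
  let ?\<delta> = "\<lambda>e \<tau> v k. if e (\<tau> k) = (v k, v (Suc k)) then 1 else 0"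
  \<comment> \<open>\<open>e\<close> chooses one entry of each matrix. The product of the chosen
    entries depends neither on \<open>\<tau>\<close> nor on the path; what remains is the path
    product of the corresponding matrix units, an integer.\<close>
  have expand: "(\<Prod>k<L. M (\<tau> k) (v k) (v (Suc k))) =
      (\<Sum>e\<in>?E. (\<Prod>g<L. M g (fst (e g)) (snd (e g))) * of_int (\<Prod>k<L. ?\<delta> e \<tau> v k))"
    if \<tau>: "\<tau> permutes {..<L}" and v: "v \<in> ?V" for \<tau> v
  proof -
    have vB: "v k \<in> B" if "k \<le> L" for k using v that by (auto simp: paths_def PiE_iff)
    let ?w = "\<lambda>g. (v (Hilbert_Choice.inv \<tau> g), v (Suc (Hilbert_Choice.inv \<tau> g)))"
    have inv: "Hilbert_Choice.inv \<tau> permutes {..<L}" using \<tau> by (rule permutes_inv)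
    have invL: "Hilbert_Choice.inv \<tau> g < L" if "g < L" for g
      using permutes_in_image[OF inv, of g] that by simp
    have "(\<Prod>k<L. M (\<tau> k) (v k) (v (Suc k))) = (\<Prod>g<L. M g (fst (?w g)) (snd (?w g)))"
      by (subst prod.permute[OF inv]) (simp add: o_def permutes_inverses[OF \<tau>])
    also have "\<dots> = (\<Prod>g<L. \<Sum>x\<in>B \<times> B. M g (fst x) (snd x) * (if x = ?w g then 1 else 0))"
    proof (rule prod.cong[OF refl])
      fix g assume "g \<in> {..<L}"
      then have "?w g \<in> B \<times> B" using invL[of g] vB by auto
      moreover have "finite (B \<times> B)" using assms by simp
      ultimately show "M g (fst (?w g)) (snd (?w g)) =
          (\<Sum>x\<in>B \<times> B. M g (fst x) (snd x) * (if x = ?w g then 1 else 0))"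
        by (simp add: if_distrib sum.delta' cong: if_cong)
    qed
    also have "\<dots> = (\<Sum>e\<in>?E. \<Prod>g<L. M g (fst (e g)) (snd (e g)) * (if e g = ?w g then 1 else 0))"
      by (rule prod_sum_PiE) (use assms in auto)
    also have "\<dots> = (\<Sum>e\<in>?E. (\<Prod>g<L. M g (fst (e g)) (snd (e g))) * of_int (\<Prod>k<L. ?\<delta> e \<tau> v k))"
    proof (rule sum.cong[OF refl])
      fix e
      have "(\<Prod>g<L. if e g = ?w g then 1 else 0 :: 'k) = (\<Prod>k<L. if e (\<tau> k) = (v k, v (Suc k)) then 1 else 0)"
        by (subst prod.permute[OF \<tau>]) (simp add: o_def permutes_inverses[OF \<tau>])
      then show "(\<Prod>g<L. M g (fst (e g)) (snd (e g)) * (if e g = ?w g then 1 else 0)) =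
          (\<Prod>g<L. M g (fst (e g)) (snd (e g))) * of_int (\<Prod>k<L. ?\<delta> e \<tau> v k)"
        by (simp only: prod.distrib of_int_prod if_distrib[of of_int] of_int_0 of_int_1)
    qed
    finally show ?thesis .
  qed
  have "(\<Sum>\<tau>\<in>?T. of_int (sign \<tau>) * mat_prod B (map (\<lambda>k. M (\<tau> k)) [0..<L]) a b) =
      (\<Sum>\<tau>\<in>?T. \<Sum>v\<in>?V. \<Sum>e\<in>?E. (\<Prod>g<L. M g (fst (e g)) (snd (e g))) *
        of_int (sign \<tau> * (\<Prod>k<L. ?\<delta> e \<tau> v k)))"
  proof (rule sum.cong[OF refl])
    fix \<tau> assume "\<tau> \<in> ?T"
    then have \<tau>: "\<tau> permutes {..<L}" by simp
    have "of_int (sign \<tau>) * mat_prod B (map (\<lambda>k. M (\<tau> k)) [0..<L]) a b =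
        (\<Sum>v\<in>?V. of_int (sign \<tau>) * (\<Prod>k<L. M (\<tau> k) (v k) (v (Suc k))))"
      by (simp only: mat_prod_eq_sum_paths[OF assms(1-3)] sum_distrib_left)
    also have "\<dots> = (\<Sum>v\<in>?V. \<Sum>e\<in>?E. (\<Prod>g<L. M g (fst (e g)) (snd (e g))) *
        of_int (sign \<tau> * (\<Prod>k<L. ?\<delta> e \<tau> v k)))"
      by (rule sum.cong[OF refl])
         (simp only: expand[OF \<tau>] sum_distrib_left of_int_mult mult.left_commute)
    finally show "of_int (sign \<tau>) * mat_prod B (map (\<lambda>k. M (\<tau> k)) [0..<L]) a b =
        (\<Sum>v\<in>?V. \<Sum>e\<in>?E. (\<Prod>g<L. M g (fst (e g)) (snd (e g))) *
          of_int (sign \<tau> * (\<Prod>k<L. ?\<delta> e \<tau> v k)))" .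
  qed
  also have "\<dots> = (\<Sum>\<tau>\<in>?T. \<Sum>e\<in>?E. \<Sum>v\<in>?V. (\<Prod>g<L. M g (fst (e g)) (snd (e g))) *
        of_int (sign \<tau> * (\<Prod>k<L. ?\<delta> e \<tau> v k)))"
    by (rule sum.cong[OF refl], rule sum.swap)
  also have "\<dots> = (\<Sum>e\<in>?E. \<Sum>\<tau>\<in>?T. \<Sum>v\<in>?V. (\<Prod>g<L. M g (fst (e g)) (snd (e g))) *
        of_int (sign \<tau> * (\<Prod>k<L. ?\<delta> e \<tau> v k)))"
    by (rule sum.swap)
  also have "\<dots> = (\<Sum>e\<in>?E. (\<Prod>g<L. M g (fst (e g)) (snd (e g))) *
        of_int (\<Sum>\<tau>\<in>?T. sign \<tau> * (\<Sum>v\<in>?V. \<Prod>k<L. ?\<delta> e \<tau> v k)))"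
    by (simp only: sum_distrib_left of_int_sum)
  also have "\<dots> = 0"
  proof (rule sum.neutral, rule ballI)
    fix e
    have "(\<Sum>\<tau>\<in>?T. sign \<tau> * (\<Sum>v\<in>?V. \<Prod>k<L. ?\<delta> e \<tau> v k)) = 0"
      unfolding L_def by (rule amitsur_levitzki_int[OF assms(1-3), of "\<lambda>g x y. if e g = (x, y) then 1 else 0"])
    then show "(\<Prod>g<L. M g (fst (e g)) (snd (e g))) *
        of_int (\<Sum>\<tau>\<in>?T. sign \<tau> * (\<Sum>v\<in>?V. \<Prod>k<L. ?\<delta> e \<tau> v k)) = 0"
      by (simp only: of_int_0 mult_zero_right)
  qed
  finally show ?thesis .
qed

section \<open>Matrix algebras satisfy no monic identity of small degree\<close>

definition mat_eval :: "'b set \<Rightarrow> ('g \<Rightarrow> 'b \<Rightarrow> 'b \<Rightarrow> 'k::comm_ring_1) \<Rightarrow> ('g, int) nc_poly \<Rightarrow> 'b \<Rightarrow> 'b \<Rightarrow> 'k"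
  where "mat_eval B r P a b =
    (\<Sum>w\<in>Poly_Mapping.keys P. of_int (Poly_Mapping.lookup P w) * mat_prod B (map r (letters w)) a b)"

text \<open>Expansion of a product of sums: a list \<open>js\<close> of steps occurs for the word
  \<open>u\<close> exactly if its labels spell \<open>u\<close>.\<close>

lemma mat_prod_map_sum:
  fixes E :: "'i \<Rightarrow> 'b \<Rightarrow> 'b \<Rightarrow> 'k::comm_ring_1"
  assumes "finite T"
  shows "mat_prod B (map (\<lambda>g x y. \<Sum>j | j \<in> T \<and> l j = g. E j x y) u) a b =
    (\<Sum>js | set js \<subseteq> T \<and> map l js = u. mat_prod B (map E js) a b)"
proof (induction u arbitrary: a)
  case Nil
  have "{js. set js \<subseteq> T \<and> map l js = []} = {[]}" by auto
  then show ?case by simp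
next
  case (Cons g u)
  let ?J = "{j. j \<in> T \<and> l j = g}" and ?S = "\<lambda>u. {js. set js \<subseteq> T \<and> map l js = u}"
  have fin: "finite (?S u)" for u
    by (rule finite_subset[OF _ finite_lists_length_eq[OF assms, of "length u"]]) auto
  have "?S (g # u) = (\<lambda>(j, js). j # js) ` (?J \<times> ?S u)"
    by (auto simp: image_iff Cons_eq_map_conv map_eq_Cons_conv)
  then have "(\<Sum>js\<in>?S (g # u). mat_prod B (map E js) a b) =
      (\<Sum>(j, js)\<in>?J \<times> ?S u. \<Sum>c\<in>B. E j a c * mat_prod B (map E js) c b)"
    by (simp add: sum.reindex inj_on_def case_prod_unfold)
  also have "\<dots> = (\<Sum>j\<in>?J. \<Sum>js\<in>?S u. \<Sum>c\<in>B. E j a c * mat_prod B (map E js) c b)"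
    by (rule sum.cartesian_product[symmetric])
  also have "\<dots> = (\<Sum>j\<in>?J. \<Sum>c\<in>B. \<Sum>js\<in>?S u. E j a c * mat_prod B (map E js) c b)"
    by (rule sum.cong[OF refl], rule sum.swap)
  also have "\<dots> = (\<Sum>c\<in>B. \<Sum>j\<in>?J. \<Sum>js\<in>?S u. E j a c * mat_prod B (map E js) c b)"
    by (rule sum.swap)
  finally show ?case
    by (simp add: Cons.IH sum_product)
qed

text \<open>If \<open>A \<noteq> D\<close>, toggling the membership of one element of
  \<open>D - A\<close> pairs off the sets \<open>T\<close> with opposite signs.\<close>

lemma sum_sign_supersets:
  assumes "finite D" "A \<subseteq> D"
  shows "(\<Sum>T | A \<subseteq> T \<and> T \<subseteq> D. (- 1) ^ card T :: int) = (if A = D then (- 1) ^ card D else 0)"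
proof (cases "A = D")
  case True
  then have "{T. A \<subseteq> T \<and> T \<subseteq> D} = {D}" by auto
  then show ?thesis using True by simp
next
  case False
  then obtain x where x: "x \<in> D" "x \<notin> A" using assms(2) by auto
  let ?P = "{T. A \<subseteq> T \<and> T \<subseteq> D}" and ?t = "\<lambda>T. if x \<in> T then T - {x} else insert x T"
  have "(\<Sum>T\<in>?P. (- 1) ^ card T :: int) = (\<Sum>T\<in>?P. - ((- 1) ^ card T))"
  proof (rule sum.reindex_bij_witness[where i = ?t and j = ?t])
    fix T assume T: "T \<in> ?P"
    then have fT: "finite T" using assms(1) finite_subset by auto
    show "- ((- 1) ^ card (?t T)) = ((- 1) ^ card T :: int)"
      using fT by (cases "card T") (auto simp: card_insert_if)
  qed (use x in auto)
  then show ?thesis using False by (simp add: sum_negf)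
qed

text \<open>Substituting sums of matrix units of a staircase \<open>e\<^sub>1\<^sub>1, e\<^sub>1\<^sub>2, e\<^sub>2\<^sub>2, e\<^sub>2\<^sub>3, \<dots>\<close>, one step for each letter of
  the monic word, and taking an alternating sum over the subsets of steps isolates the products which use
  every step; no multilinearisation of the identity is needed.\<close>

lemma no_small_matrix_identity:
  fixes P :: "('g, int) nc_poly"
  assumes B: "finite B" and monic: "nc_monic P" and deg: "nc_degree P < 2 * card B"
  obtains r :: "'g \<Rightarrow> 'b \<Rightarrow> 'b \<Rightarrow> 'k::comm_ring_1" and a b
    where "a \<in> B" "b \<in> B" "mat_eval B r P a b \<noteq> 0"
proof -
  define d where "d = nc_degree P"
  obtain ws where ws: "length ws = d" "Poly_Mapping.lookup P (Word ws) = 1"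
    using monic unfolding nc_monic_def d_def by (metis free_monoid.exhaust_sel)
  obtain v where v: "bij_betw v {..<card B} B"
    using B by (metis bij_betw_from_nat_into_finite)
  \<comment> \<open>Halving gives the staircase: step \<open>j\<close> leads from
    \<open>av j\<close> to \<open>av (Suc j)\<close>, and for even \<open>j\<close> it stays where
    it is. The vertices \<open>av 0, ..., av d\<close> fit into \<open>B\<close> because
    \<open>d < 2 * card B\<close>.\<close>
  define av where "av j = v (j div 2)" for j
  have avB: "av j \<in> B" if "j \<le> d" for j
    using v that deg by (auto simp: av_def d_def bij_betw_def)
  have av_le: "j \<le> j'" if "av (Suc j) = av j'" "j < d" "j' < d" for j j'
  proof -
    have "Suc j div 2 < card B" "j' div 2 < card B" using that deg by (auto simp: d_def)
    then have "Suc j div 2 = j' div 2"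
      using that(1) v by (auto simp: av_def bij_betw_def inj_on_def)
    then show ?thesis by presburger
  qed
  define E :: "nat \<Rightarrow> 'b \<Rightarrow> 'b \<Rightarrow> 'k" where "E j x y = (if x = av j \<and> y = av (Suc j) then 1 else 0)" for j x y
  have start: "c = av j" if "mat_prod B (map E (j # js)) c b \<noteq> 0" for j js b c
  proof (rule ccontr)
    assume "c \<noteq> av j"
    then have "E j c x = 0" for x by (simp add: E_def)
    then show False using that by simp
  qed
  \<comment> \<open>Consecutive steps of a nonzero product satisfy
    \<open>av (Suc j) = av j'\<close>, which forces \<open>j \<le> j'\<close>. A diagonal unit may
    follow itself, so repetitions are not excluded at this point.\<close>
  have chain: "sorted js" if "mat_prod B (map E js) a b \<noteq> 0" "set js \<subseteq> {..<d}" for js a b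
    using that
  proof (induction js arbitrary: a)
    case (Cons j js)
    show ?case
    proof (cases js)
      case (Cons j' js')
      have "\<exists>c\<in>B. E j a c * mat_prod B (map E js) c b \<noteq> 0"
      proof (rule ccontr)
        assume "\<not> ?thesis"
        then have "(\<Sum>c\<in>B. E j a c * mat_prod B (map E js) c b) = 0" by (intro sum.neutral) auto
        then show False using Cons.prems(1) by simp
      qed
      then obtain c where c: "E j a c * mat_prod B (map E js) c b \<noteq> 0" by blast
      have "E j a c \<noteq> 0" using c by auto
      then have "c = av (Suc j)" by (auto simp: E_def split: if_splits)
      moreover have mp: "mat_prod B (map E js) c b \<noteq> 0" using c by auto
      then have "c = av j'" using start unfolding Cons by blast
      ultimately have "j \<le> j'" using av_le Cons.prems(2) Cons by auto
      moreover have "sorted js" using Cons.IH[OF mp] Cons.prems(2) by simp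
      ultimately show ?thesis unfolding Cons by auto
    qed simp
  qed simp
  have diag: "mat_prod B (map E [0..<k]) (av 0) b = (if b = av k then 1 else 0)"
    if "k \<le> d" "b \<in> B" for k b
    using that
  proof (induction k arbitrary: b)
    case (Suc k)
    have "mat_prod B (map E [0..<Suc k]) (av 0) b =
        (\<Sum>c\<in>B. mat_prod B (map E [0..<k]) (av 0) c * mat_prod B [E k] c b)"
      using mat_prod_append[OF B avB[of 0], of "map E [0..<k]" "[E k]" b] by simp
    also have "\<dots> = (\<Sum>c\<in>B. if c = av k then mat_prod B [E k] c b else 0)"
      using Suc by (intro sum.cong) auto
    also have "\<dots> = mat_prod B [E k] (av k) b" using avB[of k] Suc.prems B by (simp add: sum.delta)
    also have "\<dots> = (\<Sum>c\<in>B. if c = av (Suc k) then if c = b then 1 else 0 else 0)"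
      by (auto simp: E_def intro!: sum.cong)
    also have "\<dots> = (if b = av (Suc k) then 1 else 0)"
      using avB[of "Suc k"] Suc.prems B by (auto simp: sum.delta)
    finally show ?case .
  qed auto
  let ?D = "{..<d}"
  define r where "r T g x y = (\<Sum>j | j \<in> T \<and> ws ! j = g. E j x y)" for T g x y
  let ?S = "\<lambda>T u. {js. set js \<subseteq> T \<and> map ((!) ws) js = u}"
  define mp where "mp js = mat_prod B (map E js) (av 0) (av d)" for js
  have finS: "finite (?S T u)" if "finite T" for T u
    by (rule finite_subset[OF _ finite_lists_length_eq[OF that, of "length u"]]) auto
  \<comment> \<open>The alternating sum over \<open>T\<close> removes every list that misses a step.
    A list of length at most \<open>d\<close> that uses all \<open>d\<close> steps has no
    repetition, and being sorted it is \<open>[0..<d]\<close>, whose labels spell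
    \<open>ws\<close>.\<close>
  have word: "(\<Sum>T\<in>Pow ?D. of_int ((- 1) ^ card T) * mat_prod B (map (r T) u) (av 0) (av d)) =
      (if u = ws then (- 1) ^ d else 0)" if u: "length u \<le> d" for u
  proof -
    have "(\<Sum>T\<in>Pow ?D. of_int ((- 1) ^ card T) * mat_prod B (map (r T) u) (av 0) (av d)) =
        (\<Sum>T\<in>Pow ?D. of_int ((- 1) ^ card T) * (\<Sum>js\<in>?S T u. mp js))"
    proof (rule sum.cong[OF refl])
      fix T assume "T \<in> Pow ?D"
      then have "finite T" using finite_subset by auto
      have "r T = (\<lambda>g x y. \<Sum>j | j \<in> T \<and> ws ! j = g. E j x y)" by (simp add: r_def fun_eq_iff)
      then show "of_int ((- 1) ^ card T) * mat_prod B (map (r T) u) (av 0) (av d) =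
          of_int ((- 1) ^ card T) * (\<Sum>js\<in>?S T u. mp js)"
        by (simp add: mat_prod_map_sum[OF \<open>finite T\<close>] mp_def)
    qed
    also have "\<dots> = (\<Sum>T\<in>Pow ?D. \<Sum>js\<in>?S ?D u. if set js \<subseteq> T then of_int ((- 1) ^ card T) * mp js else 0)"
    proof (rule sum.cong[OF refl])
      fix T assume T: "T \<in> Pow ?D"
      have "{js \<in> ?S ?D u. set js \<subseteq> T} = ?S T u" using T by auto
      then show "of_int ((- 1) ^ card T) * (\<Sum>js\<in>?S T u. mp js) =
          (\<Sum>js\<in>?S ?D u. if set js \<subseteq> T then of_int ((- 1) ^ card T) * mp js else 0)"
        by (simp add: sum.inter_filter[OF finS, symmetric] sum_distrib_left)
    qed
    also have "\<dots> = (\<Sum>js\<in>?S ?D u. \<Sum>T\<in>Pow ?D. if set js \<subseteq> T then of_int ((- 1) ^ card T) * mp js else 0)"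
      by (rule sum.swap)
    also have "\<dots> = (\<Sum>js\<in>?S ?D u. if set js = ?D then (- 1) ^ d * mp js else 0)"
    proof (rule sum.cong[OF refl])
      fix js assume js: "js \<in> ?S ?D u"
      have "(\<Sum>T\<in>Pow ?D. if set js \<subseteq> T then of_int ((- 1) ^ card T) * mp js else 0) =
          (\<Sum>T | T \<in> Pow ?D \<and> set js \<subseteq> T. of_int ((- 1) ^ card T) * mp js)"
        by (simp add: sum.inter_filter[symmetric])
      also have "{T. T \<in> Pow ?D \<and> set js \<subseteq> T} = {T. set js \<subseteq> T \<and> T \<subseteq> ?D}" by auto
      also have "(\<Sum>T | set js \<subseteq> T \<and> T \<subseteq> ?D. of_int ((- 1) ^ card T) * mp js) =
          of_int (\<Sum>T | set js \<subseteq> T \<and> T \<subseteq> ?D. (- 1) ^ card T) * mp js"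
        by (simp only: of_int_sum sum_distrib_right)
      also have "\<dots> = (if set js = ?D then (- 1) ^ d * mp js else 0)"
        using js by (subst sum_sign_supersets) auto
      finally show "(\<Sum>T\<in>Pow ?D. if set js \<subseteq> T then of_int ((- 1) ^ card T) * mp js else 0) =
          (if set js = ?D then (- 1) ^ d * mp js else 0)" .
    qed
    also have "\<dots> = (\<Sum>js\<in>?S ?D u. if js = [0..<d] then (- 1) ^ d else 0)"
    proof (rule sum.cong[OF refl])
      fix js assume js: "js \<in> ?S ?D u"
      have len: "length js \<le> d" using js u by auto
      have "js = [0..<d]" if "set js = ?D" "mp js \<noteq> 0"
      proof -
        have "distinct js"
          using that(1) len card_length[of js] by (intro card_distinct) simp
        moreover have "sorted js"
          by (rule chain[OF that(2)[unfolded mp_def]]) (simp add: that(1))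
        moreover have "set js = set [0..<d]" using that(1) by (simp add: atLeast0LessThan)
        ultimately show ?thesis
          by (intro sorted_distinct_set_unique) simp_all
      qed
      moreover have "mp [0..<d] = 1" unfolding mp_def using diag[OF order_refl avB[OF order_refl]] by simp
      moreover have "set [0..<d] = ?D" by (simp add: atLeast0LessThan)
      ultimately show "(if set js = ?D then (- 1) ^ d * mp js else 0) = (if js = [0..<d] then (- 1) ^ d else 0)"
        by (metis mult.right_neutral mult_zero_right)
    qed
    also have "\<dots> = (if u = ws then (- 1) ^ d else 0)"
    proof -
      have "[0..<d] \<in> ?S ?D u \<longleftrightarrow> u = ws"
        using map_nth[of ws] ws(1) by (auto simp: atLeast0LessThan)
      then show ?thesis using finS[of ?D u] by (simp add: sum.delta')
    qed
    finally show ?thesis .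
  qed
  have len: "length (letters w) \<le> d" if "w \<in> Poly_Mapping.keys P" for w
    unfolding d_def nc_degree_def using that by (intro Max_ge) auto
  have "(\<Sum>T\<in>Pow ?D. of_int ((- 1) ^ card T) * mat_eval B (r T) P (av 0) (av d)) =
      (\<Sum>T\<in>Pow ?D. \<Sum>w\<in>Poly_Mapping.keys P. of_int (Poly_Mapping.lookup P w) *
        (of_int ((- 1) ^ card T) * mat_prod B (map (r T) (letters w)) (av 0) (av d)))"
    by (simp add: mat_eval_def sum_distrib_left mult_ac)
  also have "\<dots> = (\<Sum>w\<in>Poly_Mapping.keys P. \<Sum>T\<in>Pow ?D. of_int (Poly_Mapping.lookup P w) *
        (of_int ((- 1) ^ card T) * mat_prod B (map (r T) (letters w)) (av 0) (av d)))"
    by (rule sum.swap)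
  also have "\<dots> = (\<Sum>w\<in>Poly_Mapping.keys P. of_int (Poly_Mapping.lookup P w) *
      (if letters w = ws then (- 1) ^ d else 0))"
    by (intro sum.cong refl) (simp only: sum_distrib_left[symmetric] word len)
  also have "\<dots> = (\<Sum>w\<in>Poly_Mapping.keys P. if w = Word ws then (- 1) ^ d else 0)"
  proof (rule sum.cong[OF refl])
    fix w
    have "letters w = ws \<longleftrightarrow> w = Word ws" by (cases w) auto
    then show "of_int (Poly_Mapping.lookup P w) * (if letters w = ws then (- 1) ^ d else 0) =
        (if w = Word ws then (- 1) ^ d else 0 :: 'k)"
      using ws(2) by auto
  qed
  also have "\<dots> = (- 1) ^ d" using ws(2) by (simp add: sum.delta in_keys_iff)
  also have "\<dots> \<noteq> (0::'k)"
    by (cases "even d") simp_all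
  finally obtain T where "mat_eval B (r T) P (av 0) (av d) \<noteq> 0"
    by (metis (no_types, lifting) mult_zero_right sum.neutral)
  then show ?thesis using that avB[of 0] avB[of d] by blast
qed

section \<open>Generic points\<close>

text \<open>
  For all but finitely many \<open>t\<^sub>0\<close>, for all but finitely many \<open>t\<^sub>1\<close>, and so on up to \<open>t\<^sub>r\<^sub>-\<^sub>1\<close>; the finite
  exceptional set for a coordinate may depend on the previous ones.
\<close>

fun generic :: "nat \<Rightarrow> ((nat \<Rightarrow> 'k::field) \<Rightarrow> bool) \<Rightarrow> bool"
  where
    "generic 0 \<Phi> \<longleftrightarrow> \<Phi> (\<lambda>_. 0)"
  | "generic (Suc r) \<Phi> \<longleftrightarrow> generic r (\<lambda>t. finite {u. \<not> \<Phi> (t(r := u))})"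

lemma generic_mono: "generic r \<Phi> \<Longrightarrow> (\<And>t. \<Phi> t \<Longrightarrow> \<Psi> t) \<Longrightarrow> generic r \<Psi>"
proof (induction r arbitrary: \<Phi> \<Psi>)
  case 0
  then show ?case by simp
next
  case (Suc r)
  have "finite {u. \<not> \<Psi> (t(r := u))}" if "finite {u. \<not> \<Phi> (t(r := u))}" for t
    by (rule finite_subset[OF _ that]) (auto intro: Suc.prems(2))
  from Suc.IH[OF Suc.prems(1)[unfolded generic.simps] this] show ?case
    unfolding generic.simps .
qed

lemma generic_conj: "generic r \<Phi> \<Longrightarrow> generic r \<Psi> \<Longrightarrow> generic r (\<lambda>t. \<Phi> t \<and> \<Psi> t)"
proof (induction r arbitrary: \<Phi> \<Psi>)
  case 0
  then show ?case by simp
next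
  case (Suc r)
  have "finite {u. \<not> (\<Phi> (t(r := u)) \<and> \<Psi> (t(r := u)))}"
    if "finite {u. \<not> \<Phi> (t(r := u))} \<and> finite {u. \<not> \<Psi> (t(r := u))}" for t
  proof -
    have "{u. \<not> (\<Phi> (t(r := u)) \<and> \<Psi> (t(r := u)))} = {u. \<not> \<Phi> (t(r := u))} \<union> {u. \<not> \<Psi> (t(r := u))}" by auto
    then show ?thesis using that by simp
  qed
  from generic_mono[OF Suc.IH[OF Suc.prems[unfolded generic.simps]] this] show ?case
    unfolding generic.simps .
qed

lemma generic_True: "generic r (\<lambda>_. True)"
  by (induction r) auto

lemma generic_Ball:
  assumes "finite A" "\<And>x. x \<in> A \<Longrightarrow> generic r (\<Phi> x)"
  shows "generic r (\<lambda>t. \<forall>x\<in>A. \<Phi> x t)"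
  using assms
proof (induction A rule: finite_induct)
  case empty
  show ?case by (rule generic_mono[OF generic_True]) simp
next
  case (insert x A)
  have "generic r (\<lambda>t. \<Phi> x t \<and> (\<forall>x\<in>A. \<Phi> x t))"
    by (rule generic_conj) (rule insert.prems, simp, rule insert.IH, rule insert.prems, simp)
  then show ?case by (rule generic_mono) simp
qed

lemma generic_imp_ex:
  assumes "infinite (UNIV :: 'k::field set)"
  shows "generic r \<Phi> \<Longrightarrow> \<exists>t :: nat \<Rightarrow> 'k. \<Phi> t"
proof (induction r arbitrary: \<Phi>)
  case (Suc r)
  from Suc.IH[OF Suc.prems[unfolded generic.simps]]
  obtain t where t: "finite {u. \<not> \<Phi> (t(r := u))}" by (rule exE)
  have "\<exists>u. \<Phi> (t(r := u))"
  proof (rule ccontr)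
    assume "\<not> (\<exists>u. \<Phi> (t(r := u)))"
    then have "{u. \<not> \<Phi> (t(r := u))} = UNIV" by simp
    then show False using t assms by simp
  qed
  then show ?case by (rule exE) (rule exI[of \<Phi>])
next
  case 0
  then show ?case unfolding generic.simps by (rule exI[of \<Phi>])
qed

text \<open>Multiplication by \<open>u ^ Z\<close> for a large \<open>Z\<close> yields a polynomial
  with a nonzero coefficient in the place of \<open>z0\<close>. The point \<open>u = 0\<close>,
  where negative powers only have a conventional value, is put into the finite set.\<close>

lemma finite_roots_laurent:
  fixes a :: "'x \<Rightarrow> 'k::field" and z :: "'x \<Rightarrow> int"
  assumes "finite E" and nz: "(\<Sum>x | x \<in> E \<and> z x = z0. a x) \<noteq> 0"
  shows "finite {u. (\<Sum>x\<in>E. a x * u powi z x) = 0}"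
proof -
  obtain Z where Z: "\<And>x. x \<in> E \<Longrightarrow> z x + int Z \<ge> 0"
  proof
    show "z x + int (\<Sum>x\<in>E. nat (abs (z x))) \<ge> 0" if "x \<in> E" for x
      using member_le_sum[OF that, of "\<lambda>x. abs (z x)"] assms(1) by auto
  qed
  define p where "p = (\<Sum>x\<in>E. Polynomial.monom (a x) (nat (z x + int Z)))"
  obtain x0 where x0: "x0 \<in> E" "z x0 = z0"
  proof -
    have "{x. x \<in> E \<and> z x = z0} \<noteq> {}"
    proof
      assume "{x. x \<in> E \<and> z x = z0} = {}"
      then show False using nz by (simp only: sum.empty not_True_eq_False simp_thms)
    qed
    then show ?thesis using that by blast
  qed
  have "Polynomial.coeff p (nat (z0 + int Z)) = (\<Sum>x\<in>E. if z x = z0 then a x else 0)"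
    unfolding p_def coeff_sum
  proof (rule sum.cong[OF refl])
    fix x assume "x \<in> E"
    then have "nat (z x + int Z) = nat (z0 + int Z) \<longleftrightarrow> z x = z0"
      using Z[of x] Z[of x0] x0 by (auto simp: eq_nat_nat_iff)
    then show "Polynomial.coeff (Polynomial.monom (a x) (nat (z x + int Z))) (nat (z0 + int Z)) =
        (if z x = z0 then a x else 0)" by simp
  qed
  also have "\<dots> = (\<Sum>x | x \<in> E \<and> z x = z0. a x)"
    by (rule sum.inter_filter[OF assms(1), symmetric])
  finally have "Polynomial.coeff p (nat (z0 + int Z)) \<noteq> 0" using nz by (simp only: not_False_eq_True)
  then have "p \<noteq> 0" by auto
  then have fin: "finite {u. poly p u = 0}" by (rule poly_roots_finite)
  have "{u. (\<Sum>x\<in>E. a x * u powi z x) = 0} \<subseteq> insert 0 {u. poly p u = 0}"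
  proof (rule subsetI, rule ccontr)
    fix u assume "u \<in> {u. (\<Sum>x\<in>E. a x * u powi z x) = 0}" "u \<notin> insert 0 {u. poly p u = 0}"
    then have *: "(\<Sum>x\<in>E. a x * u powi z x) = 0" "u \<noteq> 0" "poly p u \<noteq> 0" by simp_all
    have "poly p u = (\<Sum>x\<in>E. a x * u ^ nat (z x + int Z))"
      by (simp add: p_def poly_sum poly_monom)
    also have "\<dots> = (\<Sum>x\<in>E. a x * u powi z x) * u ^ Z"
      unfolding sum_distrib_right
    proof (rule sum.cong[OF refl])
      fix x assume "x \<in> E"
      then have "u ^ nat (z x + int Z) = u powi (z x + int Z)"
        using Z[of x] by (simp add: power_int_def)
      then show "a x * u ^ nat (z x + int Z) = a x * u powi z x * u ^ Z"
        using *(2) by (simp add: power_int_add)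
    qed
    finally show False using * by simp
  qed
  then show ?thesis using fin by (rule finite_subset[OF _ finite.insertI])
qed

text \<open>Viewed as a Laurent polynomial in the last variable, the sum has, at the exponent
  belonging to \<open>x0\<close>, a coefficient formed by the terms in \<open>?E\<close>; it is
  generically nonzero by induction. Only the exponent vector of \<open>x0\<close> has to differ from
  the others, which may coincide among themselves.\<close>

lemma generic_laurent_nonzero:
  fixes c :: "'x \<Rightarrow> 'k::field" and ex :: "'x \<Rightarrow> nat \<Rightarrow> int"
  assumes "finite E" "x0 \<in> E" "c x0 \<noteq> 0"
    and "\<And>x. x \<in> E \<Longrightarrow> x \<noteq> x0 \<Longrightarrow> \<exists>i<r. ex x i \<noteq> ex x0 i"
  shows "generic r (\<lambda>t. (\<Sum>x\<in>E. c x * (\<Prod>i<r. t i powi ex x i)) \<noteq> 0)"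
  using assms
proof (induction r arbitrary: E)
  case 0
  then have "E = {x0}" by auto
  then show ?case using 0 by simp
next
  case (Suc r)
  let ?E = "{x \<in> E. ex x r = ex x0 r}"
  have "generic r (\<lambda>t. (\<Sum>x\<in>?E. c x * (\<Prod>i<r. t i powi ex x i)) \<noteq> 0)"
  proof (rule Suc.IH)
    fix x assume x: "x \<in> ?E" "x \<noteq> x0"
    then obtain i where "i < Suc r" "ex x i \<noteq> ex x0 i" using Suc.prems(4) by auto
    then show "\<exists>i<r. ex x i \<noteq> ex x0 i" using x by (auto simp: less_Suc_eq)
  qed (use Suc.prems in auto)
  then show ?case unfolding generic.simps
  proof (rule generic_mono)
    fix t :: "nat \<Rightarrow> 'k"
    assume t: "(\<Sum>x\<in>?E. c x * (\<Prod>i<r. t i powi ex x i)) \<noteq> 0"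
    have "(\<Sum>x\<in>E. c x * (\<Prod>i<Suc r. (t(r := u)) i powi ex x i)) =
        (\<Sum>x\<in>E. (c x * (\<Prod>i<r. t i powi ex x i)) * u powi ex x r)" for u
    proof (rule sum.cong[OF refl])
      fix x
      have "(\<Prod>i<r. (t(r := u)) i powi ex x i) = (\<Prod>i<r. t i powi ex x i)"
        by (rule prod.cong) auto
      then show "c x * (\<Prod>i<Suc r. (t(r := u)) i powi ex x i) =
          (c x * (\<Prod>i<r. t i powi ex x i)) * u powi ex x r"
        by (simp only: prod.lessThan_Suc fun_upd_same mult.assoc)
    qed
    then show "finite {u. \<not> (\<Sum>x\<in>E. c x * (\<Prod>i<Suc r. (t(r := u)) i powi ex x i)) \<noteq> 0}"
      using finite_roots_laurent[OF Suc.prems(1) t] by (simp only: not_not)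
  qed
qed

lemma prod_powi_delta:
  fixes t :: "nat \<Rightarrow> 'k::field"
  assumes "i < r"
  shows "(\<Prod>j<r. t j powi (if j = i then e else 0)) = t i powi e"
proof -
  have "(\<Prod>j<r. t j powi (if j = i then e else 0)) = (\<Prod>j<r. if j = i then t j powi e else 1)"
    by (rule prod.cong) auto
  then show ?thesis using assms by (simp add: prod.delta)
qed

lemma generic_nonzero:
  assumes "i < r"
  shows "generic r (\<lambda>t :: nat \<Rightarrow> 'k::field. t i \<noteq> 0)"
  using generic_laurent_nonzero[of "{()}" "()" "\<lambda>_. 1 :: 'k" r "\<lambda>_ j. if j = i then 1 else 0"] assms
  by (simp add: prod_powi_delta)

lemma generic_power_neq:
  assumes "i < r" "j < r" "i \<noteq> j" "e > 0"
  shows "generic r (\<lambda>t :: nat \<Rightarrow> 'k::field. t i ^ e \<noteq> t j ^ e)"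
proof -
  have "generic r (\<lambda>t :: nat \<Rightarrow> 'k. (\<Sum>x\<in>{i, j}. (if x = i then 1 else - 1) *
      (\<Prod>l<r. t l powi (if l = x then int e else 0))) \<noteq> 0)"
    by (rule generic_laurent_nonzero) (use assms in auto)
  then show ?thesis
    by (rule generic_mono) (use assms in \<open>simp add: prod_powi_delta\<close>)
qed

text \<open>Over a finite field the product of all \<open>X - a\<close> vanishes everywhere, so this
  product plus 1 has positive degree and no root.\<close>

lemma infinite_UNIV_alg_closed: "infinite (UNIV :: 'k::alg_closed_field set)"
proof
  assume fin: "finite (UNIV :: 'k set)"
  define p :: "'k poly" where "p = (\<Prod>a\<in>UNIV. [:- a, 1:])"
  have "Polynomial.degree p = card (UNIV :: 'k set)"
    unfolding p_def by (subst degree_prod_eq_sum_degree) auto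
  moreover have "card (UNIV :: 'k set) > 0" using fin by (simp add: card_gt_0_iff)
  ultimately have "Polynomial.degree (p + 1) > 0"
    using degree_add_eq_left[of 1 p] by simp
  then obtain x where "poly (p + 1) x = 0"
    using alg_closed_imp_poly_has_root by blast
  moreover have "poly p x = (\<Prod>a\<in>UNIV. x - a)"
    by (simp add: p_def poly_prod)
  then have "poly p x = 0"
    using prod_zero[OF fin, of "\<lambda>a. x - a"] by (metis UNIV_I eq_iff_diff_eq_0)
  ultimately show False by simp
qed

section \<open>Representations by difference operators\<close>

lemma nc_poly_eq_sum_single:
  "f = (\<Sum>w\<in>Poly_Mapping.keys f. Poly_Mapping.single w (Poly_Mapping.lookup f w))"
  by (rule poly_mapping_eqI)
     (auto simp: lookup_sum lookup_single when_def sum.delta' in_keys_iff cong: if_cong)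

definition linear_action :: "('g \<Rightarrow> ('s \<Rightarrow> 'k) \<Rightarrow> 's \<Rightarrow> 'k::comm_ring_1) \<Rightarrow> bool"
  where "linear_action act \<longleftrightarrow>
    (\<forall>g \<phi> \<psi>. act g (\<lambda>s. \<phi> s + \<psi> s) = (\<lambda>s. act g \<phi> s + act g \<psi> s)) \<and>
    (\<forall>g a \<phi>. act g (\<lambda>s. a * \<phi> s) = (\<lambda>s. a * act g \<phi> s))"

definition nc_act :: "('g \<Rightarrow> ('s \<Rightarrow> 'k) \<Rightarrow> 's \<Rightarrow> 'k) \<Rightarrow> ('g, 'k::comm_ring_1) nc_poly \<Rightarrow> ('s \<Rightarrow> 'k) \<Rightarrow> 's \<Rightarrow> 'k"
  where "nc_act act f \<phi> s =
    (\<Sum>w\<in>Poly_Mapping.keys f. Poly_Mapping.lookup f w * foldr act (letters w) \<phi> s)"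

lemma nc_act_superset:
  assumes "finite A" "Poly_Mapping.keys f \<subseteq> A"
  shows "nc_act act f \<phi> s = (\<Sum>w\<in>A. Poly_Mapping.lookup f w * foldr act (letters w) \<phi> s)"
  unfolding nc_act_def by (rule sum.mono_neutral_left) (use assms in \<open>auto simp: in_keys_iff\<close>)

lemma nc_act_add: "nc_act act (f + g) \<phi> s = nc_act act f \<phi> s + nc_act act g \<phi> s"
proof -
  let ?A = "Poly_Mapping.keys f \<union> Poly_Mapping.keys g"
  have A: "finite ?A" "Poly_Mapping.keys f \<subseteq> ?A" "Poly_Mapping.keys g \<subseteq> ?A" "Poly_Mapping.keys (f + g) \<subseteq> ?A"
    using Poly_Mapping.keys_add[of f g] by auto
  show ?thesis
    unfolding nc_act_superset[OF A(1,2)] nc_act_superset[OF A(1,3)] nc_act_superset[OF A(1,4)]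
    by (simp add: lookup_add sum.distrib distrib_right)
qed

lemma nc_act_zero [simp]: "nc_act act 0 \<phi> s = 0"
  by (simp add: nc_act_def)

lemma nc_act_uminus: "nc_act act (- f) \<phi> s = - nc_act act f \<phi> s"
  using nc_act_add[of act f "- f" \<phi> s] by (simp add: eq_neg_iff_add_eq_0 add.commute)

lemma nc_act_diff: "nc_act act (f - g) \<phi> s = nc_act act f \<phi> s - nc_act act g \<phi> s"
  using nc_act_add[of act f "- g" \<phi> s] by (simp add: nc_act_uminus)

lemma nc_act_sum: "nc_act act (sum f A) \<phi> s = (\<Sum>x\<in>A. nc_act act (f x) \<phi> s)"
  by (induction A rule: infinite_finite_induct) (simp_all add: nc_act_add)

lemma nc_act_single: "nc_act act (Poly_Mapping.single w a) \<phi> s = a * foldr act (letters w) \<phi> s"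
  by (cases "a = 0") (simp_all add: nc_act_def)

lemma nc_act_const: "nc_act act (nc_const a) \<phi> = (\<lambda>s. a * \<phi> s)"
  by (simp add: fun_eq_iff nc_const_def nc_act_single)

lemma nc_act_one: "nc_act act 1 \<phi> = \<phi>"
  using nc_act_const[of act 1 \<phi>] by (simp add: nc_const_def)

lemma nc_act_var: "nc_act act (nc_var g) \<phi> = act g \<phi>"
  by (simp add: fun_eq_iff nc_var_def nc_act_single)

lemma foldr_linear_action:
  assumes "linear_action act"
  shows "foldr act ws (\<lambda>s. \<phi> s + \<psi> s) = (\<lambda>s. foldr act ws \<phi> s + foldr act ws \<psi> s)"
    and "foldr act ws (\<lambda>s. a * \<phi> s) = (\<lambda>s. a * foldr act ws \<phi> s)"
  using assms by (induction ws) (simp_all add: linear_action_def)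

lemma nc_act_linear:
  assumes "linear_action act"
  shows "nc_act act f (\<lambda>s. \<phi> s + \<psi> s) = (\<lambda>s. nc_act act f \<phi> s + nc_act act f \<psi> s)"
    and "nc_act act f (\<lambda>s. a * \<phi> s) = (\<lambda>s. a * nc_act act f \<phi> s)"
  by (simp_all add: fun_eq_iff nc_act_def foldr_linear_action[OF assms] distrib_left sum.distrib
      sum_distrib_left mult.left_commute)

lemma nc_act_zero_right:
  assumes "linear_action act"
  shows "nc_act act f (\<lambda>s. 0) = (\<lambda>s. 0)"
  using nc_act_linear(2)[OF assms, of f 0 "\<lambda>s. 0"] by simp

lemma nc_act_sum_right:
  assumes "linear_action act"
  shows "nc_act act f (\<lambda>s. \<Sum>i\<in>A. a i * \<phi> i s) s = (\<Sum>i\<in>A. a i * nc_act act f (\<phi> i) s)"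
proof (induction A rule: infinite_finite_induct)
  case (insert x A)
  then show ?case
    by (simp add: nc_act_linear(1)[OF assms, of f "\<lambda>s. a x * \<phi> x s" "\<lambda>s. \<Sum>i\<in>A. a i * \<phi> i s"]
        nc_act_linear(2)[OF assms])
qed (simp_all add: nc_act_zero_right[OF assms])

lemma nc_act_mult:
  assumes lin: "linear_action act"
  shows "nc_act act (f * g) \<phi> = nc_act act f (nc_act act g \<phi>)"
proof
  fix s
  let ?l = "Poly_Mapping.lookup"
  have "f * g = (\<Sum>u\<in>Poly_Mapping.keys f. \<Sum>v\<in>Poly_Mapping.keys g.
      Poly_Mapping.single (u + v) (?l f u * ?l g v))"
    by (subst nc_poly_eq_sum_single[of f], subst nc_poly_eq_sum_single[of g])
       (simp add: sum_product mult_single)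
  then have "nc_act act (f * g) \<phi> s = (\<Sum>u\<in>Poly_Mapping.keys f. \<Sum>v\<in>Poly_Mapping.keys g.
      ?l f u * (?l g v * foldr act (letters u) (foldr act (letters v) \<phi>) s))"
    by (simp add: nc_act_sum nc_act_single mult.assoc)
  also have "\<dots> = (\<Sum>u\<in>Poly_Mapping.keys f. ?l f u * foldr act (letters u) (nc_act act g \<phi>) s)"
  proof (rule sum.cong[OF refl])
    fix u
    have "foldr act (letters u) (nc_act act g \<phi>) s = nc_act act (Poly_Mapping.single u 1)
        (\<lambda>s. \<Sum>v\<in>Poly_Mapping.keys g. ?l g v * foldr act (letters v) \<phi> s) s"
      by (simp add: nc_act_single nc_act_def[abs_def])
    also have "\<dots> = (\<Sum>v\<in>Poly_Mapping.keys g. ?l g v * foldr act (letters u) (foldr act (letters v) \<phi>) s)"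
      by (subst nc_act_sum_right[OF lin]) (simp add: nc_act_single)
    finally show "(\<Sum>v\<in>Poly_Mapping.keys g. ?l f u * (?l g v * foldr act (letters u) (foldr act (letters v) \<phi>) s)) =
        ?l f u * foldr act (letters u) (nc_act act g \<phi>) s"
      by (simp add: sum_distrib_left)
  qed
  finally show "nc_act act (f * g) \<phi> s = nc_act act f (nc_act act g \<phi>) s"
    by (simp add: nc_act_def)
qed

locale euclidean_factor =
  fixes q :: "'k::alg_closed_field" and m n p :: nat
  assumes m: "m > 1" "odd m" and q: "q \<noteq> 0" "primitive_root_of_unity m q"
    and p: "2 \<le> p" "p < n"
begin

lemma q_pow_m: "q ^ m = 1"
  using q by (simp add: primitive_root_of_unity_def)

lemma q_sq: "q\<^sup>2 \<noteq> 1"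
proof -
  have "0 < (2::nat)" "2 < m" using m by (simp, presburger)
  then show ?thesis using q(2) unfolding primitive_root_of_unity_def by blast
qed

definition "coef = 1 - inverse (q\<^sup>2)"

lemma coef_nz: "coef \<noteq> 0"
  using q_sq q(1) by (auto simp: coef_def field_simps)

text \<open>
  The index \<open>s\<close> of a basis vector has the coordinates in \<open>supp\<close>, and \<open>lam W s l\<close> is the eigenvalue
  of \<open>\<omega>\<^sub>l\<close>, which is \<open>0\<close> for \<open>l \<in> {0, p}\<close>. The operator \<open>x\<^sub>j\<close> shifts by \<open>tau j\<close> because
  \<open>x\<^sub>j \<omega>\<^sub>l = q\<^sup>-\<^sup>2 \<omega>\<^sub>l x\<^sub>j\<close> for \<open>l < j\<close>, and its coefficient \<open>q ^ s (iota j)\<close> produces \<open>x\<^sub>i x\<^sub>j = q x\<^sub>j x\<^sub>i\<close>.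
  There is no coordinate \<open>p\<close>, so the coordinate \<open>p - 1\<close> serves for \<open>x\<^sub>p\<close> as well; this needs \<open>p \<ge> 2\<close>.
  The operator \<open>y\<^sub>j\<close> is \<open>(\<omega>\<^sub>j - \<omega>\<^sub>j\<^sub>-\<^sub>1) x\<^sub>j\<^sup>-\<^sup>1 / coef\<close>.
\<close>

definition "supp = {1..<n} - {p}"

definition z :: "(nat \<Rightarrow> int) \<Rightarrow> nat \<Rightarrow> int"
  where "z s l = (if l \<in> supp then s l else 0)"

definition tau :: "nat \<Rightarrow> nat \<Rightarrow> int"
  where "tau j l = (if l \<in> supp \<and> l < j then 1 else 0)"

definition iota :: "nat \<Rightarrow> nat"
  where "iota j = (if j = p then p - 1 else j)"

text \<open>There is no coordinate \<open>n\<close>, so \<open>\<omega>\<^sub>n\<close> acts as the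
  scalar \<open>W n\<close>, as it must because it is central.\<close>

definition lam :: "(nat \<Rightarrow> 'k) \<Rightarrow> (nat \<Rightarrow> int) \<Rightarrow> nat \<Rightarrow> 'k"
  where "lam W s l = (if l = 0 \<or> l = p then 0 else W l) * q powi (2 * z s l)"

definition up :: "(nat \<Rightarrow> int) \<Rightarrow> nat \<Rightarrow> nat \<Rightarrow> int"
  where "up s j = (\<lambda>l. s l + tau j l)"

definition down :: "(nat \<Rightarrow> int) \<Rightarrow> nat \<Rightarrow> nat \<Rightarrow> int"
  where "down s j = (\<lambda>l. s l - tau j l)"

definition act :: "(nat \<Rightarrow> 'k) \<Rightarrow> (nat \<Rightarrow> 'k) \<Rightarrow> euclidean_gen \<Rightarrow> ((nat \<Rightarrow> int) \<Rightarrow> 'k) \<Rightarrow> (nat \<Rightarrow> int) \<Rightarrow> 'k"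
  where "act W V g \<phi> s = (case g of
      GenX j \<Rightarrow> V j * q powi (z s (iota j)) * \<phi> (down s j)
    | GenY j \<Rightarrow> inverse (coef * V j) * (lam W s j - lam W s (j - 1)) *
        q powi (- (z (up s j) (iota j))) * \<phi> (up s j))"

lemma act_simps [simp]:
  "act W V (GenX j) \<phi> s = V j * q powi (z s (iota j)) * \<phi> (down s j)"
  "act W V (GenY j) \<phi> s = inverse (coef * V j) * (lam W s j - lam W s (j - 1)) *
        q powi (- (z (up s j) (iota j))) * \<phi> (up s j)"
  by (simp_all add: act_def)

lemma linear_act: "linear_action (act W V)"
  unfolding linear_action_def
proof (intro conjI allI ext)
  fix g \<phi> \<psi> s a
  show "act W V g (\<lambda>s. \<phi> s + \<psi> s) s = act W V g \<phi> s + act W V g \<psi> s"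
    by (cases g) (simp_all add: distrib_left)
  show "act W V g (\<lambda>s. a * \<phi> s) s = a * act W V g \<phi> s"
    by (cases g) simp_all
qed

lemma updown: "up (down s j) i = down (up s i) j" "down (down s i) j = down (down s j) i"
  "up (up s i) j = up (up s j) i" "down (up s j) j = s"
  by (auto simp: up_def down_def)

lemma z_updown: "z (up s j) l = z s l + tau j l" "z (down s j) l = z s l - tau j l"
  by (auto simp: z_def up_def down_def tau_def)

lemma iota_supp: "1 \<le> i \<Longrightarrow> i < n \<Longrightarrow> iota i \<in> supp"
  using p by (auto simp: iota_def supp_def)

text \<open>The source of the factor in \<open>x\<^sub>i x\<^sub>j = q x\<^sub>j x\<^sub>i\<close>:
  the shift of \<open>x\<^sub>j\<close> moves the coordinate read by the coefficient of
  \<open>x\<^sub>i\<close>, but not conversely. The substitute coordinate \<open>p - 1\<close> lies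
  below every \<open>j > p\<close> and not below any \<open>i < p\<close>, so it behaves like a
  coordinate \<open>p\<close>.\<close>

lemma tau_iota:
  assumes "1 \<le> i" "i < j" "j \<le> n"
  shows "tau j (iota i) = 1" "tau i (iota j) = 0"
  using assms iota_supp[of i] by (auto simp: tau_def iota_def)

lemma q_powi_pred: "q powi (a - 1) = q powi a / q"
  using q by (simp add: power_int_diff)

lemma q_powi_2: "q powi 2 = q\<^sup>2"
  by (simp add: power_int_def)

lemma lam_less:
  assumes "j < i" "i \<le> n"
  shows "lam W (down s i) j = lam W s j / q\<^sup>2" "lam W (up s i) j = lam W s j * q\<^sup>2"
proof -
  have "tau i j = 1" if "j \<noteq> 0" "j \<noteq> p" using that assms by (auto simp: tau_def supp_def)
  then show "lam W (down s i) j = lam W s j / q\<^sup>2" "lam W (up s i) j = lam W s j * q\<^sup>2"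
    using q by (auto simp: lam_def z_updown algebra_simps power_int_add power_int_diff q_powi_2)
qed

lemma lam_ge:
  assumes "i \<le> j"
  shows "lam W (down s i) j = lam W s j" "lam W (up s i) j = lam W s j"
  using assms by (auto simp: lam_def z_updown tau_def)

lemma lam_0 [simp]: "lam W s 0 = 0" and lam_p [simp]: "lam W s p = 0"
  by (simp_all add: lam_def)

abbreviation "opr W V \<equiv> nc_act (act W V)"

lemmas opr_simps = nc_act_mult[OF linear_act] nc_act_diff nc_act_add nc_act_sum nc_act_const nc_act_var

lemma act_yx:
  assumes "V j \<noteq> 0"
  shows "act W V (GenY j) (act W V (GenX j) \<phi>) s = (lam W s j - lam W s (j - 1)) / coef * \<phi> s"
  using assms q coef_nz by (simp add: updown power_int_minus field_simps)

lemma act_xy: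
  assumes "V j \<noteq> 0" "1 \<le> j" "j \<le> n"
  shows "act W V (GenX j) (act W V (GenY j) \<phi>) s = (lam W s j - lam W s (j - 1) / q\<^sup>2) / coef * \<phi> s"
  using assms q coef_nz by (simp add: updown power_int_minus lam_ge lam_less field_simps)

definition om :: "nat \<Rightarrow> (euclidean_gen, 'k) nc_poly"
  where "om i = (\<Sum>l\<in>{1..i}. nc_const (1 - inverse (q\<^sup>2)) * var_y l * var_x l)"

text \<open>Each \<open>y\<^sub>l x\<^sub>l\<close> contributes a difference of consecutive
  eigenvalues, and the sum telescopes down to \<open>lam W s 0 = 0\<close>.\<close>

lemma opr_om:
  assumes "\<And>j. 1 \<le> j \<Longrightarrow> j \<le> i \<Longrightarrow> V j \<noteq> 0"
  shows "opr W V (om i) \<phi> s = lam W s i * \<phi> s"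
  using assms
proof (induction i)
  case (Suc i)
  have "om (Suc i) = om i + nc_const coef * var_y (Suc i) * var_x (Suc i)"
    unfolding om_def coef_def by simp
  then have "opr W V (om (Suc i)) \<phi> s = lam W s i * \<phi> s + (lam W s (Suc i) - lam W s i) * \<phi> s"
    using Suc coef_nz by (simp add: opr_simps act_yx del: act_simps)
  then show ?case by (simp add: algebra_simps)
qed (simp add: om_def)

lemma opr_relator:
  assumes "r \<in> euclidean_relators q n" and V: "\<And>j. 1 \<le> j \<Longrightarrow> j \<le> n \<Longrightarrow> V j \<noteq> 0"
  shows "opr W V r \<phi> s = 0"
  using assms(1) unfolding euclidean_relators_def
proof (elim UnE)
  assume "r \<in> {var_x i * var_x j - nc_const q * var_x j * var_x i | i j.
       i \<in> {1..n} \<and> j \<in> {1..n} \<and> i < j}"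
  then obtain i j where r: "r = var_x i * var_x j - nc_const q * var_x j * var_x i"
    "1 \<le> i" "i < j" "j \<le> n" by auto
  show ?thesis unfolding r(1) using q r(2-)
    by (simp add: opr_simps z_updown tau_iota updown(2)[of s i j] q_powi_pred field_simps)
next
  assume "r \<in> {var_y i * var_y j - nc_const (inverse q) * var_y j * var_y i | i j.
       i \<in> {1..n} \<and> j \<in> {1..n} \<and> i < j}"
  then obtain i j where r: "r = var_y i * var_y j - nc_const (inverse q) * var_y j * var_y i"
    "1 \<le> i" "i < j" "j \<le> n" by auto
  then have "i \<le> j - 1" "i - 1 < j" "j - 1 < j" by auto
  then show ?thesis unfolding r(1) using q coef_nz r(2-) V[of i] V[of j]
    by (simp add: opr_simps z_updown tau_iota updown(3)[of s i j] lam_ge lam_less power_int_minus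
        power_int_add power_int_diff power2_eq_square field_simps)
next
  assume "r \<in> {var_x i * var_y j - nc_const (inverse q) * var_y j * var_x i | i j.
       i \<in> {1..n} \<and> j \<in> {1..n} \<and> i \<noteq> j}"
  then obtain i j where r: "r = var_x i * var_y j - nc_const (inverse q) * var_y j * var_x i"
    "1 \<le> i" "1 \<le> j" "i \<le> n" "j \<le> n" "i \<noteq> j" by auto
  show ?thesis
  proof (cases "i < j")
    case True
    then have "i \<le> j - 1" by auto
    then show ?thesis unfolding r(1) using q coef_nz r(2-) V[of i] V[of j] True
      by (simp add: opr_simps z_updown tau_iota updown(1) lam_ge lam_less power_int_minus
          power_int_add power_int_diff power2_eq_square field_simps)
  next
    case False
    then have "j < i" "j - 1 < i" using r by auto
    then show ?thesis unfolding r(1) using q coef_nz r(2-) V[of i] V[of j]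
      by (simp add: opr_simps z_updown tau_iota updown(1) lam_ge lam_less power_int_minus
          power_int_add power_int_diff power2_eq_square field_simps)
  qed
next
  assume "r \<in> {var_x i * var_y i -
       (var_y i * var_x i + (\<Sum>l\<in>{1..<i}. nc_const (1 - inverse (q\<^sup>2)) * var_y l * var_x l)) | i.
       i \<in> {1..n}}"
  then obtain i where i: "r = var_x i * var_y i -
       (var_y i * var_x i + (\<Sum>l\<in>{1..<i}. nc_const (1 - inverse (q\<^sup>2)) * var_y l * var_x l))"
    "1 \<le> i" "i \<le> n" by auto
  moreover have "{1..<i} = {1..i - 1}" using i by auto
  ultimately have r: "r = var_x i * var_y i - (var_y i * var_x i + om (i - 1))" "1 \<le> i" "i \<le> n"
    by (simp_all add: om_def)
  have "opr W V (om (i - 1)) \<phi> s = lam W s (i - 1) * \<phi> s"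
    by (rule opr_om) (use V r in auto)
  \<comment> \<open>The eigenvalues of \<open>x\<^sub>i y\<^sub>i\<close> and
    \<open>y\<^sub>i x\<^sub>i\<close> differ by \<open>(1 - inverse (q\<^sup>2)) / coef\<close>
    times that of \<open>\<omega>\<^sub>i\<^sub>-\<^sub>1\<close>, which is exactly the correction
    term of the relation.\<close>
  moreover have "(a - b / q\<^sup>2) / coef = (a - b) / coef + b" for a b
  proof -
    have "a - b / q\<^sup>2 = a - b + b * coef" by (simp add: coef_def field_simps)
    then have "(a - b / q\<^sup>2) / coef = (a - b) / coef + b * coef / coef" by (simp only: add_divide_distrib)
    then show ?thesis using coef_nz by simp
  qed
  ultimately show ?thesis unfolding r(1) using r(2-) V[of i]
    by (simp add: opr_simps act_yx act_xy algebra_simps del: act_simps)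
qed

end

subsection \<open>Restriction to periodic functions\<close>

context euclidean_factor
begin

definition red :: "(nat \<Rightarrow> int) \<Rightarrow> nat \<Rightarrow> int"
  where "red s = (\<lambda>l. z s l mod int m)"

definition "box = {b. red b = b}"

text \<open>The relations are verified on functions of arbitrary integer vectors, where shifts need
  no reduction modulo \<open>m\<close>. Since \<open>q ^ m = 1\<close>, the operators preserve the
  functions that depend on \<open>red s\<close> only; these form a space of dimension
  \<open>m ^ (n - 2)\<close>.\<close>

definition periodic :: "((nat \<Rightarrow> int) \<Rightarrow> 'k) \<Rightarrow> bool"
  where "periodic \<phi> \<longleftrightarrow> (\<forall>s. \<phi> (red s) = \<phi> s)"

definition per :: "(nat \<Rightarrow> int) \<Rightarrow> (nat \<Rightarrow> int) \<Rightarrow> 'k"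
  where "per b s = (if red s = b then 1 else 0)"

lemma q_powi_mod: "q powi (a mod int m) = q powi a"
proof -
  have "q powi a = q powi (int m * (a div int m) + a mod int m)" by simp
  also have "\<dots> = (q powi int m) powi (a div int m) * q powi (a mod int m)"
    using q by (simp only: power_int_add power_int_mult simp_thms)
  finally show ?thesis by (simp add: q_pow_m)
qed

lemma q_powi_cong: "a mod int m = b mod int m \<Longrightarrow> q powi a = q powi b"
  by (metis q_powi_mod)

lemma z_red: "z (red s) l mod int m = z s l mod int m"
  by (simp add: red_def z_def)

lemma red_red [simp]: "red (red s) = red s"
  unfolding red_def[of "red s"] z_red by (simp add: red_def)

lemma red_in_box: "red s \<in> box"
  by (simp add: box_def)

lemma red_updown: "red (up (red s) j) = red (up s j)" "red (down (red s) j) = red (down s j)"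
  unfolding red_def[of "up _ _"] red_def[of "down _ _"] z_updown
  by (intro ext mod_add_cong mod_diff_cong z_red refl)+

lemma lam_red: "lam W (red s) l = lam W s l"
proof -
  have "q powi (2 * z (red s) l) = q powi (2 * z s l)"
    by (rule q_powi_cong) (rule mod_mult_cong[OF refl z_red])
  then show ?thesis by (simp add: lam_def)
qed

lemma periodic_act:
  assumes "periodic \<phi>"
  shows "periodic (act W V g \<phi>)"
proof -
  have per: "\<phi> (red s) = \<phi> s" for s using assms by (simp add: periodic_def)
  have \<phi>: "\<phi> (down (red s) j) = \<phi> (down s j)" "\<phi> (up (red s) j) = \<phi> (up s j)" for s j
    using per[of "down (red s) j"] per[of "up (red s) j"] per[of "down s j"] per[of "up s j"]
    by (simp_all add: red_updown)
  have zr: "q powi z (red s) l = q powi z s l" for s l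
    by (rule q_powi_cong) (rule z_red)
  have zu: "q powi (- z (up (red s) j) l) = q powi (- z (up s j) l)" for s j l
    unfolding z_updown by (rule q_powi_cong) (intro mod_minus_cong mod_add_cong z_red refl)
  show ?thesis
    unfolding periodic_def by (cases g) (simp_all add: \<phi> zr zu lam_red)
qed

lemma periodic_opr:
  assumes "periodic \<phi>"
  shows "periodic (opr W V f \<phi>)"
proof -
  have "periodic (foldr (act W V) ws \<phi>)" for ws
    using assms by (induction ws) (simp_all add: periodic_act)
  then show ?thesis by (simp add: periodic_def nc_act_def)
qed

lemma periodic_per: "periodic (per b)"
  by (simp add: periodic_def per_def)

lemma box_iff: "b \<in> box \<longleftrightarrow> (\<forall>l. if l \<in> supp then 0 \<le> b l \<and> b l < int m else b l = 0)"
proof -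
  have mpos: "int m > 0" using m by simp
  have "x mod int m = x \<longleftrightarrow> 0 \<le> x \<and> x < int m" for x
    using mod_pos_pos_trivial[of x "int m"] pos_mod_bound[OF mpos, of x] pos_mod_sign[OF mpos, of x]
    by auto
  then show ?thesis by (auto simp: box_def red_def z_def fun_eq_iff)
qed

lemma box_bij: "bij_betw (\<lambda>b. restrict b supp) box (supp \<rightarrow>\<^sub>E {0..<int m})"
proof (rule bij_betw_byWitness[where f' = "\<lambda>b l. if l \<in> supp then b l else 0"])
  show "\<forall>b\<in>box. (\<lambda>l. if l \<in> supp then restrict b supp l else 0) = b"
    by (auto simp: box_iff fun_eq_iff split: if_splits)
  show "\<forall>b\<in>supp \<rightarrow>\<^sub>E {0..<int m}. restrict (\<lambda>l. if l \<in> supp then b l else 0) supp = b"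
    by (auto simp: fun_eq_iff PiE_iff extensional_def)
qed (auto simp: box_iff PiE_iff split: if_splits)

lemma card_supp: "card supp = n - 2"
  using p by (simp add: supp_def)

lemma finite_box: "finite box"
  using bij_betw_finite[OF box_bij] by (simp add: supp_def finite_PiE)

lemma card_box: "card box = m ^ (n - 2)"
  using bij_betw_same_card[OF box_bij] card_supp by (simp add: card_PiE supp_def)

lemma periodic_expand:
  assumes "periodic \<phi>"
  shows "\<phi> = (\<lambda>s. \<Sum>b\<in>box. \<phi> b * per b s)"
proof
  fix s
  have "(\<Sum>b\<in>box. \<phi> b * per b s) = (\<Sum>b\<in>box. if b = red s then \<phi> b else 0)"
    by (rule sum.cong) (auto simp: per_def)
  also have "\<dots> = \<phi> (red s)" using finite_box red_in_box by (simp add: sum.delta)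
  finally show "\<phi> s = (\<Sum>b\<in>box. \<phi> b * per b s)" using assms by (simp add: periodic_def)
qed

section \<open>Matrix entries and the action of words\<close>

definition ent :: "(nat \<Rightarrow> 'k) \<Rightarrow> (nat \<Rightarrow> 'k) \<Rightarrow> (euclidean_gen, 'k) nc_poly \<Rightarrow> (nat \<Rightarrow> int) \<Rightarrow> (nat \<Rightarrow> int) \<Rightarrow> 'k"
  where "ent W V f a b = opr W V f (per b) a"

lemma ent_mult: "ent W V (f * g) a b = (\<Sum>c\<in>box. ent W V f a c * ent W V g c b)"
proof -
  have "opr W V g (per b) = (\<lambda>s. \<Sum>c\<in>box. opr W V g (per b) c * per c s)"
    by (rule periodic_expand[OF periodic_opr[OF periodic_per]])
  then have "ent W V (f * g) a b = opr W V f (\<lambda>s. \<Sum>c\<in>box. opr W V g (per b) c * per c s) a"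
    unfolding ent_def nc_act_mult[OF linear_act] by (rule arg_cong)
  then show ?thesis
    unfolding nc_act_sum_right[OF linear_act] by (simp add: ent_def mult.commute)
qed

lemma ent_one: "a \<in> box \<Longrightarrow> ent W V 1 a b = (if a = b then 1 else 0)"
  by (simp add: ent_def nc_act_one per_def box_def)

lemma ent_sum: "ent W V (sum f A) a b = (\<Sum>x\<in>A. ent W V (f x) a b)"
  by (simp add: ent_def nc_act_sum)

lemma ent_const_mult: "ent W V (nc_const c * f) a b = c * ent W V f a b"
  by (simp add: ent_def opr_simps)

lemma ent_prod_list:
  "a \<in> box \<Longrightarrow> ent W V (prod_list fs) a b = mat_prod box (map (ent W V) fs) a b"
  by (induction fs arbitrary: a) (simp_all add: ent_one ent_mult)

definition gstep :: "euclidean_gen \<Rightarrow> (nat \<Rightarrow> int) \<Rightarrow> nat \<Rightarrow> int"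
  where "gstep g s = (case g of GenX j \<Rightarrow> down s j | GenY j \<Rightarrow> up s j)"

text \<open>A generator acts by the shift \<open>gstep\<close>, a monomial in \<open>V\<close> with
  exponents \<open>gdeg\<close>, and this remaining coefficient, which is free of
  \<open>V\<close>.\<close>

definition gcoef :: "(nat \<Rightarrow> 'k) \<Rightarrow> euclidean_gen \<Rightarrow> (nat \<Rightarrow> int) \<Rightarrow> 'k"
  where "gcoef W g s = (case g of GenX j \<Rightarrow> q powi (z s (iota j))
    | GenY j \<Rightarrow> inverse coef * (lam W s j - lam W s (j - 1)) * q powi (- (z (up s j) (iota j))))"

primrec wcoef :: "(nat \<Rightarrow> 'k) \<Rightarrow> euclidean_gen list \<Rightarrow> (nat \<Rightarrow> int) \<Rightarrow> 'k"
  where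
    "wcoef W [] s = 1"
  | "wcoef W (g # gs) s = gcoef W g s * wcoef W gs (gstep g s)"

definition gdeg :: "euclidean_gen \<Rightarrow> nat \<Rightarrow> int"
  where "gdeg g i = (case g of GenX j \<Rightarrow> if i = j then 1 else 0 | GenY j \<Rightarrow> if i = j then - 1 else 0)"

definition wdeg :: "euclidean_gen list \<Rightarrow> nat \<Rightarrow> int"
  where "wdeg gs i = (\<Sum>g\<leftarrow>gs. gdeg g i)"

definition gens :: "euclidean_gen set"
  where "gens = GenX ` {1..n} \<union> GenY ` {1..n}"

text \<open>The difference occurring here is the factor of \<open>y\<^sub>i\<close> that could
  vanish; without such zeros every word has a nonzero coefficient at every index.\<close>

definition separated :: "(nat \<Rightarrow> 'k) \<Rightarrow> bool"
  where "separated W \<longleftrightarrow> (\<forall>i\<in>{1..n}. \<forall>s. lam W s i \<noteq> lam W s (i - 1))"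

lemma act_monomial:
  assumes "g \<in> gens"
  shows "act W V g \<phi> s = (\<Prod>i<Suc n. V i powi gdeg g i) * gcoef W g s * \<phi> (gstep g s)"
proof -
  obtain j where j: "j \<in> {1..n}" "g = GenX j \<or> g = GenY j" using assms by (auto simp: gens_def)
  then have "j < Suc n" by simp
  then have "(\<Prod>i<Suc n. V i powi gdeg (GenX j) i) = V j"
    "(\<Prod>i<Suc n. V i powi gdeg (GenY j) i) = inverse (V j)"
    unfolding gdeg_def euclidean_gen.case by (simp_all only: prod_powi_delta power_int_minus power_int_1_right)
  then show ?thesis using j(2)
    by (auto simp: gcoef_def gstep_def mult_ac simp del: prod.lessThan_Suc)
qed

lemma foldr_act_monomial:
  assumes "set gs \<subseteq> gens" "\<And>i. i \<le> n \<Longrightarrow> V i \<noteq> 0"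
  shows "foldr (act W V) gs \<phi> s =
    (\<Prod>i<Suc n. V i powi wdeg gs i) * wcoef W gs s * \<phi> (fold gstep gs s)"
  using assms(1)
proof (induction gs arbitrary: s)
  case Nil
  then show ?case by (simp add: wdeg_def del: prod.lessThan_Suc)
next
  case (Cons g gs)
  have "(\<Prod>i<Suc n. V i powi wdeg (g # gs) i) =
      (\<Prod>i<Suc n. V i powi gdeg g i * V i powi wdeg gs i)"
    by (rule prod.cong[OF refl]) (simp add: wdeg_def power_int_add assms(2))
  moreover have "foldr (act W V) (g # gs) \<phi> s =
      (\<Prod>i<Suc n. V i powi gdeg g i) * gcoef W g s * foldr (act W V) gs \<phi> (gstep g s)"
    using act_monomial[of g W V "foldr (act W V) gs \<phi>" s] Cons.prems by simp
  ultimately show ?case using Cons by (simp add: prod.distrib mult_ac del: prod.lessThan_Suc)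
qed

lemma wcoef_nonzero:
  assumes "set gs \<subseteq> gens" "separated W"
  shows "wcoef W gs s \<noteq> 0"
  using assms(1)
proof (induction gs arbitrary: s)
  case (Cons g gs)
  have "gcoef W g s \<noteq> 0"
    using Cons.prems assms(2) coef_nz q by (auto simp: gcoef_def gens_def separated_def)
  then show ?case using Cons by simp
qed simp

text \<open>Since \<open>q ^ m = 1\<close>, \<open>lam W s l ^ m\<close> does not depend on
  \<open>s\<close>. Hence the condition for all \<open>s\<close> follows from finitely many
  inequalities between \<open>m\<close>-th powers of parameters, with 0 in place of
  \<open>W 0\<close> and \<open>W p\<close>.\<close>

lemma generic_separated: "generic (Suc n) separated"
proof -
  have "generic (Suc n) (\<lambda>W. \<forall>i\<in>{1..n}. \<forall>s. lam W s i \<noteq> lam W s (i - 1))"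
  proof (rule generic_Ball)
    fix i assume i: "i \<in> {1..n}"
    let ?w = "\<lambda>W l. if l = 0 \<or> l = p then 0 else W l :: 'k"
    have mpos: "m > 0" using m by simp
    have "generic (Suc n) (\<lambda>W. ?w W i ^ m \<noteq> ?w W (i - 1) ^ m)"
    proof -
      \<comment> \<open>By \<open>2 \<le> p\<close> the indices \<open>0\<close> and
        \<open>p\<close> are not neighbours, so two adjacent eigenvalues are never both forced to be
        0; next to a forced 0 it suffices that the other parameter is nonzero.\<close>
      consider "i = p" | "i \<noteq> p" "i - 1 = 0 \<or> i - 1 = p" | "i \<noteq> p" "i - 1 \<noteq> 0" "i - 1 \<noteq> p" by blast
      then show ?thesis
      proof cases
        case 1
        have "generic (Suc n) (\<lambda>W :: nat \<Rightarrow> 'k. W (p - 1) \<noteq> 0)" by (rule generic_nonzero) (use p in simp)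
        then show ?thesis by (rule generic_mono) (use 1 p mpos in \<open>simp add: power_0_left\<close>)
      next
        case 2
        have "generic (Suc n) (\<lambda>W :: nat \<Rightarrow> 'k. W i \<noteq> 0)" by (rule generic_nonzero) (use i in simp)
        then show ?thesis by (rule generic_mono) (use 2 i mpos in \<open>simp add: power_0_left\<close>)
      next
        case 3
        have "generic (Suc n) (\<lambda>W :: nat \<Rightarrow> 'k. W i ^ m \<noteq> W (i - 1) ^ m)"
          by (rule generic_power_neq) (use i mpos in auto)
        then show ?thesis by (rule generic_mono) (use 3 i in simp)
      qed
    qed
    then show "generic (Suc n) (\<lambda>W. \<forall>s. lam W s i \<noteq> lam W s (i - 1))"
    proof (rule generic_mono, intro allI notI)
      fix W s assume W: "?w W i ^ m \<noteq> ?w W (i - 1) ^ m" "lam W s i = lam W s (i - 1)"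
      have "lam W s l ^ m = ?w W l ^ m" for l
      proof -
        have "(q powi (2 * z s l)) ^ m = (q ^ m) powi (2 * z s l)"
          by (metis power_int_mult power_int_of_nat mult.commute)
        then show ?thesis unfolding lam_def power_mult_distrib by (simp add: q_pow_m)
      qed
      then show False using W by metis
    qed
  qed simp
  then show ?thesis by (simp add: separated_def[abs_def])
qed

section \<open>Standard monomials and their independence\<close>

definition omk :: "(nat \<Rightarrow> nat) \<Rightarrow> (euclidean_gen, 'k) nc_poly"
  where "omk k = prod_list (map (\<lambda>i. om i ^ k i) [1..<Suc n])"

text \<open>\<open>nat\<close> truncates at 0, so a positive \<open>d i\<close> stands for a power
  of \<open>x\<^sub>i\<close> and a negative one for a power of \<open>y\<^sub>i\<close>. In this
  encoding \<open>d\<close> is the exponent vector of \<open>V\<close> in the action of the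
  word.\<close>

definition uword :: "(nat \<Rightarrow> int) \<Rightarrow> euclidean_gen list"
  where "uword d = concat (map (\<lambda>i. replicate (nat (d i)) (GenX i) @ replicate (nat (- d i)) (GenY i)) [1..<Suc n])"

definition std :: "(nat \<Rightarrow> nat) \<times> (nat \<Rightarrow> int) \<Rightarrow> (euclidean_gen, 'k) nc_poly"
  where "std e = omk (fst e) * Poly_Mapping.single (Word (uword (snd e))) 1"

definition std_index :: "((nat \<Rightarrow> nat) \<times> (nat \<Rightarrow> int)) set"
  where "std_index = {(k, d). (\<forall>i. i \<notin> {1..n} - {p} \<longrightarrow> k i = 0) \<and> (\<forall>i. i \<notin> {1..n} \<longrightarrow> d i = 0)}"

lemma std_index_eqI:
  assumes "e \<in> std_index" "e' \<in> std_index"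
  shows "(\<forall>i<Suc n. fst e i = fst e' i) \<Longrightarrow> fst e = fst e'"
    and "(\<forall>i<Suc n. snd e i = snd e' i) \<Longrightarrow> snd e = snd e'"
proof -
  have *: "fst e i = 0" "fst e' i = 0" "snd e i = 0" "snd e' i = 0" if "\<not> i < Suc n" for i
    using assms that by (auto simp: std_index_def)
  show "(\<forall>i<Suc n. fst e i = fst e' i) \<Longrightarrow> fst e = fst e'"
    using *(1,2) by (metis ext)
  show "(\<forall>i<Suc n. snd e i = snd e' i) \<Longrightarrow> snd e = snd e'"
    using *(3,4) by (metis ext)
qed

lemma uword_gens: "set (uword d) \<subseteq> gens"
  by (auto simp: uword_def gens_def)

lemma wdeg_uword:
  assumes "\<forall>i. i \<notin> {1..n} \<longrightarrow> d i = 0"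
  shows "wdeg (uword d) = d"
proof
  fix i
  have app: "wdeg (xs @ ys) i = wdeg xs i + wdeg ys i" for xs ys by (simp add: wdeg_def)
  have rep: "wdeg (replicate k g) i = int k * gdeg g i" for k g
    by (simp add: wdeg_def sum_list_replicate)
  have "wdeg (concat (map (\<lambda>i. replicate (nat (d i)) (GenX i) @ replicate (nat (- d i)) (GenY i)) ls)) i =
      (\<Sum>l\<leftarrow>ls. if i = l then d l else 0)" for ls
  proof (induction ls)
    case (Cons l ls)
    then show ?case by (simp add: app rep) (simp add: gdeg_def)
  qed (simp add: wdeg_def)
  then have "wdeg (uword d) i = (\<Sum>l\<leftarrow>[1..<Suc n]. if i = l then d l else 0)"
    unfolding uword_def by blast
  also have "\<dots> = (\<Sum>l\<in>set [1..<Suc n]. if i = l then d l else 0)"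
    by (rule sum_list_distinct_conv_sum_set) simp
  also have "\<dots> = d i" using assms by (auto simp: sum.delta' simp del: upt_Suc)
  finally show "wdeg (uword d) i = d i" .
qed

lemma opr_om_power:
  assumes "\<And>j. 1 \<le> j \<Longrightarrow> j \<le> i \<Longrightarrow> V j \<noteq> 0"
  shows "opr W V (om i ^ k) \<phi> s = lam W s i ^ k * \<phi> s"
  using opr_om[OF assms] by (induction k) (simp_all add: nc_act_one nc_act_mult[OF linear_act] mult.assoc)

text \<open>At the index 0 every power of \<open>q\<close> in \<open>lam\<close> is 1, so this row
  shows the exact monomial in \<open>W\<close>.\<close>

lemma opr_omk:
  assumes k: "\<And>i. i \<notin> {1..n} - {p} \<Longrightarrow> k i = 0" and V: "\<And>i. i \<le> n \<Longrightarrow> V i \<noteq> 0"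
  shows "opr W V (omk k) \<phi> (\<lambda>_. 0) = (\<Prod>i<Suc n. W i powi int (k i)) * \<phi> (\<lambda>_. 0)"
proof -
  let ?s = "\<lambda>_. 0 :: int"
  have aux: "opr W V (prod_list (map (\<lambda>i. om i ^ k i) ls)) \<phi> ?s = (\<Prod>i\<leftarrow>ls. lam W ?s i ^ k i) * \<phi> ?s"
    if "set ls \<subseteq> {1..n}" for ls
    using that
  proof (induction ls)
    case Nil
    then show ?case by (simp add: nc_act_one)
  next
    case (Cons l ls)
    then have "opr W V (om l ^ k l) \<psi> ?s = lam W ?s l ^ k l * \<psi> ?s" for \<psi>
      by (intro opr_om_power V) auto
    then show ?case using Cons by (simp add: nc_act_mult[OF linear_act] mult.assoc)
  qed
  have "opr W V (omk k) \<phi> ?s = (\<Prod>i\<leftarrow>[1..<Suc n]. lam W ?s i ^ k i) * \<phi> ?s"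
    unfolding omk_def by (rule aux) auto
  also have "(\<Prod>i\<leftarrow>[1..<Suc n]. lam W ?s i ^ k i) = (\<Prod>i\<in>{1..<Suc n}. lam W ?s i ^ k i)"
    by (subst prod.distinct_set_conv_list[symmetric]) (simp_all del: upt_Suc)
  also have "\<dots> = (\<Prod>i\<in>{1..<Suc n}. W i powi int (k i))"
    by (rule prod.cong[OF refl]) (use k[of p] in \<open>auto simp: lam_def z_def\<close>)
  also have "\<dots> = (\<Prod>i<Suc n. W i powi int (k i))"
    by (rule prod.mono_neutral_left) (use k[of 0] in \<open>auto simp: not_le less_Suc_eq_le\<close>)
  finally show ?thesis .
qed

lemma opr_std:
  assumes e: "e \<in> std_index" and V: "\<And>i. i \<le> n \<Longrightarrow> V i \<noteq> 0"
  shows "opr W V (std e) \<phi> (\<lambda>_. 0) = (\<Prod>i<Suc n. W i powi int (fst e i)) *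
    ((\<Prod>i<Suc n. V i powi snd e i) * wcoef W (uword (snd e)) (\<lambda>_. 0) *
      \<phi> (fold gstep (uword (snd e)) (\<lambda>_. 0)))"
proof -
  have k: "fst e i = 0" if "i \<notin> {1..n} - {p}" for i using e that by (auto simp: std_index_def)
  have d: "\<forall>i. i \<notin> {1..n} \<longrightarrow> snd e i = 0" using e by (auto simp: std_index_def)
  show ?thesis
  proof -
    have "opr W V (omk (fst e)) \<psi> (\<lambda>_. 0) = (\<Prod>i<Suc n. W i powi int (fst e i)) * \<psi> (\<lambda>_. 0)" for \<psi>
      by (rule opr_omk) (fact k, fact V)
    moreover have "foldr (act W V) (uword (snd e)) \<phi> s = (\<Prod>i<Suc n. V i powi snd e i) *
        wcoef W (uword (snd e)) s * \<phi> (fold gstep (uword (snd e)) s)" for s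
      using foldr_act_monomial[of "uword (snd e)" V W \<phi> s] V uword_gens
      by (simp only: wdeg_uword[OF d] simp_thms)
    ultimately show ?thesis
      unfolding std_def nc_act_mult[OF linear_act]
      by (simp only: nc_act_single free_monoid.sel mult_1_left)
  qed
qed

text \<open>Terms with different \<open>d\<close> have different monomials in \<open>V\<close>.
  Terms with the same \<open>d\<close> share the word, hence its coefficient and its column, and
  differ in their monomials in \<open>W\<close>. Therefore \<open>W\<close> is made generic first,
  which keeps the coefficient at the \<open>V\<close>-monomial of \<open>e0\<close> nonzero, and
  \<open>V\<close> afterwards; \<open>b\<close> is the column reached by the word of
  \<open>e0\<close>.\<close>

lemma generic_std_combination:
  assumes E: "finite E" "E \<subseteq> std_index" and e0: "e0 \<in> E" "c e0 \<noteq> 0"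
  obtains b where "b \<in> box" "generic (Suc n) (\<lambda>W. generic (Suc n) (\<lambda>V.
    (\<forall>i\<le>n. V i \<noteq> 0) \<longrightarrow> ent W V (\<Sum>e\<in>E. nc_const (c e) * std e) (\<lambda>_. 0) b \<noteq> 0))"
proof -
  let ?t = "\<lambda>d. red (fold gstep (uword d) (\<lambda>_. 0))"
  define b where "b = ?t (snd e0)"
  define D where "D = snd ` E"
  let ?P = "\<lambda>W d. \<Sum>e | e \<in> E \<and> snd e = d. c e * (\<Prod>i<Suc n. W i powi int (fst e i))"
  have "generic (Suc n) (\<lambda>W. separated W \<and> ?P W (snd e0) \<noteq> 0)"
  proof (rule generic_conj[OF generic_separated generic_laurent_nonzero])
    fix e assume e: "e \<in> {e. e \<in> E \<and> snd e = snd e0}" "e \<noteq> e0"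
    then have "fst e \<noteq> fst e0" by (auto simp: prod_eq_iff)
    then show "\<exists>i<Suc n. int (fst e i) \<noteq> int (fst e0 i)"
      using std_index_eqI(1)[of e e0] e E(2) e0 by auto
  qed (use E e0 in auto)
  then have "generic (Suc n) (\<lambda>W. generic (Suc n) (\<lambda>V.
    (\<forall>i\<le>n. V i \<noteq> 0) \<longrightarrow> ent W V (\<Sum>e\<in>E. nc_const (c e) * std e) (\<lambda>_. 0) b \<noteq> 0))"
  proof (rule generic_mono)
    fix W assume W: "separated W \<and> ?P W (snd e0) \<noteq> 0"
    \<comment> \<open>\<open>a d\<close> is the coefficient of the \<open>V\<close>-monomial with
      exponents \<open>d\<close> in column \<open>b\<close>; words leading to another column
      contribute 0.\<close>
    define a where "a d = wcoef W (uword d) (\<lambda>_. 0) * ?P W d * (if ?t d = b then 1 else 0)" for d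
    have "a (snd e0) \<noteq> 0"
      using W wcoef_nonzero[OF uword_gens, of W] unfolding a_def b_def by simp
    moreover have "\<exists>i<Suc n. d i \<noteq> snd e0 i" if "d \<in> D" "d \<noteq> snd e0" for d
      using that std_index_eqI(2)[of _ e0] E(2) e0 unfolding D_def by blast
    ultimately have "generic (Suc n) (\<lambda>V. (\<Sum>d\<in>D. a d * (\<Prod>i<Suc n. V i powi d i)) \<noteq> 0)"
      by (intro generic_laurent_nonzero[of D "snd e0"]) (use E e0 in \<open>auto simp: D_def\<close>)
    then show "generic (Suc n) (\<lambda>V.
      (\<forall>i\<le>n. V i \<noteq> 0) \<longrightarrow> ent W V (\<Sum>e\<in>E. nc_const (c e) * std e) (\<lambda>_. 0) b \<noteq> 0)"
    proof (rule generic_mono, intro impI)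
      fix V assume V: "(\<Sum>d\<in>D. a d * (\<Prod>i<Suc n. V i powi d i)) \<noteq> 0" "\<forall>i\<le>n. V i \<noteq> 0"
      let ?h = "\<lambda>e. c e * ent W V (std e) (\<lambda>_. 0) b"
      have h: "?h e = c e * (\<Prod>i<Suc n. W i powi int (fst e i)) *
          (wcoef W (uword (snd e)) (\<lambda>_. 0) * (if ?t (snd e) = b then 1 else 0) * (\<Prod>i<Suc n. V i powi snd e i))"
        if "e \<in> E" for e
      proof -
        have "e \<in> std_index" using that E(2) by blast
        moreover have "V i \<noteq> 0" if "i \<le> n" for i using V that by blast
        ultimately show ?thesis
          using opr_std[of e V W "per b"] unfolding ent_def by (simp only: per_def mult_ac simp_thms)
      qed
      have "ent W V (\<Sum>e\<in>E. nc_const (c e) * std e) (\<lambda>_. 0) b = (\<Sum>e\<in>E. ?h e)"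
        by (simp add: ent_sum ent_const_mult)
      also have "\<dots> = (\<Sum>d\<in>D. \<Sum>e | e \<in> E \<and> snd e = d. ?h e)"
        unfolding D_def by (rule sum.image_gen[OF E(1)])
      also have "\<dots> = (\<Sum>d\<in>D. a d * (\<Prod>i<Suc n. V i powi d i))"
      proof (rule sum.cong[OF refl])
        fix d
        have "(\<Sum>e | e \<in> E \<and> snd e = d. ?h e) = (\<Sum>e | e \<in> E \<and> snd e = d.
            c e * (\<Prod>i<Suc n. W i powi int (fst e i)) *
            (wcoef W (uword d) (\<lambda>_. 0) * (if ?t d = b then 1 else 0) * (\<Prod>i<Suc n. V i powi d i)))"
          by (rule sum.cong[OF refl]) (use h in blast)
        also have "\<dots> = ?P W d * (wcoef W (uword d) (\<lambda>_. 0) * (if ?t d = b then 1 else 0) * (\<Prod>i<Suc n. V i powi d i))"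
          by (rule sum_distrib_right[symmetric])
        finally show "(\<Sum>e | e \<in> E \<and> snd e = d. ?h e) = a d * (\<Prod>i<Suc n. V i powi d i)"
          unfolding a_def by (simp only: mult_ac)
      qed
      finally show "ent W V (\<Sum>e\<in>E. nc_const (c e) * std e) (\<lambda>_. 0) b \<noteq> 0"
        using V by simp
    qed
  qed
  then show ?thesis using that red_in_box unfolding b_def by blast
qed

end

section \<open>Spanning monomials\<close>

lemma nc_const_commute: "f * nc_const a = nc_const a * f"
proof -
  have "f * nc_const a = (\<Sum>w\<in>Poly_Mapping.keys f. Poly_Mapping.single w (Poly_Mapping.lookup f w)) * nc_const a"
    using nc_poly_eq_sum_single[of f] by simp
  also have "\<dots> = nc_const a * (\<Sum>w\<in>Poly_Mapping.keys f. Poly_Mapping.single w (Poly_Mapping.lookup f w))"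
    unfolding sum_distrib_left sum_distrib_right
    by (rule sum.cong[OF refl]) (simp add: nc_const_def mult_single mult.commute)
  also have "\<dots> = nc_const a * f" using nc_poly_eq_sum_single[of f] by simp
  finally show ?thesis .
qed

lemma nc_const_left_commute: "f * (nc_const a * g) = nc_const a * (f * g)"
  by (simp only: nc_const_commute[of f a] flip: mult.assoc)

lemma nc_const_mult: "nc_const a * nc_const b = nc_const (a * b)"
  by (simp add: nc_const_def mult_single)

lemma nc_const_mult_left: "nc_const a * (nc_const b * f) = nc_const (a * b) * f"
  by (simp add: nc_const_mult flip: mult.assoc)

lemma nc_const_add: "nc_const (a + b) = nc_const a + nc_const b"
  by (simp add: nc_const_def single_add)

lemma nc_const_1 [simp]: "nc_const 1 = 1" and nc_const_0 [simp]: "nc_const 0 = 0"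
  by (simp_all add: nc_const_def)

lemma nc_const_uminus: "nc_const (- a) = - nc_const a"
  by (simp add: nc_const_def single_uminus)

lemma nc_single_word: "Poly_Mapping.single (Word ws) (1 :: 'k::comm_ring_1) = prod_list (map nc_var ws)"
proof (induction ws)
  case Nil
  then show ?case by (simp flip: zero_free_monoid_def)
next
  case (Cons w ws)
  have "Poly_Mapping.single (Word (w # ws)) (1::'k) = nc_var w * Poly_Mapping.single (Word ws) 1"
    by (simp add: nc_var_def mult_single plus_free_monoid_def)
  then show ?case using Cons by simp
qed

text \<open>Congruences between elements of the free algebra avoid calculations with cosets of
  cosets. \<open>J\<close> will be the kernel of the map onto the factor algebra; the rewriting
  relies on its being an ideal that contains the relators and \<open>om p\<close>.\<close>

locale euclidean_congruence = euclidean_factor q m n p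
  for q :: "'k::alg_closed_field" and m n p +
  fixes J :: "(euclidean_gen, 'k) nc_poly set"
  assumes J_sub: "J \<subseteq> carrier (free_algebra gens)"
    and J_zero: "0 \<in> J" and J_add: "f \<in> J \<Longrightarrow> g \<in> J \<Longrightarrow> f + g \<in> J"
    and J_mult: "f \<in> J \<Longrightarrow> g \<in> carrier (free_algebra gens) \<Longrightarrow> f * g \<in> J"
      "f \<in> J \<Longrightarrow> g \<in> carrier (free_algebra gens) \<Longrightarrow> g * f \<in> J"
    and J_rel: "euclidean_relators q n \<subseteq> J" and J_om: "om p \<in> J"
begin

section \<open>Congruence and commutation up to scalars\<close>

abbreviation "F \<equiv> (carrier (free_algebra gens) :: (euclidean_gen, 'k) nc_poly set)"

lemma F_power: "f \<in> F \<Longrightarrow> f ^ k \<in> F"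
  by (induction k) (simp_all add: nc_closed)

lemma F_prod_list: "(\<And>f. f \<in> set fs \<Longrightarrow> f \<in> F) \<Longrightarrow> prod_list fs \<in> F"
  by (induction fs) (simp_all add: nc_closed)

lemma F_var: "i \<in> {1..n} \<Longrightarrow> var_x i \<in> F" "i \<in> {1..n} \<Longrightarrow> var_y i \<in> F"
  by (auto intro!: nc_closed_var simp: gens_def)

lemma F_om: "i \<le> n \<Longrightarrow> om i \<in> F"
  unfolding om_def by (intro nc_sum_closed nc_closed F_var) auto

lemmas F_intros = nc_closed F_power F_var F_om

lemma J_uminus: "f \<in> J \<Longrightarrow> - f \<in> J"
  using J_mult(1)[of f "nc_const (- 1)", OF _ nc_closed_const]
  by (simp add: nc_const_uminus)

definition cg :: "(euclidean_gen, 'k) nc_poly \<Rightarrow> (euclidean_gen, 'k) nc_poly \<Rightarrow> bool" (infix "\<doteq>" 50)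
  where "f \<doteq> g \<longleftrightarrow> f \<in> F \<and> g \<in> F \<and> f - g \<in> J"

lemma cg_refl: "f \<in> F \<Longrightarrow> f \<doteq> f"
  by (simp add: cg_def J_zero)

lemma cg_sym: "f \<doteq> g \<Longrightarrow> g \<doteq> f"
  using J_uminus[of "f - g"] by (simp add: cg_def)

lemma cg_trans [trans]: "f \<doteq> g \<Longrightarrow> g \<doteq> h \<Longrightarrow> f \<doteq> h"
  using J_add[of "f - g" "g - h"] by (simp add: cg_def)

lemma cg_add: "f \<doteq> f' \<Longrightarrow> g \<doteq> g' \<Longrightarrow> f + g \<doteq> f' + g'"
  using J_add[of "f - f'" "g - g'"] by (simp add: cg_def nc_closed algebra_simps)

lemma cg_mult: "f \<doteq> f' \<Longrightarrow> g \<doteq> g' \<Longrightarrow> f * g \<doteq> f' * g'"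
proof -
  assume *: "f \<doteq> f'" "g \<doteq> g'"
  then have "(f - f') * g \<in> J" "f' * (g - g') \<in> J"
    by (auto simp: cg_def intro: J_mult)
  then have "(f - f') * g + f' * (g - g') \<in> J" by (rule J_add)
  then show ?thesis using * by (simp add: cg_def nc_closed algebra_simps)
qed

lemma cg_mult_left: "f \<doteq> f' \<Longrightarrow> g \<in> F \<Longrightarrow> g * f \<doteq> g * f'"
  by (simp add: cg_mult cg_refl)

lemma cg_mult_right: "f \<doteq> f' \<Longrightarrow> g \<in> F \<Longrightarrow> f * g \<doteq> f' * g"
  by (simp add: cg_mult cg_refl)

lemma cg_rel: "f - g \<in> euclidean_relators q n \<Longrightarrow> f \<in> F \<Longrightarrow> g \<in> F \<Longrightarrow> f \<doteq> g"
  using J_rel by (auto simp: cg_def)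

definition qc :: "(euclidean_gen, 'k) nc_poly \<Rightarrow> 'k \<Rightarrow> (euclidean_gen, 'k) nc_poly \<Rightarrow> bool"
  where "qc g a h \<longleftrightarrow> g \<in> F \<and> h \<in> F \<and> g * h \<doteq> nc_const a * (h * g)"

lemma qcD: "qc g a h \<Longrightarrow> g * h \<doteq> nc_const a * (h * g)"
  by (simp add: qc_def)

lemma qc_mult:
  assumes "qc g a h1" "qc g b h2"
  shows "qc g (a * b) (h1 * h2)"
proof -
  have F: "g \<in> F" "h1 \<in> F" "h2 \<in> F" using assms by (auto simp: qc_def)
  have "g * (h1 * h2) = (g * h1) * h2" by (simp add: mult.assoc)
  also have "\<dots> \<doteq> (nc_const a * (h1 * g)) * h2" using assms F by (intro cg_mult_right) (auto simp: qc_def)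
  also have "\<dots> = nc_const a * h1 * (g * h2)" by (simp add: mult.assoc)
  also have "\<dots> \<doteq> nc_const a * h1 * (nc_const b * (h2 * g))"
    using assms F by (intro cg_mult_left) (auto simp: qc_def intro: nc_closed)
  also have "\<dots> = nc_const (a * b) * (h1 * h2 * g)"
    by (simp only: mult.assoc nc_const_left_commute[of h1] nc_const_mult_left)
  finally show ?thesis using F by (simp add: qc_def nc_closed)
qed

lemma qc_const: "g \<in> F \<Longrightarrow> qc g 1 (nc_const c)"
  by (simp add: qc_def nc_closed nc_const_commute cg_refl)

lemma qc_one: "g \<in> F \<Longrightarrow> qc g 1 1"
  using qc_const[of g 1] by simp

lemma qc_zero: "g \<in> F \<Longrightarrow> qc g a 0"
  by (simp add: qc_def nc_closed cg_refl)

lemma qc_add: "qc g a h1 \<Longrightarrow> qc g a h2 \<Longrightarrow> qc g a (h1 + h2)"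
  using cg_add[of "g * h1" "nc_const a * (h1 * g)" "g * h2" "nc_const a * (h2 * g)"]
  by (simp add: qc_def nc_closed distrib_left distrib_right)

lemma qc_sum: "g \<in> F \<Longrightarrow> (\<And>x. x \<in> A \<Longrightarrow> qc g a (h x)) \<Longrightarrow> qc g a (sum h A)"
  by (induction A rule: infinite_finite_induct) (simp_all add: qc_add qc_zero)

lemma qc_sym:
  assumes "qc g a h" "a \<noteq> 0"
  shows "qc h (inverse a) g"
proof -
  have F: "g \<in> F" "h \<in> F" using assms by (auto simp: qc_def)
  have "nc_const (inverse a) * (nc_const a * (h * g)) \<doteq> nc_const (inverse a) * (g * h)"
    by (rule cg_mult_left[OF cg_sym[OF qcD[OF assms(1)]]]) (rule nc_closed)
  then show ?thesis using F assms(2) by (simp add: qc_def nc_const_mult_left)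
qed

lemma qc_power:
  assumes "qc g a h"
  shows "qc g (a ^ k) (h ^ k)"
proof (induction k)
  case 0
  have "g \<in> F" using assms by (simp add: qc_def)
  then show ?case using qc_one by simp
next
  case (Suc k)
  then show ?case using qc_mult[OF assms Suc] by simp
qed

lemma qc_prod_list:
  "g \<in> F \<Longrightarrow> (\<And>h. h \<in> set hs \<Longrightarrow> \<exists>a. qc g a h) \<Longrightarrow> \<exists>a. qc g a (prod_list hs)"
proof (induction hs)
  case Nil
  then show ?case using qc_one by auto
next
  case (Cons h hs)
  obtain a where "qc g a h" using Cons.prems(2)[of h] by auto
  moreover obtain b where "qc g b (prod_list hs)" using Cons.IH[OF Cons.prems(1)] Cons.prems(2) by auto
  ultimately have "qc g (a * b) (prod_list (h # hs))" by (simp add: qc_mult)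
  then show ?case by (rule exI)
qed

lemma qc_xx:
  assumes "i \<in> {1..n}" "j \<in> {1..n}" "i < j"
  shows "qc (var_x i) (q) (var_x j)"
proof -
  have "var_x i * var_x j - nc_const (q) * var_x j * var_x i \<in> euclidean_relators q n"
    unfolding euclidean_relators_def
    by (rule UnI1, rule UnI1, rule UnI1, rule CollectI, rule exI[of _ i], rule exI[of _ j], intro conjI refl assms)
  then show ?thesis
    unfolding qc_def mult.assoc[symmetric] by (intro conjI cg_rel F_intros assms)
qed

lemma qc_yy:
  assumes "i \<in> {1..n}" "j \<in> {1..n}" "i < j"
  shows "qc (var_y i) (inverse q) (var_y j)"
proof -
  have "var_y i * var_y j - nc_const (inverse q) * var_y j * var_y i \<in> euclidean_relators q n"
    unfolding euclidean_relators_def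
    by (rule UnI1, rule UnI1, rule UnI2, rule CollectI, rule exI[of _ i], rule exI[of _ j], intro conjI refl assms)
  then show ?thesis
    unfolding qc_def mult.assoc[symmetric] by (intro conjI cg_rel F_intros assms)
qed

lemma qc_xy:
  assumes "i \<in> {1..n}" "j \<in> {1..n}" "i \<noteq> j"
  shows "qc (var_x i) (inverse q) (var_y j)"
proof -
  have "var_x i * var_y j - nc_const (inverse q) * var_y j * var_x i \<in> euclidean_relators q n"
    unfolding euclidean_relators_def
    by (rule UnI1, rule UnI2, rule CollectI, rule exI[of _ i], rule exI[of _ j], intro conjI refl assms)
  then show ?thesis
    unfolding qc_def mult.assoc[symmetric] by (intro conjI cg_rel F_intros assms)
qed

lemma cg_xy:
  assumes "i \<in> {1..n}"
  shows "var_x i * var_y i \<doteq> var_y i * var_x i + om (i - 1)"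
proof (rule cg_rel)
  have "{1..<i} = {1..i - 1}" using assms by auto
  then have "om (i - 1) = (\<Sum>l\<in>{1..<i}. nc_const (1 - inverse (q\<^sup>2)) * var_y l * var_x l)"
    by (simp add: om_def)
  then show "var_x i * var_y i - (var_y i * var_x i + om (i - 1)) \<in> euclidean_relators q n"
    unfolding euclidean_relators_def
    by (intro UnI2 CollectI exI[of _ i] conjI assms) (simp only:)
qed (use assms in \<open>auto intro!: F_intros\<close>)

lemma qc_yx: "i \<in> {1..n} \<Longrightarrow> j \<in> {1..n} \<Longrightarrow> i \<noteq> j \<Longrightarrow> qc (var_y i) q (var_x j)"
  using qc_sym[OF qc_xy[of j i]] q by simp

lemma qc_xx': "i \<in> {1..n} \<Longrightarrow> j \<in> {1..n} \<Longrightarrow> j < i \<Longrightarrow> qc (var_x i) (inverse q) (var_x j)"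
  using qc_sym[OF qc_xx[of j i]] q by simp

lemma qc_yy': "i \<in> {1..n} \<Longrightarrow> j \<in> {1..n} \<Longrightarrow> j < i \<Longrightarrow> qc (var_y i) q (var_y j)"
  using qc_sym[OF qc_yy[of j i]] q by simp

lemma om_Suc: "om (Suc i) = om i + nc_const coef * (var_y (Suc i) * var_x (Suc i))"
  by (simp add: om_def coef_def mult.assoc)

lemma om_pred: "1 \<le> j \<Longrightarrow> om j = om (j - 1) + nc_const coef * (var_y j * var_x j)"
  using om_Suc[of "j - 1"] by simp

lemma om_0 [simp]: "om 0 = 0"
  by (simp add: om_def)

lemma coef_add: "nc_const (inverse (q\<^sup>2)) * f + nc_const coef * f = f"
  by (simp add: coef_def flip: distrib_right nc_const_add)

text \<open>Passing \<open>y\<^sub>l\<close> and passing \<open>x\<^sub>l\<close> with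
  \<open>l < j\<close> each cost a factor \<open>inverse q\<close>.\<close>

lemma qc_x_om_less:
  assumes "j \<in> {1..n}" "i < j"
  shows "qc (var_x j) (inverse (q\<^sup>2)) (om i)"
  unfolding om_def
proof (rule qc_sum)
  fix l assume "l \<in> {1..i}"
  then have "qc (var_x j) (1 * inverse q * inverse q) (nc_const (1 - inverse (q\<^sup>2)) * var_y l * var_x l)"
    using assms by (intro qc_mult qc_const qc_xy qc_xx' F_intros) auto
  then show "qc (var_x j) (inverse (q\<^sup>2)) (nc_const (1 - inverse (q\<^sup>2)) * var_y l * var_x l)"
    by (simp add: power2_eq_square)
qed (use assms in \<open>auto intro!: F_intros\<close>)

lemma qc_y_om_less:
  assumes "j \<in> {1..n}" "i < j"
  shows "qc (var_y j) (q\<^sup>2) (om i)"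
  unfolding om_def
proof (rule qc_sum)
  fix l assume "l \<in> {1..i}"
  then have "qc (var_y j) (1 * q * q) (nc_const (1 - inverse (q\<^sup>2)) * var_y l * var_x l)"
    using assms by (intro qc_mult qc_const qc_yx qc_yy' F_intros) auto
  then show "qc (var_y j) (q\<^sup>2) (nc_const (1 - inverse (q\<^sup>2)) * var_y l * var_x l)"
    by (simp add: power2_eq_square)
qed (use assms in \<open>auto intro!: F_intros\<close>)

text \<open>The summand \<open>\<omega>\<^sub>j\<^sub>-\<^sub>1\<close> passes with the factor
  \<open>inverse (q\<^sup>2)\<close>, and the correction term of \<open>x\<^sub>j y\<^sub>j\<close>
  adds the same product with the factor \<open>coef\<close>; the two factors sum to 1.\<close>

lemma qc_x_om_same:
  assumes j: "j \<in> {1..n}"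
  shows "qc (var_x j) 1 (om j)"
proof -
  let ?x = "var_x j" and ?y = "var_y j" and ?w = "om (j - 1)"
  have F: "?x \<in> F" "?y \<in> F" "?w \<in> F" "om j \<in> F" using j by (auto intro!: F_intros)
  have oj: "om j = ?w + nc_const coef * (?y * ?x)" using j by (intro om_pred) auto
  have 1: "?x * ?w \<doteq> nc_const (inverse (q\<^sup>2)) * (?w * ?x)"
    by (rule qcD[OF qc_x_om_less]) (use j in auto)
  have 2: "nc_const coef * ((?x * ?y) * ?x) \<doteq> nc_const coef * ((?y * ?x + ?w) * ?x)"
    by (intro cg_mult_left cg_mult_right cg_xy j F nc_closed)
  have "?x * om j = ?x * ?w + nc_const coef * ((?x * ?y) * ?x)"
    unfolding oj by (simp only: distrib_left nc_const_left_commute[of ?x] mult.assoc)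
  also have "\<dots> \<doteq> nc_const (inverse (q\<^sup>2)) * (?w * ?x) + nc_const coef * ((?y * ?x + ?w) * ?x)"
    by (rule cg_add[OF 1 2])
  also have "\<dots> = (nc_const (inverse (q\<^sup>2)) * (?w * ?x) + nc_const coef * (?w * ?x)) + nc_const coef * (?y * ?x * ?x)"
    by (simp add: distrib_left distrib_right)
  also have "\<dots> = om j * ?x"
    unfolding coef_add oj by (simp add: distrib_right mult.assoc)
  finally show ?thesis using F by (simp add: qc_def)
qed

lemma qc_y_om_same:
  assumes j: "j \<in> {1..n}"
  shows "qc (var_y j) 1 (om j)"
proof -
  let ?x = "var_x j" and ?y = "var_y j" and ?w = "om (j - 1)"
  have F: "?x \<in> F" "?y \<in> F" "?w \<in> F" "om j \<in> F" using j by (auto intro!: F_intros)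
  have oj: "om j = ?w + nc_const coef * (?y * ?x)" using j by (intro om_pred) auto
  have "qc ?y (q\<^sup>2) ?w" by (rule qc_y_om_less) (use j in auto)
  then have 1: "?w * ?y \<doteq> nc_const (inverse (q\<^sup>2)) * (?y * ?w)"
    using q by (intro qcD qc_sym) auto
  have 2: "nc_const coef * (?y * (?x * ?y)) \<doteq> nc_const coef * (?y * (?y * ?x + ?w))"
    by (intro cg_mult_left cg_mult_right cg_xy j F nc_closed)
  have "om j * ?y = ?w * ?y + nc_const coef * (?y * (?x * ?y))"
    unfolding oj by (simp add: distrib_right mult.assoc)
  also have "\<dots> \<doteq> nc_const (inverse (q\<^sup>2)) * (?y * ?w) + nc_const coef * (?y * (?y * ?x + ?w))"
    by (rule cg_add[OF 1 2])
  also have "\<dots> = (nc_const (inverse (q\<^sup>2)) * (?y * ?w) + nc_const coef * (?y * ?w)) + nc_const coef * (?y * (?y * ?x))"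
    by (simp add: distrib_left)
  also have "\<dots> = ?y * om j"
    unfolding coef_add oj by (simp only: distrib_left nc_const_left_commute[of ?y])
  finally have "qc (om j) 1 ?y" using F by (simp add: qc_def)
  then show ?thesis using qc_sym[of "om j" 1 ?y] by simp
qed

text \<open>Each further pair \<open>y\<^sub>l x\<^sub>l\<close> with \<open>l > j\<close> is passed
  with the factors \<open>inverse q\<close> and \<open>q\<close>, which cancel. For
  \<open>i = n\<close> this is the centrality of \<open>\<omega>\<^sub>n\<close>.\<close>

lemma qc_om_ge:
  assumes j: "j \<in> {1..n}" and "j \<le> i" "i \<le> n"
  shows "qc (var_x j) 1 (om i)" "qc (var_y j) 1 (om i)"
proof -
  have "qc (var_x j) 1 (om i) \<and> qc (var_y j) 1 (om i)"
    using assms(2,3)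
  proof (induction i rule: dec_induct)
    case base
    then show ?case using qc_x_om_same qc_y_om_same j by blast
  next
    case (step i)
    have i: "Suc i \<in> {1..n}" "j < Suc i" "j \<noteq> Suc i" using step by auto
    have IH: "qc (var_x j) 1 (om i)" "qc (var_y j) 1 (om i)" using step.IH step.prems by auto
    have one: "1 * (inverse q * q) = 1" "1 * (inverse q * q) = 1" using q by simp_all
    have x: "qc (var_x j) (1 * (inverse q * q)) (nc_const coef * (var_y (Suc i) * var_x (Suc i)))"
      by (intro qc_mult qc_const qc_xy qc_xx F_intros i j)
    have y: "qc (var_y j) (1 * (inverse q * q)) (nc_const coef * (var_y (Suc i) * var_x (Suc i)))"
      by (intro qc_mult qc_const qc_yx qc_yy F_intros i j)
    show ?case unfolding om_Suc
      by (intro conjI qc_add IH x[unfolded one] y[unfolded one])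
  qed
  then show "qc (var_x j) 1 (om i)" "qc (var_y j) 1 (om i)" by blast+
qed

lemma qc_var_om:
  assumes "g \<in> gens" "i \<le> n"
  shows "\<exists>a. qc (nc_var g) a (om i)"
proof -
  obtain j where j: "j \<in> {1..n}" "g = GenX j \<or> g = GenY j" using assms by (auto simp: gens_def)
  show ?thesis
  proof (cases "j \<le> i")
    case True
    then show ?thesis
      using j(2) qc_om_ge(1)[OF j(1) True assms(2)] qc_om_ge(2)[OF j(1) True assms(2)] by blast
  next
    case False
    then have "i < j" by simp
    then show ?thesis using j(2) qc_x_om_less[OF j(1)] qc_y_om_less[OF j(1)] by blast
  qed
qed

lemma qc_om_om:
  assumes "i \<le> n" "j \<le> n"
  shows "qc (om i) 1 (om j)"
  unfolding om_def[of j]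
proof (rule qc_sum)
  fix l assume "l \<in> {1..j}"
  then have l: "l \<in> {1..n}" using assms by auto
  have "\<exists>a b. qc (om i) a (var_y l) \<and> qc (om i) b (var_x l) \<and> a * b = 1"
  proof (cases "l \<le> i")
    case True
    then show ?thesis using qc_sym[OF qc_om_ge(1)[OF l True assms(1)]] qc_sym[OF qc_om_ge(2)[OF l True assms(1)]]
      by (intro exI[of _ 1]) simp
  next
    case False
    then have "i < l" by simp
    from qc_sym[OF qc_x_om_less[OF l this]] qc_sym[OF qc_y_om_less[OF l this]] q show ?thesis
      by (intro exI[of _ "inverse (q\<^sup>2)"] exI[of _ "q\<^sup>2"]) simp
  qed
  then obtain a b where ab: "qc (om i) a (var_y l)" "qc (om i) b (var_x l)" "a * b = 1" by blast
  have "qc (om i) (1 * a * b) (nc_const (1 - inverse (q\<^sup>2)) * var_y l * var_x l)"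
    using assms by (intro qc_mult qc_const ab F_intros)
  then show "qc (om i) 1 (nc_const (1 - inverse (q\<^sup>2)) * var_y l * var_x l)"
    using ab(3) by simp
qed (use assms in \<open>auto intro!: F_intros\<close>)

section \<open>Rewriting to standard monomials\<close>

definition blk :: "nat \<Rightarrow> int \<Rightarrow> (euclidean_gen, 'k) nc_poly"
  where "blk j a = var_x j ^ nat a * var_y j ^ nat (- a)"

definition ublk :: "(nat \<Rightarrow> int) \<Rightarrow> (euclidean_gen, 'k) nc_poly"
  where "ublk d = prod_list (map (\<lambda>i. blk i (d i)) [1..<Suc n])"

lemma single_uword: "Poly_Mapping.single (Word (uword d)) 1 = ublk d"
proof -
  have "prod_list (map nc_var (concat (map (\<lambda>i. replicate (nat (d i)) (GenX i) @
      replicate (nat (- d i)) (GenY i)) ls))) = prod_list (map (\<lambda>i. blk i (d i)) ls)" for ls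
    by (induction ls) (simp_all add: blk_def map_replicate_const prod_list_replicate mult.assoc)
  then show ?thesis unfolding nc_single_word uword_def ublk_def by blast
qed

lemma std_eq: "std (k, d) = omk k * ublk d"
  by (simp add: std_def single_uword)

lemma F_blk: "j \<in> {1..n} \<Longrightarrow> blk j a \<in> F"
  unfolding blk_def by (intro F_intros)

lemma F_ublk: "ublk d \<in> F"
  unfolding ublk_def by (rule F_prod_list) (auto intro!: F_blk simp del: upt_Suc)

lemma F_omk: "omk k \<in> F"
  unfolding omk_def by (rule F_prod_list) (auto intro!: F_power F_om simp del: upt_Suc)

lemma F_std: "std e \<in> F"
  by (cases e) (auto simp: std_eq intro: F_ublk F_omk nc_closed)

lemma F_gens: "g \<in> gens \<Longrightarrow> nc_var g \<in> F"
  by (rule nc_closed_var)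

lemma qc_var_omk: "g \<in> gens \<Longrightarrow> \<exists>a. qc (nc_var g) a (omk k)"
  unfolding omk_def
proof (rule qc_prod_list)
  fix h assume g: "g \<in> gens" and h: "h \<in> set (map (\<lambda>i. om i ^ k i) [1..<Suc n])"
  obtain i where "i \<in> set [1..<Suc n]" "h = om i ^ k i" using h unfolding set_map by (elim imageE)
  then have i: "i \<le> n" "h = om i ^ k i" by auto
  obtain a where "qc (nc_var g) a (om i)" using qc_var_om[OF g i(1)] by blast
  then have "qc (nc_var g) (a ^ k i) h" unfolding i(2) by (rule qc_power)
  then show "\<exists>a. qc (nc_var g) a h" by (rule exI)
qed (rule F_gens)

lemma qc_blk:
  assumes "j \<in> {1..n}" "i \<in> {1..n}" "i \<noteq> j"
  shows "\<exists>a. qc (var_x j) a (blk i t)" "\<exists>a. qc (var_y j) a (blk i t)"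
proof -
  have "\<exists>a b. qc (var_x j) a (var_x i) \<and> qc (var_y j) b (var_y i)"
  proof (cases "i < j")
    case True
    show ?thesis
      by (rule exI[of _ "inverse q"], rule exI[of _ q], intro conjI qc_xx' qc_yy' assms True)
  next
    case False
    then have "j < i" using assms(3) by simp
    then show ?thesis
      by (intro exI[of _ q] exI[of _ "inverse q"] conjI qc_xx qc_yy assms)
  qed
  moreover have "qc (var_x j) (inverse q) (var_y i)" "qc (var_y j) q (var_x i)"
    using assms by (auto intro!: qc_xy qc_yx)
  ultimately obtain a b c e where "qc (var_x j) a (var_x i)" "qc (var_y j) b (var_y i)"
    "qc (var_x j) c (var_y i)" "qc (var_y j) e (var_x i)" by blast
  then have "qc (var_x j) (a ^ nat t * c ^ nat (- t)) (blk i t)" "qc (var_y j) (e ^ nat t * b ^ nat (- t)) (blk i t)"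
    unfolding blk_def by (simp_all add: qc_mult qc_power)
  then show "\<exists>a. qc (var_x j) a (blk i t)" "\<exists>a. qc (var_y j) a (blk i t)" by blast+
qed

text \<open>The factor must be nonzero because \<open>\<omega>\<^sub>i\<close> is later moved
  leftwards out of a product, which inverts the factor.\<close>

lemma qc_om_blk:
  assumes "i \<le> n" "j \<in> {1..n}"
  shows "\<exists>a. qc (om i) a (blk j t) \<and> a \<noteq> 0"
proof -
  have "\<exists>a b. qc (om i) a (var_x j) \<and> qc (om i) b (var_y j) \<and> a \<noteq> 0 \<and> b \<noteq> 0"
  proof (cases "j \<le> i")
    case True
    then show ?thesis
      using qc_sym[OF qc_om_ge(1)[OF assms(2) True assms(1)]] qc_sym[OF qc_om_ge(2)[OF assms(2) True assms(1)]]
      by (intro exI[of _ 1]) simp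
  next
    case False
    then have "i < j" by simp
    from qc_sym[OF qc_x_om_less[OF assms(2) this]] qc_sym[OF qc_y_om_less[OF assms(2) this]] q show ?thesis
      by (intro exI[of _ "q\<^sup>2"] exI[of _ "inverse (q\<^sup>2)"]) simp
  qed
  then obtain a b where ab: "qc (om i) a (var_x j)" "qc (om i) b (var_y j)" "a \<noteq> 0" "b \<noteq> 0" by blast
  then have "qc (om i) (a ^ nat t * b ^ nat (- t)) (blk j t)"
    unfolding blk_def by (simp add: qc_mult qc_power)
  moreover have "a ^ nat t * b ^ nat (- t) \<noteq> 0" using ab by simp
  ultimately show ?thesis by blast
qed

lemma qc_prod_list_nonzero:
  "g \<in> F \<Longrightarrow> (\<And>h. h \<in> set hs \<Longrightarrow> \<exists>a. qc g a h \<and> a \<noteq> 0) \<Longrightarrow> \<exists>a. qc g a (prod_list hs) \<and> a \<noteq> 0"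
proof (induction hs)
  case Nil
  then show ?case using qc_one by (intro exI[of _ 1]) simp
next
  case (Cons h hs)
  obtain a where "qc g a h" "a \<noteq> 0" using Cons.prems(2)[of h] by auto
  moreover obtain b where "qc g b (prod_list hs)" "b \<noteq> 0"
    using Cons.IH[OF Cons.prems(1)] Cons.prems(2) by auto
  ultimately have "qc g (a * b) (prod_list (h # hs))" "a * b \<noteq> 0" by (simp_all add: qc_mult)
  then show ?case by blast
qed

definition spanned :: "(euclidean_gen, 'k) nc_poly \<Rightarrow> bool"
  where "spanned f \<longleftrightarrow> (\<exists>E c. finite E \<and> E \<subseteq> std_index \<and> f \<doteq> (\<Sum>e\<in>E. nc_const (c e) * std e))"

lemma spanned_cg: "f \<doteq> g \<Longrightarrow> spanned g \<Longrightarrow> spanned f"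
  unfolding spanned_def using cg_trans by blast

lemma spanned_0: "spanned 0"
  unfolding spanned_def using cg_refl[OF nc_closed_zero] by (intro exI[of _ "{}"]) simp

lemma spanned_std: "e \<in> std_index \<Longrightarrow> spanned (std e)"
  unfolding spanned_def using cg_refl[OF F_std] by (intro exI[of _ "{e}"] exI[of _ "\<lambda>_. 1"]) simp

lemma spanned_add:
  assumes "spanned f" "spanned g"
  shows "spanned (f + g)"
proof -
  obtain E c where E: "finite E" "E \<subseteq> std_index" "f \<doteq> (\<Sum>e\<in>E. nc_const (c e) * std e)"
    using assms(1) by (auto simp: spanned_def)
  obtain E' c' where E': "finite E'" "E' \<subseteq> std_index" "g \<doteq> (\<Sum>e\<in>E'. nc_const (c' e) * std e)"
    using assms(2) by (auto simp: spanned_def)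
  define a where "a e = (if e \<in> E then c e else 0) + (if e \<in> E' then c' e else 0)" for e
  have ext: "(\<Sum>e\<in>E0. nc_const (c0 e) * std e) = (\<Sum>e\<in>E \<union> E'. nc_const (if e \<in> E0 then c0 e else 0) * std e)"
    if "E0 \<subseteq> E \<union> E'" for E0 c0
    by (rule sum.mono_neutral_cong_left) (use that E(1) E'(1) in auto)
  have "f + g \<doteq> (\<Sum>e\<in>E. nc_const (c e) * std e) + (\<Sum>e\<in>E'. nc_const (c' e) * std e)"
    by (rule cg_add[OF E(3) E'(3)])
  also have "\<dots> = (\<Sum>e\<in>E \<union> E'. nc_const (a e) * std e)"
    unfolding ext[of E c, OF Un_upper1] ext[of E' c', OF Un_upper2] sum.distrib[symmetric]
    by (simp only: a_def nc_const_add distrib_right)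
  finally have "f + g \<doteq> (\<Sum>e\<in>E \<union> E'. nc_const (a e) * std e)" .
  moreover have "finite (E \<union> E')" "E \<union> E' \<subseteq> std_index" using E(1,2) E'(1,2) by auto
  ultimately show ?thesis unfolding spanned_def by (intro exI conjI)
qed

lemma spanned_scale:
  assumes "spanned f"
  shows "spanned (nc_const a * f)"
proof -
  obtain E c where E: "finite E" "E \<subseteq> std_index" "f \<doteq> (\<Sum>e\<in>E. nc_const (c e) * std e)"
    using assms by (auto simp: spanned_def)
  have "nc_const a * f \<doteq> nc_const a * (\<Sum>e\<in>E. nc_const (c e) * std e)"
    by (rule cg_mult_left[OF E(3) nc_closed_const])
  also have "\<dots> = (\<Sum>e\<in>E. nc_const (a * c e) * std e)"
    by (simp only: sum_distrib_left nc_const_mult_left)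
  finally have "nc_const a * f \<doteq> (\<Sum>e\<in>E. nc_const (a * c e) * std e)" .
  then show ?thesis unfolding spanned_def using E(1,2) by (intro exI conjI)
qed

lemma spanned_sum: "(\<And>x. x \<in> A \<Longrightarrow> spanned (f x)) \<Longrightarrow> spanned (sum f A)"
  by (induction A rule: infinite_finite_induct) (simp_all add: spanned_add spanned_0)

lemma om_mult_omk:
  assumes i: "i \<in> {1..n}"
  shows "om i * omk k \<doteq> omk (k(i := Suc (k i)))"
proof -
  have F: "om l \<in> F" if "l \<le> n" for l using that by (rule F_om)
  have Fp: "prod_list (map (\<lambda>l. om l ^ k l) ls) \<in> F" if "set ls \<subseteq> {1..n}" for k ls
    using that by (intro F_prod_list) (auto intro!: F_power F)
  have main: "om i * prod_list (map (\<lambda>l. om l ^ k l) ls) \<doteq> prod_list (map (\<lambda>l. om l ^ (k(i := Suc (k i))) l) ls)"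
    if "distinct ls" "i \<in> set ls" "set ls \<subseteq> {1..n}" for ls
    using that
  proof (induction ls)
    case (Cons l ls)
    show ?case
    proof (cases "l = i")
      case True
      then have M: "map (\<lambda>l. om l ^ (k(i := Suc (k i))) l) ls = map (\<lambda>l. om l ^ k l) ls"
        using Cons.prems by (intro map_cong) auto
      have "om i * prod_list (map (\<lambda>l. om l ^ k l) (l # ls)) =
          prod_list (map (\<lambda>l. om l ^ (k(i := Suc (k i))) l) (l # ls))"
        unfolding list.map prod_list.Cons M using True by (simp add: mult.assoc)
      then show ?thesis using cg_refl[OF Fp[of "l # ls" "k(i := Suc (k i))"]] Cons.prems by (simp only:)
    next
      case False
      let ?R = "prod_list (map (\<lambda>l. om l ^ k l) ls)"
      have "qc (om i) (1 ^ k l) (om l ^ k l)"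
        by (rule qc_power, rule qc_om_om) (use i Cons.prems in auto)
      then have "om i * om l ^ k l \<doteq> om l ^ k l * om i" using qcD by fastforce
      then have "om i * om l ^ k l * ?R \<doteq> om l ^ k l * om i * ?R"
        by (rule cg_mult_right) (use Fp Cons.prems in auto)
      also have "\<dots> = om l ^ k l * (om i * ?R)" by (simp add: mult.assoc)
      also have "\<dots> \<doteq> om l ^ k l * prod_list (map (\<lambda>l. om l ^ (k(i := Suc (k i))) l) ls)"
        by (rule cg_mult_left[OF Cons.IH]) (use Cons.prems False in \<open>auto intro!: F_power F\<close>)
      finally show ?thesis using False by (simp add: mult.assoc)
    qed
  qed simp
  show ?thesis unfolding omk_def by (rule main) (use i in auto)
qed

text \<open>\<open>\<omega>\<^sub>0\<close> is 0 and \<open>\<omega>\<^sub>p\<close> vanishes modulo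
  \<open>J\<close>; every other \<open>\<omega>\<^sub>i\<close> commutes with its fellows and just
  raises one exponent.\<close>

lemma spanned_om_std:
  assumes "i \<le> n" "e \<in> std_index"
  shows "spanned (om i * std e)"
proof -
  obtain k d where e: "e = (k, d)" by (cases e)
  consider "i = 0" | "i = p" | "i \<in> {1..n}" "i \<noteq> p" using assms(1) by force
  then show ?thesis
  proof cases
    case 1
    then show ?thesis using spanned_0 by simp
  next
    case 2
    have "om p \<doteq> 0" using J_om F_om[of p] p by (simp add: cg_def nc_closed)
    then have "om p * std e \<doteq> 0 * std e" by (rule cg_mult_right[OF _ F_std])
    then show ?thesis using 2 spanned_0 spanned_cg by simp
  next
    case 3
    have "om i * omk k * ublk d \<doteq> omk (k(i := Suc (k i))) * ublk d"
      by (rule cg_mult_right[OF om_mult_omk[OF 3(1)] F_ublk])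
    moreover have "(k(i := Suc (k i)), d) \<in> std_index"
      using assms(2) 3 by (auto simp: e std_index_def)
    ultimately show ?thesis using spanned_std[of "(k(i := Suc (k i)), d)"] spanned_cg
      by (simp add: e std_eq mult.assoc)
  qed
qed

lemma yx_eq:
  assumes "1 \<le> j"
  shows "var_y j * var_x j = nc_const (inverse coef) * om j + nc_const (- inverse coef) * om (j - 1)"
proof -
  have "om j = om (j - 1) + nc_const coef * (var_y j * var_x j)" by (rule om_pred[OF assms])
  then have "nc_const (inverse coef) * om j + nc_const (- inverse coef) * om (j - 1) =
      nc_const (inverse coef) * (nc_const coef * (var_y j * var_x j))"
    by (simp add: distrib_left nc_const_uminus)
  then show ?thesis using coef_nz by (simp add: nc_const_mult_left)
qed

lemma xy_cg:
  assumes "j \<in> {1..n}"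
  shows "var_x j * var_y j \<doteq> nc_const (inverse coef) * om j + nc_const (1 - inverse coef) * om (j - 1)"
proof -
  have "var_x j * var_y j \<doteq> var_y j * var_x j + om (j - 1)" by (rule cg_xy[OF assms])
  also have "var_y j * var_x j + om (j - 1) =
      nc_const (inverse coef) * om j + nc_const (1 - inverse coef) * om (j - 1)"
  proof -
    have "nc_const (1 - inverse coef) * om (j - 1) = om (j - 1) + nc_const (- inverse coef) * om (j - 1)"
      unfolding diff_conv_add_uminus[of 1 "inverse coef"] nc_const_add
      by (simp only: distrib_right nc_const_1 mult_1_left)
    moreover have "1 \<le> j" using assms by simp
    ultimately show ?thesis using yx_eq[of j] by (simp only: ac_simps)
  qed
  finally show ?thesis .
qed

text \<open>The letter either lengthens the block, where \<open>a0 = 1\<close>, or meets an opposite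
  letter, and then the two combine to a linear combination of \<open>\<omega>\<^sub>j\<close> and
  \<open>\<omega>\<^sub>j\<^sub>-\<^sub>1\<close>. One formula covers both cases.\<close>

lemma var_blk:
  assumes j: "j \<in> {1..n}" and g: "g = GenX j \<or> g = GenY j"
  shows "\<exists>a0 a1 a2. nc_var g * blk j t \<doteq>
    (nc_const a0 + (nc_const a1 * om j + nc_const a2 * om (j - 1))) * blk j (t + gdeg g j)"
proof -
  have triv: ?thesis if "nc_var g * blk j t = blk j (t + gdeg g j)"
    using that cg_refl[OF F_blk[OF j]] by (intro exI[of _ 1] exI[of _ 0]) simp
  have cancel: ?thesis
    if "nc_var g * h \<doteq> nc_const a1 * om j + nc_const a2 * om (j - 1)" "blk j t = h * blk j (t + gdeg g j)" for h a1 a2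
  proof -
    have "nc_var g * h * blk j (t + gdeg g j) \<doteq> (nc_const a1 * om j + nc_const a2 * om (j - 1)) * blk j (t + gdeg g j)"
      by (rule cg_mult_right[OF that(1) F_blk[OF j]])
    then show ?thesis
      by (intro exI[of _ 0] exI[of _ a1] exI[of _ a2]) (simp add: that(2) mult.assoc)
  qed
  from g show ?thesis
  proof
    assume g: "g = GenX j"
    show ?thesis
    proof (cases "t \<ge> 0")
      case True
      then have "nat (t + 1) = Suc (nat t)" by simp
      then show ?thesis using True by (intro triv) (simp add: g gdeg_def blk_def mult.assoc)
    next
      case False
      then have "nat (- t) = Suc (nat (- (t + 1)))" by simp
      then show ?thesis using False xy_cg[OF j]
        by (intro cancel[where h = "var_y j"]) (simp_all add: g gdeg_def blk_def)
    qed
  next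
    assume g: "g = GenY j"
    show ?thesis
    proof (cases "t \<le> 0")
      case True
      then have "nat (- (t - 1)) = Suc (nat (- t))" by simp
      then show ?thesis using True by (intro triv) (simp add: g gdeg_def blk_def)
    next
      case False
      then have *: "nat t = Suc (nat (t - 1))" by simp
      have "var_y j * var_x j \<doteq> var_y j * var_x j" using j by (intro cg_refl F_intros)
      then have "var_y j * var_x j \<doteq> nc_const (inverse coef) * om j + nc_const (- inverse coef) * om (j - 1)"
        using yx_eq[of j] j by simp
      then show ?thesis using False *
        by (intro cancel[where h = "var_x j"]) (simp_all add: g gdeg_def blk_def)
    qed
  qed
qed

text \<open>The letter is moved up to its own block at the cost of a scalar and absorbed there by
  \<open>var_blk\<close>; the \<open>\<omega>\<close>'s that arise inside the monomial are moved
  back to its front.\<close>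

lemma spanned_var_std:
  assumes g: "g \<in> gens" and e: "e \<in> std_index"
  shows "spanned (nc_var g * std e)"
proof -
  obtain k d where kd: "e = (k, d)" by (cases e)
  obtain j where j: "j \<in> {1..n}" "g = GenX j \<or> g = GenY j" using g by (auto simp: gens_def)
  define d' where "d' = d(j := d j + gdeg g j)"
  define A where "A = prod_list (map (\<lambda>i. blk i (d i)) [1..<j])"
  define D where "D = prod_list (map (\<lambda>i. blk i (d i)) [Suc j..<Suc n])"
  have FAD: "A \<in> F" "D \<in> F" unfolding A_def D_def using j by (auto intro!: F_prod_list F_blk simp del: upt_Suc)
  have split: "[1..<Suc n] = [1..<j] @ j # [Suc j..<Suc n]"
    using j upt_add_eq_append[of 1 j "Suc n - j"] upt_conv_Cons[of j "Suc n"] by (simp del: upt_Suc)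
  have ud: "ublk d = A * (blk j (d j) * D)"
    unfolding ublk_def split A_def D_def by simp
  have maps: "map (\<lambda>i. blk i (d' i)) [1..<j] = map (\<lambda>i. blk i (d i)) [1..<j]"
    "map (\<lambda>i. blk i (d' i)) [Suc j..<Suc n] = map (\<lambda>i. blk i (d i)) [Suc j..<Suc n]"
    by (auto simp: d'_def)
  have d'j: "d' j = d j + gdeg g j" by (simp add: d'_def)
  have ud': "ublk d' = A * (blk j (d j + gdeg g j) * D)"
    unfolding ublk_def split A_def D_def
    by (simp only: map_append list.map prod_list.append prod_list.Cons maps d'j)
  have e': "(k, d') \<in> std_index" using e j by (auto simp: kd std_index_def d'_def)
  obtain s1 where s1: "qc (nc_var g) s1 (omk k)" using qc_var_omk[OF g] by blast
  have "\<exists>a. qc (nc_var g) a A"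
    unfolding A_def
  proof (rule qc_prod_list)
    fix h assume h: "h \<in> set (map (\<lambda>i. blk i (d i)) [1..<j])"
    obtain i where "i \<in> set [1..<j]" "h = blk i (d i)" using h unfolding set_map by (elim imageE)
    then have "i \<in> {1..n}" "i \<noteq> j" "h = blk i (d i)" using j by auto
    then show "\<exists>a. qc (nc_var g) a h" using qc_blk[OF j(1)] j(2) by auto
  qed (rule F_gens[OF g])
  then obtain s2 where s2: "qc (nc_var g) s2 A" by blast
  have omA: "\<exists>a. qc (om i) a A \<and> a \<noteq> 0" if "i \<le> n" for i
    unfolding A_def
  proof (rule qc_prod_list_nonzero)
    fix h assume h: "h \<in> set (map (\<lambda>i. blk i (d i)) [1..<j])"
    obtain l where "l \<in> set [1..<j]" "h = blk l (d l)" using h unfolding set_map by (elim imageE)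
    then have "l \<in> {1..n}" "h = blk l (d l)" using j by auto
    then show "\<exists>a. qc (om i) a h \<and> a \<noteq> 0" using qc_om_blk[OF that] by auto
  qed (rule F_om[OF that])
  have om_k: "\<exists>a. qc (om i) a (omk k) \<and> a \<noteq> 0" if "i \<le> n" for i
    unfolding omk_def
  proof (rule qc_prod_list_nonzero)
    fix h assume h: "h \<in> set (map (\<lambda>i. om i ^ k i) [1..<Suc n])"
    obtain l where "l \<in> set [1..<Suc n]" "h = om l ^ k l" using h unfolding set_map by (elim imageE)
    then have "l \<le> n" "h = om l ^ k l" by auto
    then show "\<exists>a. qc (om i) a h \<and> a \<noteq> 0"
      using qc_power[OF qc_om_om[OF that \<open>l \<le> n\<close>], of "k l"] by (intro exI[of _ 1]) simp
  qed (rule F_om[OF that])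
  have om_in: "spanned (omk k * (A * (om i * (blk j (d j + gdeg g j) * D))))" if i: "i \<le> n" for i
  proof -
    let ?R = "blk j (d j + gdeg g j) * D"
    have FR: "?R \<in> F" by (intro nc_closed F_blk j FAD)
    obtain a where a: "qc (om i) a A" "a \<noteq> 0" using omA[OF i] by blast
    obtain b where b: "qc (om i) b (omk k)" "b \<noteq> 0" using om_k[OF i] by blast
    have "qc (om i) (b * a) (omk k * A)" by (rule qc_mult[OF b(1) a(1)])
    then have "qc (omk k * A) (inverse (b * a)) (om i)" using a(2) b(2) by (intro qc_sym) auto
    then have "omk k * A * om i * ?R \<doteq> nc_const (inverse (b * a)) * (om i * (omk k * A)) * ?R"
      by (intro cg_mult_right[OF qcD FR])
    moreover have "spanned (nc_const (inverse (b * a)) * (om i * std (k, d')))"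
      by (rule spanned_scale[OF spanned_om_std[OF i e']])
    ultimately show ?thesis using spanned_cg by (simp add: std_eq ud' mult.assoc)
  qed
  obtain a0 a1 a2 where T: "nc_var g * blk j (d j) \<doteq>
      (nc_const a0 + (nc_const a1 * om j + nc_const a2 * om (j - 1))) * blk j (d j + gdeg g j)"
    using var_blk[OF j] by blast
  let ?T = "nc_const a0 + (nc_const a1 * om j + nc_const a2 * om (j - 1))" and ?b = "blk j (d j + gdeg g j)"
  have "nc_var g * (omk k * A) \<doteq> nc_const (s1 * s2) * (omk k * A * nc_var g)"
    by (rule qcD[OF qc_mult[OF s1 s2]])
  then have "nc_var g * (omk k * A) * (blk j (d j) * D) \<doteq>
      nc_const (s1 * s2) * (omk k * A * nc_var g) * (blk j (d j) * D)"
    by (rule cg_mult_right) (intro nc_closed F_blk j FAD)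
  also have "\<dots> = nc_const (s1 * s2) * (omk k * A) * (nc_var g * blk j (d j)) * D"
    by (simp add: mult.assoc)
  also have "\<dots> \<doteq> nc_const (s1 * s2) * (omk k * A) * (?T * ?b) * D"
    by (intro cg_mult_right cg_mult_left T nc_closed F_omk FAD)
  also have "\<dots> = nc_const (s1 * s2) * (nc_const a0 * std (k, d') +
      (nc_const a1 * (omk k * (A * (om j * (?b * D)))) +
       nc_const a2 * (omk k * (A * (om (j - 1) * (?b * D))))))"
    by (simp only: std_eq ud' mult.assoc distrib_left distrib_right
        nc_const_left_commute[of A] nc_const_left_commute[of "omk k"])
  finally have "nc_var g * (omk k * A) * (blk j (d j) * D) \<doteq> \<dots>" .
  moreover have "spanned (nc_const (s1 * s2) * (nc_const a0 * std (k, d') +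
      (nc_const a1 * (omk k * (A * (om j * (?b * D)))) +
       nc_const a2 * (omk k * (A * (om (j - 1) * (?b * D)))))))"
    using j by (intro spanned_scale spanned_add spanned_std e' om_in) auto
  ultimately show ?thesis using spanned_cg by (simp add: kd std_eq ud mult.assoc)
qed

lemma spanned_var_mult:
  assumes "g \<in> gens" "spanned f"
  shows "spanned (nc_var g * f)"
proof -
  obtain E c where E: "finite E" "E \<subseteq> std_index" "f \<doteq> (\<Sum>e\<in>E. nc_const (c e) * std e)"
    using assms(2) by (auto simp: spanned_def)
  have "nc_var g * f \<doteq> nc_var g * (\<Sum>e\<in>E. nc_const (c e) * std e)"
    by (rule cg_mult_left[OF E(3) F_gens[OF assms(1)]])
  also have "\<dots> = (\<Sum>e\<in>E. nc_const (c e) * (nc_var g * std e))"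
    by (simp only: sum_distrib_left nc_const_left_commute[of "nc_var g"])
  finally show ?thesis
    by (rule spanned_cg) (use E(2) in \<open>auto intro!: spanned_sum spanned_scale spanned_var_std[OF assms(1)]\<close>)
qed

lemma spanned_free:
  assumes "f \<in> F"
  shows "spanned f"
proof -
  have "std (\<lambda>_. 0, \<lambda>_. 0) = 1"
  proof -
    have "prod_list (map (\<lambda>i. 1 :: (euclidean_gen, 'k) nc_poly) ls) = 1" for ls :: "nat list" by (induction ls) simp_all
    then show ?thesis by (simp add: std_eq omk_def ublk_def blk_def del: upt_Suc)
  qed
  then have one: "spanned 1" using spanned_std[of "(\<lambda>_. 0, \<lambda>_. 0)"] by (simp add: std_index_def)
  have word: "spanned (prod_list (map nc_var ws))" if "set ws \<subseteq> gens" for ws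
    using that by (induction ws) (simp_all add: one spanned_var_mult)
  have "spanned (Poly_Mapping.single w (Poly_Mapping.lookup f w))" if "w \<in> Poly_Mapping.keys f" for w
  proof -
    have "set (letters w) \<subseteq> gens" using assms that by (auto simp: carrier_free_algebra)
    then have "spanned (nc_const (Poly_Mapping.lookup f w) * Poly_Mapping.single w 1)"
      using spanned_scale[OF word[of "letters w"]] nc_single_word[of "letters w"] by (metis free_monoid.collapse)
    then show ?thesis by (simp add: nc_const_def mult_single)
  qed
  then have "spanned (\<Sum>w\<in>Poly_Mapping.keys f. Poly_Mapping.single w (Poly_Mapping.lookup f w))"
    by (rule spanned_sum)
  then show ?thesis using nc_poly_eq_sum_single[of f] by simp
qed

end

section \<open>The factor algebra as a quotient of the free algebra\<close>

lemma ideal_image_surjective: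
  assumes "ring_hom_ring R S h" "h ` carrier R = carrier S" "ideal K R"
  shows "ideal (h ` K) S"
proof -
  interpret ring_hom_ring R S h by fact
  interpret K: ideal K R by fact
  show ?thesis
  proof (rule idealI)
    show "ring S" by (rule S.ring_axioms)
    show "subgroup (h ` K) (add_monoid S)"
      by (rule group_hom.subgroup_img_is_subgroup[OF a_group_hom K.a_subgroup])
  next
    fix a x assume a: "a \<in> h ` K" and x: "x \<in> carrier S"
    obtain k where k: "k \<in> K" "a = h k" using a by blast
    obtain y where y: "y \<in> carrier R" "x = h y" using x assms(2) by blast
    have "x \<otimes>\<^bsub>S\<^esub> a = h (y \<otimes>\<^bsub>R\<^esub> k)" "a \<otimes>\<^bsub>S\<^esub> x = h (k \<otimes>\<^bsub>R\<^esub> y)"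
      using k y K.Icarr by simp_all
    then show "x \<otimes>\<^bsub>S\<^esub> a \<in> h ` K" "a \<otimes>\<^bsub>S\<^esub> x \<in> h ` K"
      using K.I_l_closed[OF k(1) y(1)] K.I_r_closed[OF k(1) y(1)] by simp_all
  qed
qed

lemma quotient_map_surjective: "ideal I R \<Longrightarrow> (\<lambda>x. I +>\<^bsub>R\<^esub> x) ` carrier R = carrier (R Quot I)"
  by (auto simp: FactRing_def A_RCOSETS_def')

lemma quotient_map_eq_zero:
  assumes "ideal I R" "x \<in> carrier R"
  shows "I +>\<^bsub>R\<^esub> x = \<zero>\<^bsub>R Quot I\<^esub> \<longleftrightarrow> x \<in> I"
proof -
  interpret ideal I R by fact
  show ?thesis
    using assms(2) a_rcos_const rcos_const_imp_mem by (auto simp: FactRing_def)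
qed

lemma ring_hom_add_pow:
  fixes h :: "('g, 'k::comm_ring_1) nc_poly \<Rightarrow> 'b" and c :: int
  assumes "ring_hom_ring (free_algebra G) A h" and x: "x \<in> carrier (free_algebra G)"
  shows "[c] \<cdot>\<^bsub>A\<^esub> h x = h (of_int c * x)"
proof -
  let ?C = "carrier (free_algebra G)"
  interpret ring_hom_ring "free_algebra G" A h by fact
  have int_closed: "of_int c * x \<in> ?C" for c
    using nc_closed_mult[OF nc_closed_const x, of "of_int c"] by (simp add: nc_const_def single_of_int)
  have nat: "[k] \<cdot>\<^bsub>A\<^esub> h x = h (of_nat k * x)" for k :: nat
  proof (induction k)
    case 0
    then show ?case using hom_zero by simp
  next
    case (Suc k)
    have "of_nat k * x \<in> ?C" using int_closed[of "int k"] by simp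
    then have "h (of_nat k * x + x) = h (of_nat k * x) \<oplus>\<^bsub>A\<^esub> h x" using x hom_add by simp
    then show ?case using Suc x by (simp add: S.add.nat_pow_Suc distrib_right add.commute)
  qed
  show ?thesis
  proof (cases "c \<ge> 0")
    case True
    then show ?thesis using nat[of "nat c"] by (simp add: add_pow_int_ge)
  next
    case False
    have "h (of_int c * x) \<oplus>\<^bsub>A\<^esub> h (of_int (- c) * x) = h (of_int c * x + of_int (- c) * x)"
      using hom_add[OF int_closed[of c] int_closed[of "- c"]] by simp
    also have "\<dots> = \<zero>\<^bsub>A\<^esub>" using hom_zero by simp
    finally have "h (of_int c * x) = \<ominus>\<^bsub>A\<^esub> h (of_int (- c) * x)"
      using int_closed by (intro S.minus_equality[symmetric]) (auto simp del: of_int_minus)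
    then show ?thesis using False nat[of "nat (- c)"] by (simp add: add_pow_int_lt)
  qed
qed

text \<open>Evaluation on representatives in the free algebra: an identity in a quotient becomes
  membership of this element in the kernel.\<close>

definition nc_subst :: "('a \<Rightarrow> ('g, 'k::comm_ring_1) nc_poly) \<Rightarrow> ('a, int) nc_poly \<Rightarrow> ('g, 'k) nc_poly"
  where "nc_subst f P =
    (\<Sum>w\<in>Poly_Mapping.keys P. of_int (Poly_Mapping.lookup P w) * prod_list (map f (letters w)))"

lemma nc_eval_hom:
  fixes h :: "('g, 'k::comm_ring_1) nc_poly \<Rightarrow> 'b"
  assumes hom: "ring_hom_ring (free_algebra G) A h"
    and f: "\<And>w x. w \<in> Poly_Mapping.keys P \<Longrightarrow> x \<in> set (letters w) \<Longrightarrow> f x \<in> carrier (free_algebra G) \<and> r x = h (f x)"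
  shows "nc_eval A r P = h (nc_subst f P)" "nc_subst f P \<in> carrier (free_algebra G)"
proof -
  let ?C = "carrier (free_algebra G)"
  interpret ring_hom_ring "free_algebra G" A h by (rule hom)
  have prod: "prod_list (map f ws) \<in> ?C \<and>
      foldr (\<lambda>x a. r x \<otimes>\<^bsub>A\<^esub> a) ws \<one>\<^bsub>A\<^esub> = h (prod_list (map f ws))"
    if "\<And>x. x \<in> set ws \<Longrightarrow> f x \<in> ?C \<and> r x = h (f x)" for ws
    using that
  proof (induction ws)
    case Nil
    then show ?case using hom_one by (simp add: nc_closed)
  next
    case (Cons x ws)
    have x: "f x \<in> ?C" "r x = h (f x)" using Cons.prems[of x] by simp_all
    have ws: "prod_list (map f ws) \<in> ?C"
      "foldr (\<lambda>x a. r x \<otimes>\<^bsub>A\<^esub> a) ws \<one>\<^bsub>A\<^esub> = h (prod_list (map f ws))"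
      using Cons.IH[OF Cons.prems] by simp_all
    have "foldr (\<lambda>x a. r x \<otimes>\<^bsub>A\<^esub> a) (x # ws) \<one>\<^bsub>A\<^esub> = h (f x * prod_list (map f ws))"
      using hom_mult[OF x(1) ws(1)] by (simp add: ws(2) x(2))
    then show ?case using nc_closed_mult[OF x(1) ws(1)] by simp
  qed
  let ?t = "\<lambda>w. of_int (Poly_Mapping.lookup P w) * prod_list (map f (letters w))"
  have closed: "?t w \<in> ?C" if "w \<in> Poly_Mapping.keys P" for w
  proof -
    have "prod_list (map f (letters w)) \<in> ?C" using prod[of "letters w"] f[OF that] by blast
    then have "nc_const (of_int (Poly_Mapping.lookup P w)) * prod_list (map f (letters w)) \<in> ?C"
      by (rule nc_closed_mult[OF nc_closed_const])
    then show ?thesis by (simp add: nc_const_def single_of_int)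
  qed
  have sum: "finsum A (\<lambda>w. h (?t w)) K = h (sum ?t K) \<and> sum ?t K \<in> ?C"
    if "finite K" "K \<subseteq> Poly_Mapping.keys P" for K
    using that
  proof (induction K rule: finite_induct)
    case empty
    then show ?case using hom_zero by (simp add: nc_closed)
  next
    case (insert w K)
    have K: "K \<subseteq> Poly_Mapping.keys P" "w \<in> Poly_Mapping.keys P" using insert.prems by simp_all
    have c1: "?t w \<in> ?C" by (rule closed[OF K(2)])
    have c2: "finsum A (\<lambda>w. h (?t w)) K = h (sum ?t K)" "sum ?t K \<in> ?C"
      using insert.IH[OF K(1)] by blast+
    have "(\<lambda>w. h (?t w)) \<in> K \<rightarrow> carrier A" using closed K(1) hom_closed by blast
    then have "finsum A (\<lambda>w. h (?t w)) (insert w K) = h (?t w) \<oplus>\<^bsub>A\<^esub> finsum A (\<lambda>w. h (?t w)) K"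
      by (rule S.finsum_insert[OF insert.hyps]) (rule hom_closed[OF c1])
    also have "\<dots> = h (?t w + sum ?t K)" unfolding c2(1) using hom_add[OF c1 c2(2)] by simp
    also have "?t w + sum ?t K = sum ?t (insert w K)" using insert.hyps by (rule sum.insert[symmetric])
    finally show ?case using nc_closed_add[OF c1 c2(2)] insert.hyps by (simp only: sum.insert simp_thms)
  qed
  have "nc_eval A r P = finsum A (\<lambda>w. h (?t w)) (Poly_Mapping.keys P)"
    unfolding nc_eval_def
  proof (rule S.finsum_cong')
    fix w assume w: "w \<in> Poly_Mapping.keys P"
    have pw: "prod_list (map f (letters w)) \<in> ?C"
      "foldr (\<lambda>x a. r x \<otimes>\<^bsub>A\<^esub> a) (letters w) \<one>\<^bsub>A\<^esub> = h (prod_list (map f (letters w)))"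
      using prod[of "letters w"] f[OF w] by auto
    show "[Poly_Mapping.lookup P w] \<cdot>\<^bsub>A\<^esub> foldr (\<lambda>g a. r g \<otimes>\<^bsub>A\<^esub> a) (letters w) \<one>\<^bsub>A\<^esub> = h (?t w)"
      unfolding pw(2) by (rule ring_hom_add_pow[OF hom pw(1)])
  next
    show "(\<lambda>w. h (?t w)) \<in> Poly_Mapping.keys P \<rightarrow> carrier A" using closed hom_closed by blast
  qed (rule refl)
  moreover have "finsum A (\<lambda>w. h (?t w)) (Poly_Mapping.keys P) = h (nc_subst f P)"
    "nc_subst f P \<in> ?C"
    using sum[OF finite_keys subset_refl] unfolding nc_subst_def by blast+
  ultimately show "nc_eval A r P = h (nc_subst f P)" "nc_subst f P \<in> ?C"
    by (simp_all only:)
qed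

context euclidean_factor
begin

abbreviation "Fr \<equiv> (free_algebra gens :: (euclidean_gen, 'k) nc_poly ring)"

lemma euclidean_free_eq: "euclidean_free n = Fr"
  by (simp add: euclidean_free_def gens_def)

abbreviation "A \<equiv> omega_factor q n p"
abbreviation "I1 \<equiv> euclidean_ideal q n"
abbreviation "Q \<equiv> quantum_euclidean q n"
abbreviation "I2 \<equiv> Idl\<^bsub>Q\<^esub> {omega q n p}"

definition pr :: "(euclidean_gen, 'k) nc_poly \<Rightarrow> (euclidean_gen, 'k) nc_poly set set"
  where "pr f = I2 +>\<^bsub>Q\<^esub> (I1 +>\<^bsub>Fr\<^esub> f)"

lemma Q_eq: "Q = Fr Quot I1"
  by (simp add: quantum_euclidean_def euclidean_free_eq)

lemma ideal_I1: "ideal I1 Fr"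
  using ideal_euclidean_ideal[of q n] by (simp add: euclidean_free_eq)

lemma omega_eq: "omega q n p = I1 +>\<^bsub>Fr\<^esub> om p"
  by (simp add: omega_def euclidean_free_eq om_def)

lemma ideal_I2: "ideal I2 Q"
  by (rule ring.genideal_ideal[OF ring_quantum_euclidean]) (use omega_closed[of p n q] p in auto)

lemma hom_Q: "ring_hom_ring Fr Q (\<lambda>f. I1 +>\<^bsub>Fr\<^esub> f)"
  unfolding Q_eq by (rule ideal.rcos_ring_hom_ring[OF ideal_I1])

lemma hom_Q_surj: "(\<lambda>f. I1 +>\<^bsub>Fr\<^esub> f) ` carrier Fr = carrier Q"
  unfolding Q_eq by (rule quotient_map_surjective[OF ideal_I1])

lemma ring_A: "ring A"
  unfolding omega_factor_def by (rule ideal.quotient_is_ring[OF ideal_I2])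

lemma hom_pr: "ring_hom_ring Fr A pr"
proof (rule ring_hom_ringI2)
  have "(\<lambda>x. I2 +>\<^bsub>Q\<^esub> x) \<circ> (\<lambda>f. I1 +>\<^bsub>Fr\<^esub> f) \<in> ring_hom Fr A"
    unfolding omega_factor_def
    by (rule ring_hom_trans[OF ring_hom_ring.homh[OF hom_Q] ideal.rcos_ring_hom[OF ideal_I2]])
  then show "pr \<in> ring_hom Fr A" by (simp add: pr_def[abs_def] o_def)
qed (rule ring_free_algebra ring_A)+

lemma pr_surj: "pr ` carrier Fr = carrier A"
proof -
  have "pr ` carrier Fr = (\<lambda>x. I2 +>\<^bsub>Q\<^esub> x) ` ((\<lambda>f. I1 +>\<^bsub>Fr\<^esub> f) ` carrier Fr)"
    by (simp add: pr_def[abs_def] image_image)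
  also have "\<dots> = carrier A"
    unfolding hom_Q_surj omega_factor_def by (rule quotient_map_surjective[OF ideal_I2])
  finally show ?thesis .
qed

lemma pr_eq_0: "f \<in> carrier Fr \<Longrightarrow> pr f = \<zero>\<^bsub>A\<^esub> \<longleftrightarrow> (I1 +>\<^bsub>Fr\<^esub> f) \<in> I2"
  unfolding pr_def omega_factor_def
  by (rule quotient_map_eq_zero[OF ideal_I2]) (use hom_Q_surj in blast)

text \<open>The two successive quotients become one. By \<open>congruence\<close> and
  \<open>kerJ_minimal\<close>, this kernel is the ideal generated by the relators together with
  \<open>om p\<close>.\<close>

definition kerJ :: "(euclidean_gen, 'k) nc_poly set"
  where "kerJ = {f \<in> carrier Fr. pr f = \<zero>\<^bsub>A\<^esub>}"

lemma ideal_kerJ: "ideal kerJ Fr"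
  using ring_hom_ring.kernel_is_ideal[OF hom_pr] by (simp add: a_kernel_def' kerJ_def)

lemma om_closed: "i \<le> n \<Longrightarrow> om i \<in> carrier Fr"
  unfolding om_def by (intro nc_sum_closed nc_closed) (auto simp: gens_def)

lemma relators_sub: "euclidean_relators q n \<subseteq> carrier Fr"
  using euclidean_relators_closed[of q n] by (simp add: euclidean_free_eq)

lemma congruence: "euclidean_congruence q m n p kerJ"
proof (rule euclidean_congruence.intro[OF euclidean_factor_axioms], rule euclidean_congruence_axioms.intro)
  show "kerJ \<subseteq> carrier Fr" by (auto simp: kerJ_def)
  show "0 \<in> kerJ" using additive_subgroup.zero_closed[OF ideal.axioms(1)[OF ideal_kerJ]] by simp
  show "f + g \<in> kerJ" if "f \<in> kerJ" "g \<in> kerJ" for f g 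
    using additive_subgroup.a_closed[OF ideal.axioms(1)[OF ideal_kerJ] that] by simp
  show "f * g \<in> kerJ" "g * f \<in> kerJ" if "f \<in> kerJ" "g \<in> carrier Fr" for f g
    using ideal.I_r_closed[OF ideal_kerJ that] ideal.I_l_closed[OF ideal_kerJ that] by simp_all
  show "euclidean_relators q n \<subseteq> kerJ"
  proof
    fix r assume r: "r \<in> euclidean_relators q n"
    then have rF: "r \<in> carrier Fr" using relators_sub by blast
    have "r \<in> I1"
      unfolding euclidean_ideal_def euclidean_free_eq
      using ring.genideal_self[OF ring_free_algebra relators_sub] r by blast
    then have "(I1 +>\<^bsub>Fr\<^esub> r) = \<zero>\<^bsub>Q\<^esub>"
      unfolding Q_eq by (rule quotient_map_eq_zero[OF ideal_I1 rF, THEN iffD2])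
    moreover have "\<zero>\<^bsub>Q\<^esub> \<in> I2" by (rule additive_subgroup.zero_closed[OF ideal.axioms(1)[OF ideal_I2]])
    ultimately have "(I1 +>\<^bsub>Fr\<^esub> r) \<in> I2" by (simp only:)
    then have "pr r = \<zero>\<^bsub>A\<^esub>" by (rule pr_eq_0[OF rF, THEN iffD2])
    then show "r \<in> kerJ" unfolding kerJ_def using rF by blast
  qed
  have omF: "om p \<in> carrier Fr" using p by (intro om_closed) simp
  have "p \<le> n" using p by simp
  then have "omega q n p \<in> I2"
    by (rule ring.genideal_self'[OF ring_quantum_euclidean omega_closed])
  then have "(I1 +>\<^bsub>Fr\<^esub> om p) \<in> I2" by (subst (asm) (1) omega_eq)
  then have "pr (om p) = \<zero>\<^bsub>A\<^esub>" by (rule pr_eq_0[OF omF, THEN iffD2])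
  then show "om p \<in> kerJ" unfolding kerJ_def using omF by blast
qed

text \<open>The image of \<open>K\<close> in \<open>Q\<close> is an ideal containing
  \<open>\<omega>\<^sub>p\<close>, so it contains \<open>I2\<close>. As \<open>K\<close> also
  contains the kernel \<open>I1\<close> of the first quotient map, every element whose coset lies in
  this image lies in \<open>K\<close>.\<close>

lemma kerJ_minimal:
  assumes K: "ideal K Fr" "euclidean_relators q n \<subseteq> K" "om p \<in> K" and f: "f \<in> kerJ"
  shows "f \<in> K"
proof -
  have I1: "I1 \<subseteq> K"
    unfolding euclidean_ideal_def euclidean_free_eq
    by (rule ring.genideal_minimal[OF ring_free_algebra K(1,2)])
  have "ideal ((\<lambda>f. I1 +>\<^bsub>Fr\<^esub> f) ` K) Q"
    by (rule ideal_image_surjective[OF hom_Q hom_Q_surj K(1)])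
  then have "I2 \<subseteq> (\<lambda>f. I1 +>\<^bsub>Fr\<^esub> f) ` K"
  proof (rule ring.genideal_minimal[OF ring_quantum_euclidean])
    show "{omega q n p} \<subseteq> (\<lambda>f. I1 +>\<^bsub>Fr\<^esub> f) ` K" unfolding omega_eq using K(3) by blast
  qed
  moreover have fF: "f \<in> carrier Fr" and f0: "pr f = \<zero>\<^bsub>A\<^esub>" using f by (simp_all add: kerJ_def)
  have "(I1 +>\<^bsub>Fr\<^esub> f) \<in> I2" by (rule pr_eq_0[OF fF, THEN iffD1, OF f0])
  ultimately have "(I1 +>\<^bsub>Fr\<^esub> f) \<in> (\<lambda>f. I1 +>\<^bsub>Fr\<^esub> f) ` K" by (rule subsetD)
  then obtain g where g: "I1 +>\<^bsub>Fr\<^esub> f = I1 +>\<^bsub>Fr\<^esub> g" "g \<in> K" by (rule imageE)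
  have "abelian_subgroup I1 Fr"
    by (rule abelian_subgroupI3[OF ideal.axioms(1)[OF ideal_I1] ring.is_abelian_group[OF ring_free_algebra]])
  from abelian_subgroup.a_rcos_self[OF this fF] have "f \<in> I1 +>\<^bsub>Fr\<^esub> f" .
  then obtain i where "i \<in> I1" "f = i + g" unfolding g(1) by (auto simp: a_r_coset_def')
  then show ?thesis using I1 g(2) additive_subgroup.a_closed[OF ideal.axioms(1)[OF K(1)], of i g] by auto
qed

end

section \<open>Primeness and PI degree\<close>

lemma (in euclidean_congruence) free_algebra_spanned_mod:
  assumes "f \<in> F"
  obtains E c where "finite E" "E \<subseteq> std_index" "f - (\<Sum>e\<in>E. nc_const (c e) * std e) \<in> J"
  using spanned_free[OF assms] that unfolding spanned_def cg_def by blast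

context euclidean_factor
begin

lemma opr_kernel_ideal: "ideal {f \<in> carrier Fr. \<forall>\<phi> s. opr W V f \<phi> s = 0} Fr"
proof -
  define K where "K = {f \<in> carrier Fr. \<forall>\<phi> s. opr W V f \<phi> s = 0}"
  have KI: "f \<in> K" if "f \<in> carrier Fr" "\<And>\<phi> s. opr W V f \<phi> s = 0" for f
    using that unfolding K_def by blast
  have KD: "f \<in> carrier Fr" "opr W V f \<phi> s = 0" if "f \<in> K" for f \<phi> s
    using that unfolding K_def by blast+
  have ag: "abelian_group Fr" by (rule ring.is_abelian_group[OF ring_free_algebra])
  have neg: "- f \<in> carrier Fr" if "f \<in> carrier Fr" for f
    using nc_closed_diff[OF nc_closed_zero that] by simp
  have minus: "\<ominus>\<^bsub>Fr\<^esub> f = - f" if "f \<in> carrier Fr" for f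
    by (rule abelian_group.minus_equality[OF ag]) (use that neg in simp_all)
  have "subgroup K (add_monoid Fr)"
  proof (rule subgroup.intro)
    show "K \<subseteq> carrier (add_monoid Fr)" using KD(1) by auto
    show "\<one>\<^bsub>add_monoid Fr\<^esub> \<in> K" by (rule KI) (simp_all add: nc_closed)
    show "f \<otimes>\<^bsub>add_monoid Fr\<^esub> g \<in> K" if "f \<in> K" "g \<in> K" for f g
      using that KD by (intro KI) (simp_all add: nc_closed nc_act_add)
    show "inv\<^bsub>add_monoid Fr\<^esub> f \<in> K" if "f \<in> K" for f
    proof -
      have "inv\<^bsub>add_monoid Fr\<^esub> f = - f" using minus[OF KD(1)[OF that]] by (simp add: a_inv_def)
      moreover have "- f \<in> K"
        by (rule KI[OF neg[OF KD(1)[OF that]]]) (simp only: nc_act_uminus KD(2)[OF that] minus_zero)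
      ultimately show ?thesis by simp
    qed
  qed
  moreover have "g * f \<in> K" "f * g \<in> K" if f: "f \<in> K" and g: "g \<in> carrier Fr" for f g
  proof -
    have z: "opr W V f \<phi> = (\<lambda>s. 0)" for \<phi> using KD(2)[OF f] by (rule ext)
    show "g * f \<in> K"
      by (rule KI[OF nc_closed_mult[OF g KD(1)[OF f]]])
         (simp only: nc_act_mult[OF linear_act] z nc_act_zero_right[OF linear_act])
    show "f * g \<in> K"
      by (rule KI[OF nc_closed_mult[OF KD(1)[OF f] g]]) (simp only: nc_act_mult[OF linear_act] z)
  qed
  ultimately have "ideal K Fr" by (intro idealI[OF ring_free_algebra]) simp_all
  then show ?thesis unfolding K_def .
qed

lemma opr_kerJ:
  assumes "f \<in> kerJ" and V: "\<And>i. i \<le> n \<Longrightarrow> V i \<noteq> 0"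
  shows "opr W V f \<phi> s = 0"
proof -
  have "f \<in> {f \<in> carrier Fr. \<forall>\<phi> s. opr W V f \<phi> s = 0}"
  proof (rule kerJ_minimal[OF opr_kernel_ideal _ _ assms(1)])
    show "euclidean_relators q n \<subseteq> {f \<in> carrier Fr. \<forall>\<phi> s. opr W V f \<phi> s = 0}"
    proof
      fix r assume r: "r \<in> euclidean_relators q n"
      then have "opr W V r \<phi> s = 0" for \<phi> s by (rule opr_relator) (erule V)
      then show "r \<in> {f \<in> carrier Fr. \<forall>\<phi> s. opr W V f \<phi> s = 0}" using r relators_sub by blast
    qed
    have "opr W V (om p) \<phi> s = lam W s p * \<phi> s" for \<phi> s
      by (rule opr_om, rule V) (use p in linarith)
    then have "opr W V (om p) \<phi> s = 0" for \<phi> s by (simp only: lam_p mult_zero_left)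
    moreover have "om p \<in> carrier Fr" by (rule om_closed) (use p in linarith)
    ultimately show "om p \<in> {f \<in> carrier Fr. \<forall>\<phi> s. opr W V f \<phi> s = 0}" by blast
  qed
  then show ?thesis by blast
qed

lemma ent_kerJ: "f \<in> kerJ \<Longrightarrow> (\<And>i. i \<le> n \<Longrightarrow> V i \<noteq> 0) \<Longrightarrow> ent W V f a b = 0"
  unfolding ent_def by (rule opr_kerJ)

text \<open>Spanning and independence combined: modulo \<open>kerJ\<close>, \<open>f\<close> is a
  combination of standard monomials, some coefficient is nonzero because
  \<open>f \<notin> kerJ\<close>, and elements of \<open>kerJ\<close> have only zero
  entries.\<close>

lemma generic_nonzero_entry:
  assumes f: "f \<in> carrier Fr" "f \<notin> kerJ"
  obtains b where "b \<in> box" "generic (Suc n) (\<lambda>W. generic (Suc n) (\<lambda>V.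
    (\<forall>i\<le>n. V i \<noteq> 0) \<longrightarrow> ent W V f (\<lambda>_. 0) b \<noteq> 0))"
proof -
  obtain E c where E: "finite E" "E \<subseteq> std_index" and diff: "f - (\<Sum>e\<in>E. nc_const (c e) * std e) \<in> kerJ"
    by (rule euclidean_congruence.free_algebra_spanned_mod[OF congruence f(1)])
  let ?g = "\<Sum>e\<in>E. nc_const (c e) * std e"
  have "\<exists>e0\<in>E. c e0 \<noteq> 0"
  proof (rule ccontr)
    assume "\<not> ?thesis"
    then have "?g = 0" by (intro sum.neutral) simp
    then show False using diff f(2) by simp
  qed
  then obtain e0 where "e0 \<in> E" "c e0 \<noteq> 0" by blast
  from generic_std_combination[where c = c, OF E this] obtain b where b: "b \<in> box"
    "generic (Suc n) (\<lambda>W. generic (Suc n) (\<lambda>V. (\<forall>i\<le>n. V i \<noteq> 0) \<longrightarrow> ent W V ?g (\<lambda>_. 0) b \<noteq> 0))" .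
  have eq: "ent W V f a b = ent W V ?g a b" if "\<forall>i\<le>n. V i \<noteq> 0" for W V a b
  proof -
    have "ent W V (f - ?g) a b = 0" by (rule ent_kerJ[OF diff]) (use that in blast)
    then show ?thesis by (simp add: ent_def nc_act_diff)
  qed
  have "generic (Suc n) (\<lambda>W. generic (Suc n) (\<lambda>V. (\<forall>i\<le>n. V i \<noteq> 0) \<longrightarrow> ent W V f (\<lambda>_. 0) b \<noteq> 0))"
  proof (rule generic_mono[OF b(2)], erule generic_mono, rule impI)
    fix W V assume "(\<forall>i\<le>n. V i \<noteq> 0) \<longrightarrow> ent W V ?g (\<lambda>_. 0) b \<noteq> 0" "\<forall>i\<le>n. V i \<noteq> 0"
    then have "ent W V ?g (\<lambda>_. 0) b \<noteq> 0" by (rule mp)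
    then show "ent W V f (\<lambda>_. 0) b \<noteq> 0" using eq[OF \<open>\<forall>i\<le>n. V i \<noteq> 0\<close>, of W "\<lambda>_. 0" b] by (simp only: not_False_eq_True)
  qed
  then show ?thesis by (rule that[OF b(1)])
qed

lemma generic_all_nonzero: "generic (Suc n) (\<lambda>V :: nat \<Rightarrow> 'k. \<forall>i\<in>{..n}. V i \<noteq> 0)"
proof (rule generic_Ball)
  fix i assume "i \<in> {..n}"
  then show "generic (Suc n) (\<lambda>V :: nat \<Rightarrow> 'k. V i \<noteq> 0)" by (intro generic_nonzero) simp
qed simp

text \<open>The representations are jointly faithful on the factor algebra, so its identities can be
  tested on matrices over the field.\<close>

lemma kerJ_iff:
  assumes "f \<in> carrier Fr"
  shows "f \<in> kerJ \<longleftrightarrow> (\<forall>W V. (\<forall>i\<le>n. V i \<noteq> 0) \<longrightarrow> (\<forall>a\<in>box. \<forall>b\<in>box. ent W V f a b = 0))"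
proof (intro iffI allI impI ballI)
  fix W V :: "nat \<Rightarrow> 'k" and a b assume "f \<in> kerJ" "\<forall>i\<le>n. V i \<noteq> 0"
  then show "ent W V f a b = 0" by (intro ent_kerJ) blast+
next
  assume zero: "\<forall>W V. (\<forall>i\<le>n. V i \<noteq> 0) \<longrightarrow> (\<forall>a\<in>box. \<forall>b\<in>box. ent W V f a b = 0)"
  show "f \<in> kerJ"
  proof (rule ccontr)
    assume "f \<notin> kerJ"
    then obtain b where b: "b \<in> box" "generic (Suc n) (\<lambda>W. generic (Suc n) (\<lambda>V.
      (\<forall>i\<le>n. V i \<noteq> 0) \<longrightarrow> ent W V f (\<lambda>_. 0) b \<noteq> 0))" by (rule generic_nonzero_entry[OF assms])
    from generic_imp_ex[OF infinite_UNIV_alg_closed b(2)]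
    obtain W where W: "generic (Suc n) (\<lambda>V. (\<forall>i\<le>n. V i \<noteq> 0) \<longrightarrow> ent W V f (\<lambda>_. 0) b \<noteq> 0)"
      by (rule exE)
    have "generic (Suc n) (\<lambda>V :: nat \<Rightarrow> 'k. \<forall>i\<in>{..n}. V i \<noteq> 0)"
      by (rule generic_all_nonzero)
    with W have "generic (Suc n) (\<lambda>V. ((\<forall>i\<le>n. V i \<noteq> 0) \<longrightarrow> ent W V f (\<lambda>_. 0) b \<noteq> 0) \<and> (\<forall>i\<in>{..n}. V i \<noteq> 0))"
      by (rule generic_conj)
    from generic_imp_ex[OF infinite_UNIV_alg_closed this]
    obtain V where V: "((\<forall>i\<le>n. V i \<noteq> 0) \<longrightarrow> ent W V f (\<lambda>_. 0) b \<noteq> 0) \<and> (\<forall>i\<in>{..n}. V i \<noteq> 0)" by (rule exE)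
    have V0: "\<forall>i\<le>n. V i \<noteq> 0" using V by simp
    then have "ent W V f (\<lambda>_. 0) b \<noteq> 0" using V by blast
    moreover have "(\<lambda>_. 0) \<in> box" using m by (simp add: box_iff)
    ultimately show False using zero V0 b(1) by blast
  qed
qed

section \<open>Surjectivity onto the full matrix algebra\<close>

lemma q_powi_eq_1:
  assumes "q powi x = 1"
  shows "int m dvd x"
proof -
  let ?r = "x mod int m"
  have mpos: "int m > 0" using m by simp
  have r: "0 \<le> ?r" "?r < int m" using pos_mod_sign[OF mpos] pos_mod_bound[OF mpos] by blast+
  have "q powi int (nat ?r) = 1" using assms q_powi_mod[of x] r(1) by (simp only: int_nat_eq if_True)
  then have one: "q ^ nat ?r = 1" by (simp only: power_int_of_nat)
  have prim: "\<forall>k. 0 < k \<and> k < m \<longrightarrow> q ^ k \<noteq> 1" using q(2) by (simp add: primitive_root_of_unity_def)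
  have "nat ?r < m" using r by linarith
  then have "nat ?r = 0" using prim[rule_format, of "nat ?r"] one by (metis gr0I)
  then have "?r = 0" using r(1) by linarith
  then show ?thesis by (rule mod_0_imp_dvd)
qed

text \<open>As \<open>m\<close> is odd, the factor 2 can be cancelled modulo
  \<open>m\<close>.\<close>

lemma q_powi_2_inj:
  assumes "q powi (2 * x) = q powi (2 * y)" "0 \<le> x" "x < int m" "0 \<le> y" "y < int m"
  shows "x = y"
proof -
  have "q powi (2 * x - 2 * y) = 1"
    using assms(1) q by (simp add: power_int_diff)
  then have "int m dvd 2 * (x - y)" using q_powi_eq_1 by (simp add: algebra_simps)
  moreover have "coprime (int m) 2" using m by simp
  ultimately have dvd: "int m dvd x - y" using coprime_dvd_mult_right_iff[of "int m" 2 "x - y"] by blast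
  have small: "abs (x - y) < int m" using assms by linarith
  show ?thesis
  proof (rule ccontr)
    assume "x \<noteq> y"
    then have "abs (int m) \<le> abs (x - y)" using dvd by (intro dvd_imp_le_int) auto
    then show False using small by simp
  qed
qed

lemma box_in: "b \<in> box \<Longrightarrow> i \<in> supp \<Longrightarrow> 0 \<le> b i \<and> b i < int m"
  unfolding box_iff by metis

lemma box_out: "b \<in> box \<Longrightarrow> i \<notin> supp \<Longrightarrow> b i = 0"
  unfolding box_iff by metis

definition diag :: "(nat \<Rightarrow> 'k) \<Rightarrow> (nat \<Rightarrow> 'k) \<Rightarrow> ((nat \<Rightarrow> int) \<Rightarrow> 'k) \<Rightarrow> bool"
  where "diag W V h \<longleftrightarrow> (\<exists>f\<in>carrier Fr. \<forall>\<phi> s. opr W V f \<phi> s = h s * \<phi> s)"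

lemma diag_const: "diag W V (\<lambda>s. c)"
  unfolding diag_def by (rule bexI[of _ "nc_const c"]) (simp_all add: nc_act_const nc_closed)

lemma diag_mult:
  assumes "diag W V h" "diag W V g"
  shows "diag W V (\<lambda>s. h s * g s)"
proof -
  from assms(1) obtain f1 where f1: "f1 \<in> carrier Fr" "\<forall>\<phi> s. opr W V f1 \<phi> s = h s * \<phi> s"
    unfolding diag_def by (rule bexE)
  from assms(2) obtain f2 where f2: "f2 \<in> carrier Fr" "\<forall>\<phi> s. opr W V f2 \<phi> s = g s * \<phi> s"
    unfolding diag_def by (rule bexE)
  show ?thesis unfolding diag_def
    by (rule bexI[of _ "f1 * f2"])
       (simp_all add: f1 f2 nc_closed nc_act_mult[OF linear_act] mult.assoc)
qed

lemma diag_prod: "(\<And>x. x \<in> S \<Longrightarrow> diag W V (h x)) \<Longrightarrow> diag W V (\<lambda>s. \<Prod>x\<in>S. h x s)"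
  by (induction S rule: infinite_finite_induct) (simp_all add: diag_const diag_mult)

lemma diag_lam_diff:
  assumes V: "\<And>i. i \<le> n \<Longrightarrow> V i \<noteq> 0" and i: "i \<le> n"
  shows "diag W V (\<lambda>s. lam W s i - c)"
  unfolding diag_def
proof (rule bexI[of _ "om i - nc_const c"], intro allI)
  fix \<phi> s
  have "opr W V (om i) \<phi> s = lam W s i * \<phi> s" by (rule opr_om) (use V i in auto)
  then show "opr W V (om i - nc_const c) \<phi> s = (lam W s i - c) * \<phi> s"
    by (simp add: nc_act_diff nc_act_const algebra_simps)
qed (intro nc_closed om_closed i)

text \<open>Interpolation on the joint spectrum: for every coordinate \<open>i\<close>, multiply
  \<open>\<omega>\<^sub>i\<close> minus each eigenvalue other than the one at \<open>c\<close>.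
  These eigenvalues are distinct because \<open>W i \<noteq> 0\<close>.\<close>

lemma diag_point:
  assumes V: "\<And>i. i \<le> n \<Longrightarrow> V i \<noteq> 0" and W: "\<And>i. i \<le> n \<Longrightarrow> W i \<noteq> 0" and c: "c \<in> box"
  shows "\<exists>h. diag W V h \<and> (\<forall>a\<in>box. h a \<noteq> 0 \<longleftrightarrow> a = c)"
proof (intro exI conjI ballI)
  let ?h = "\<lambda>s. \<Prod>i\<in>supp. \<Prod>t\<in>{0..<int m} - {c i}. (lam W s i - W i * q powi (2 * t))"
  show "diag W V ?h"
    by (intro diag_prod diag_lam_diff V) (auto simp: supp_def)
  fix a assume a: "a \<in> box"
  have fin: "finite supp" by (simp add: supp_def)
  have lam: "lam W a i = W i * q powi (2 * a i)" if "i \<in> supp" for i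
    using that by (auto simp: lam_def z_def supp_def)
  have Wi: "W i \<noteq> 0" if "i \<in> supp" for i using W that by (auto simp: supp_def)
  have rng: "0 \<le> a i" "a i < int m" if "i \<in> supp" for i using box_in[OF a that] by simp_all
  have "?h a = 0" if "a \<noteq> c"
  proof -
    obtain i where i: "a i \<noteq> c i" using \<open>a \<noteq> c\<close> by auto
    then have "i \<in> supp" using box_out[OF a, of i] box_out[OF c, of i] by auto
    moreover have "(\<Prod>t\<in>{0..<int m} - {c i}. (lam W a i - W i * q powi (2 * t))) = 0"
      by (rule prod_zero) (use i rng[OF \<open>i \<in> supp\<close>] lam[OF \<open>i \<in> supp\<close>] in \<open>auto intro!: bexI[of _ "a i"]\<close>)
    ultimately show ?thesis using fin by (intro prod_zero) auto
  qed
  moreover have "?h c \<noteq> 0"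
  proof -
    have "lam W c i - W i * q powi (2 * t) \<noteq> 0" if "i \<in> supp" "t \<in> {0..<int m} - {c i}" for i t
    proof
      assume "lam W c i - W i * q powi (2 * t) = 0"
      then have "q powi (2 * c i) = q powi (2 * t)"
        using Wi[OF that(1)] that(1) by (auto simp: lam_def z_def supp_def)
      moreover have "0 \<le> c i" "c i < int m" using box_in[OF c that(1)] by simp_all
      ultimately have "c i = t" using that(2) by (intro q_powi_2_inj) auto
      then show False using that(2) by simp
    qed
    then show ?thesis using fin by (simp add: prod_zero_iff)
  qed
  ultimately show "?h a \<noteq> 0 \<longleftrightarrow> a = c" by blast
qed

text \<open>In matrix terms, row \<open>a\<close> of \<open>f\<close> has its only nonzero entry in
  column \<open>b\<close>. The other rows are arbitrary; \<open>matrix_unit\<close> cuts them off by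
  a diagonal element.\<close>

definition reach :: "(nat \<Rightarrow> 'k) \<Rightarrow> (nat \<Rightarrow> 'k) \<Rightarrow> (nat \<Rightarrow> int) \<Rightarrow> (nat \<Rightarrow> int) \<Rightarrow> bool"
  where "reach W V a b \<longleftrightarrow> (\<exists>f\<in>carrier Fr. \<exists>k. k \<noteq> 0 \<and> (\<forall>\<phi>. periodic \<phi> \<longrightarrow> opr W V f \<phi> a = k * \<phi> b))"

lemma reach_refl: "reach W V a a"
  unfolding reach_def by (rule bexI[of _ 1], rule exI[of _ 1]) (simp_all add: nc_act_one nc_closed)

lemma reach_trans:
  assumes "reach W V a b" "reach W V b c"
  shows "reach W V a c"
proof -
  obtain f k where f: "f \<in> carrier Fr" "k \<noteq> 0" "\<And>\<phi>. periodic \<phi> \<Longrightarrow> opr W V f \<phi> a = k * \<phi> b"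
    using assms(1) unfolding reach_def by blast
  obtain g l where g: "g \<in> carrier Fr" "l \<noteq> 0" "\<And>\<phi>. periodic \<phi> \<Longrightarrow> opr W V g \<phi> b = l * \<phi> c"
    using assms(2) unfolding reach_def by blast
  have "opr W V (f * g) \<phi> a = (k * l) * \<phi> c" if "periodic \<phi>" for \<phi>
    using f(3)[OF periodic_opr[OF that]] g(3)[OF that] by (simp add: nc_act_mult[OF linear_act])
  then show ?thesis unfolding reach_def using f g nc_closed_mult by (intro bexI[of _ "f * g"] exI[of _ "k * l"]) auto
qed

lemma reach_step:
  assumes V: "\<And>i. i \<le> n \<Longrightarrow> V i \<noteq> 0" and j: "1 \<le> j" "j \<le> n"
  shows "reach W V a (red (down a j))"
  unfolding reach_def
proof (rule bexI[of _ "var_x j"], rule exI[of _ "V j * q powi (z a (iota j))"], intro conjI allI impI)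
  show "V j * q powi (z a (iota j)) \<noteq> 0" using V[OF j(2)] q by simp
  fix \<phi> assume "periodic \<phi>"
  then show "opr W V (var_x j) \<phi> a = V j * q powi (z a (iota j)) * \<phi> (red (down a j))"
    by (simp add: nc_act_var periodic_def)
qed (use j in \<open>auto intro!: nc_closed_var simp: gens_def\<close>)

lemma reach_steps:
  assumes V: "\<And>i. i \<le> n \<Longrightarrow> V i \<noteq> 0" and j: "1 \<le> j" "j \<le> n" and a: "a \<in> box"
  shows "reach W V a (red (\<lambda>l. a l - int t * tau j l))"
proof (induction t)
  case 0
  then show ?case using a reach_refl by (simp add: box_def)
next
  case (Suc t)
  let ?b = "red (\<lambda>l. a l - int t * tau j l)"
  have "reach W V ?b (red (down ?b j))" by (rule reach_step) (use V j in auto)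
  moreover have "red (down ?b j) = red (down (\<lambda>l. a l - int t * tau j l) j)" by (rule red_updown)
  moreover have "down (\<lambda>l. a l - int t * tau j l) j = (\<lambda>l. a l - int (Suc t) * tau j l)"
    by (auto simp: down_def algebra_simps)
  ultimately show ?case using reach_trans[OF Suc] by simp
qed

text \<open>Coordinates are corrected from the highest downwards:
  \<open>x\<^sub>j\<^sub>+\<^sub>1\<close> shifts only coordinates up to \<open>j\<close>, so those
  already correct are not disturbed.\<close>

lemma reach_box:
  assumes V: "\<And>i. i \<le> n \<Longrightarrow> V i \<noteq> 0" and ab: "a \<in> box" "b \<in> box"
  shows "reach W V a b"
proof -
  have "reach W V a b" if "\<forall>l\<ge>j. a l = b l" "a \<in> box" "b \<in> box" for j a b
    using that
  proof (induction j arbitrary: a)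
    case 0
    then have "a = b" by auto
    then show ?case by (simp add: reach_refl)
  next
    case (Suc j)
    show ?case
    proof (cases "j \<in> supp")
      case False
      then have "a j = b j" using box_out[OF Suc.prems(2)] box_out[OF Suc.prems(3)] by simp
      then have "\<forall>l\<ge>j. a l = b l" using Suc.prems(1) by (metis le_antisym not_less_eq_eq)
      then show ?thesis using Suc by blast
    next
      case True
      \<comment> \<open>The number of applications of \<open>x\<^sub>j\<^sub>+\<^sub>1\<close>, each
        of which lowers coordinate \<open>j\<close> by 1 modulo \<open>m\<close>.\<close>
      define t where "t = nat ((a j - b j) mod int m)"
      define a' where "a' = red (\<lambda>l. a l - int t * tau (Suc j) l)"
      have t: "int t = (a j - b j) mod int m" using m by (simp add: t_def)
      have "reach W V a a'" unfolding a'_def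
        by (rule reach_steps) (use V True Suc.prems in \<open>auto simp: supp_def\<close>)
      moreover have "reach W V a' b"
      proof (rule Suc.IH)
        show "a' \<in> box" unfolding a'_def by (rule red_in_box)
        show "\<forall>l\<ge>j. a' l = b l"
        proof (intro allI impI)
          fix l assume l: "j \<le> l"
          have bl: "red b l = b l" and al: "red a l = a l" using Suc.prems by (auto simp: box_def)
          show "a' l = b l"
          proof (cases "l = j")
            case True
            then have "a' l = (a j - int t) mod int m"
              using \<open>j \<in> supp\<close> by (simp add: a'_def red_def z_def tau_def)
            also have "\<dots> = b j mod int m" unfolding t by (simp add: mod_simps)
            also have "\<dots> = b l" using bl True \<open>j \<in> supp\<close> by (simp add: red_def z_def)
            finally show ?thesis .
          next
            case False
            then have "tau (Suc j) l = 0" using l by (simp add: tau_def)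
            then have "a' l = red a l" by (simp add: a'_def red_def z_def)
            then show ?thesis using al Suc.prems(1) l False by simp
          qed
        qed
      qed (rule Suc.prems)
      ultimately show ?thesis by (rule reach_trans)
    qed
  qed
  moreover have "\<forall>l\<ge>n. a l = b l"
    using box_out[OF ab(1)] box_out[OF ab(2)] by (simp add: supp_def)
  ultimately show ?thesis using ab by blast
qed

text \<open>In \<open>fa * (f * fb)\<close> the diagonal element \<open>fa\<close> keeps row
  \<open>a\<close> only, \<open>fb\<close> keeps column \<open>b\<close> only, and \<open>f\<close>
  has a nonzero entry where they meet; \<open>c\<close> is the value to be normalised.\<close>

lemma matrix_unit:
  assumes V: "\<And>i. i \<le> n \<Longrightarrow> V i \<noteq> 0" and W: "\<And>i. i \<le> n \<Longrightarrow> W i \<noteq> 0" and ab: "a \<in> box" "b \<in> box"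
  shows "\<exists>f\<in>carrier Fr. \<forall>x\<in>box. \<forall>y\<in>box. ent W V f x y = (if x = a \<and> y = b then 1 else 0)"
proof -
  have "\<exists>h. diag W V h \<and> (\<forall>x\<in>box. h x \<noteq> 0 \<longleftrightarrow> x = a)" by (rule diag_point) (erule V, erule W, rule ab)
  then obtain ha where ha: "diag W V ha" "\<forall>x\<in>box. ha x \<noteq> 0 \<longleftrightarrow> x = a" by (elim exE conjE)
  from ha(1) obtain fa where fa: "fa \<in> carrier Fr" "\<forall>\<phi> s. opr W V fa \<phi> s = ha s * \<phi> s"
    unfolding diag_def by (rule bexE)
  have "\<exists>h. diag W V h \<and> (\<forall>x\<in>box. h x \<noteq> 0 \<longleftrightarrow> x = b)" by (rule diag_point) (erule V, erule W, rule ab)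
  then obtain hb where hb: "diag W V hb" "\<forall>x\<in>box. hb x \<noteq> 0 \<longleftrightarrow> x = b" by (elim exE conjE)
  from hb(1) obtain fb where fb: "fb \<in> carrier Fr" "\<forall>\<phi> s. opr W V fb \<phi> s = hb s * \<phi> s"
    unfolding diag_def by (rule bexE)
  have "reach W V a b" by (rule reach_box) (erule V, rule ab, rule ab)
  then obtain f k where f: "f \<in> carrier Fr" "k \<noteq> 0" "\<forall>\<phi>. periodic \<phi> \<longrightarrow> opr W V f \<phi> a = k * \<phi> b"
    unfolding reach_def by (elim bexE exE conjE)
  define c where "c = ha a * (k * hb b)"
  have c: "c \<noteq> 0" using ha(2) hb(2) f(2) ab by (simp add: c_def)
  have "ent W V (nc_const (inverse c) * (fa * (f * fb))) x y = (if x = a \<and> y = b then 1 else 0)"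
    if "x \<in> box" "y \<in> box" for x y
  proof -
    have e: "ent W V (nc_const (inverse c) * (fa * (f * fb))) x y =
        inverse c * (ha x * opr W V f (opr W V fb (per y)) x)"
      by (simp add: ent_def nc_act_mult[OF linear_act] nc_act_const fa(2))
    show ?thesis
    proof (cases "x = a")
      case True
      have "opr W V f (opr W V fb (per y)) a = k * (hb b * per y b)"
        using f(3)[rule_format, OF periodic_opr[OF periodic_per]] by (simp add: fb(2))
      moreover have "per y b = (if b = y then 1 else 0)" using ab(2) by (simp add: per_def box_def)
      ultimately show ?thesis unfolding e using True c by (cases "b = y") (auto simp: c_def field_simps)
    next
      case False
      then have "ha x = 0" using ha(2) that(1) by blast
      then show ?thesis unfolding e using False by simp
    qed
  qed
  moreover have "nc_const (inverse c) * (fa * (f * fb)) \<in> carrier Fr" by (intro nc_closed fa(1) fb(1) f(1))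
  ultimately show ?thesis by blast
qed

lemma ent_surjective:
  assumes V: "\<And>i. i \<le> n \<Longrightarrow> V i \<noteq> 0" and W: "\<And>i. i \<le> n \<Longrightarrow> W i \<noteq> 0"
  shows "\<exists>f\<in>carrier Fr. \<forall>x\<in>box. \<forall>y\<in>box. ent W V f x y = M x y"
proof -
  have "\<forall>ab\<in>box \<times> box. \<exists>f. f \<in> carrier Fr \<and> (\<forall>x\<in>box. \<forall>y\<in>box. ent W V f x y = (if x = fst ab \<and> y = snd ab then 1 else 0))"
  proof
    fix ab assume ab: "ab \<in> box \<times> box"
    have "\<exists>f\<in>carrier Fr. \<forall>x\<in>box. \<forall>y\<in>box. ent W V f x y = (if x = fst ab \<and> y = snd ab then 1 else 0)"
      by (rule matrix_unit) (use V W ab in auto)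
    then show "\<exists>f. f \<in> carrier Fr \<and> (\<forall>x\<in>box. \<forall>y\<in>box. ent W V f x y = (if x = fst ab \<and> y = snd ab then 1 else 0))"
      by blast
  qed
  then obtain u where u: "\<forall>ab\<in>box \<times> box. u ab \<in> carrier Fr \<and>
      (\<forall>x\<in>box. \<forall>y\<in>box. ent W V (u ab) x y = (if x = fst ab \<and> y = snd ab then 1 else 0))"
    unfolding bchoice_iff by (rule exE)
  let ?f = "\<Sum>ab\<in>box \<times> box. nc_const (M (fst ab) (snd ab)) * u ab"
  have "ent W V ?f x y = M x y" if "x \<in> box" "y \<in> box" for x y
  proof -
    have "ent W V ?f x y = (\<Sum>ab\<in>box \<times> box. if ab = (x, y) then M x y else 0)"
      unfolding ent_sum ent_const_mult
    proof (rule sum.cong[OF refl])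
      fix ab assume "ab \<in> box \<times> box"
      then have "ent W V (u ab) x y = (if x = fst ab \<and> y = snd ab then 1 else 0)" using u that by blast
      then show "M (fst ab) (snd ab) * ent W V (u ab) x y = (if ab = (x, y) then M x y else 0)"
        by (auto simp: prod_eq_iff)
    qed
    then show ?thesis using that finite_box by (simp add: sum.delta)
  qed
  moreover have "?f \<in> carrier Fr" by (intro nc_sum_closed nc_closed) (use u in blast)
  ultimately show ?thesis by blast
qed

section \<open>Primeness\<close>

lemma zero_box: "(\<lambda>_. 0) \<in> box"
  using m by (simp add: box_iff)

lemma one_notin_kerJ: "1 \<notin> kerJ"
proof
  assume "1 \<in> kerJ"
  then have "ent (\<lambda>_. 1) (\<lambda>_. 1) 1 (\<lambda>_. 0) (\<lambda>_. 0) = 0" by (rule ent_kerJ) simp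
  then show False by (simp add: ent_one[OF zero_box])
qed

text \<open>Both elements have a nonzero entry in row 0, at columns \<open>b\<close> and
  \<open>c\<close>. The matrix unit \<open>u\<close> at \<open>(b, 0)\<close> leads from column
  \<open>b\<close> back to row 0, so the entry \<open>(0, c)\<close> of the product is the product
  of these two entries.\<close>

lemma mult_connect_notin_kerJ:
  assumes f: "f \<in> carrier Fr" "f \<notin> kerJ" and g: "g \<in> carrier Fr" "g \<notin> kerJ"
  shows "\<exists>u\<in>carrier Fr. f * u * g \<notin> kerJ"
proof -
  obtain b where b: "b \<in> box" "generic (Suc n) (\<lambda>W. generic (Suc n) (\<lambda>V.
    (\<forall>i\<le>n. V i \<noteq> 0) \<longrightarrow> ent W V f (\<lambda>_. 0) b \<noteq> 0))" by (rule generic_nonzero_entry[OF f])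
  obtain c where c: "c \<in> box" "generic (Suc n) (\<lambda>W. generic (Suc n) (\<lambda>V.
    (\<forall>i\<le>n. V i \<noteq> 0) \<longrightarrow> ent W V g (\<lambda>_. 0) c \<noteq> 0))" by (rule generic_nonzero_entry[OF g])
  from generic_imp_ex[OF infinite_UNIV_alg_closed generic_conj[OF generic_conj[OF b(2) c(2)] generic_all_nonzero]]
  obtain W where W: "generic (Suc n) (\<lambda>V. (\<forall>i\<le>n. V i \<noteq> 0) \<longrightarrow> ent W V f (\<lambda>_. 0) b \<noteq> 0)"
    "generic (Suc n) (\<lambda>V. (\<forall>i\<le>n. V i \<noteq> 0) \<longrightarrow> ent W V g (\<lambda>_. 0) c \<noteq> 0)" "\<forall>i\<in>{..n}. W i \<noteq> 0"
    by (elim exE conjE)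
  from generic_imp_ex[OF infinite_UNIV_alg_closed generic_conj[OF generic_conj[OF W(1,2)] generic_all_nonzero]]
  obtain V where V: "(\<forall>i\<le>n. V i \<noteq> 0) \<longrightarrow> ent W V f (\<lambda>_. 0) b \<noteq> 0"
    "(\<forall>i\<le>n. V i \<noteq> 0) \<longrightarrow> ent W V g (\<lambda>_. 0) c \<noteq> 0" "\<forall>i\<in>{..n}. V i \<noteq> 0"
    by (elim exE conjE)
  have V0: "\<And>i. i \<le> n \<Longrightarrow> V i \<noteq> 0" using V(3) by simp
  have fg: "ent W V f (\<lambda>_. 0) b \<noteq> 0" "ent W V g (\<lambda>_. 0) c \<noteq> 0" using V by auto
  have "\<exists>u\<in>carrier Fr. \<forall>x\<in>box. \<forall>y\<in>box. ent W V u x y = (if x = b \<and> y = (\<lambda>_. 0) then 1 else 0)"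
    by (rule matrix_unit) (use V0 W(3) b(1) zero_box in auto)
  then obtain u where u: "u \<in> carrier Fr"
    "\<And>x y. x \<in> box \<Longrightarrow> y \<in> box \<Longrightarrow> ent W V u x y = (if x = b \<and> y = (\<lambda>_. 0) then 1 else 0)" by blast
  have "ent W V (f * u) (\<lambda>_. 0) y = (if y = (\<lambda>_. 0) then ent W V f (\<lambda>_. 0) b else 0)" if "y \<in> box" for y
  proof -
    have "ent W V (f * u) (\<lambda>_. 0) y = (\<Sum>x\<in>box. if x = b then if y = (\<lambda>_. 0) then ent W V f (\<lambda>_. 0) x else 0 else 0)"
      unfolding ent_mult by (rule sum.cong[OF refl]) (simp add: u(2) that)
    then show ?thesis using b(1) finite_box by (simp add: sum.delta)
  qed
  then have "ent W V (f * u * g) (\<lambda>_. 0) c =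
      (\<Sum>y\<in>box. if y = (\<lambda>_. 0) then ent W V f (\<lambda>_. 0) b * ent W V g y c else 0)"
    unfolding ent_mult[of W V "f * u"] by (intro sum.cong) auto
  also have "\<dots> = ent W V f (\<lambda>_. 0) b * ent W V g (\<lambda>_. 0) c"
    using zero_box finite_box by (simp add: sum.delta)
  finally have "ent W V (f * u * g) (\<lambda>_. 0) c \<noteq> 0" using fg by simp
  then have "f * u * g \<notin> kerJ" using ent_kerJ[of "f * u * g" V W "\<lambda>_. 0" c] V0 by blast
  then show ?thesis using u(1) by blast
qed

lemma prime_A: "prime_ring A"
  unfolding prime_ring_def
proof (intro conjI allI impI)
  show "ring A" by (rule ring_A)
  have one: "pr 1 = \<one>\<^bsub>A\<^esub>" using ring_hom_ring.homh[OF hom_pr] ring_hom_one[of pr Fr A] by simp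
  show "\<one>\<^bsub>A\<^esub> \<noteq> \<zero>\<^bsub>A\<^esub>"
    using one_notin_kerJ nc_closed_one unfolding kerJ_def one[symmetric] by blast
  fix I J assume I: "ideal I A" and J: "ideal J A" and IJ: "I \<cdot>\<^bsub>A\<^esub> J = {\<zero>\<^bsub>A\<^esub>}"
  show "I = {\<zero>\<^bsub>A\<^esub>} \<or> J = {\<zero>\<^bsub>A\<^esub>}"
  proof (rule ccontr)
    assume *: "\<not> ?thesis"
    have nz: "\<exists>f\<in>carrier Fr. pr f \<in> K \<and> f \<notin> kerJ" if K: "ideal K A" "K \<noteq> {\<zero>\<^bsub>A\<^esub>}" for K
    proof -
      have "\<zero>\<^bsub>A\<^esub> \<in> K" by (rule additive_subgroup.zero_closed[OF ideal.axioms(1)[OF K(1)]])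
      then obtain a where a: "a \<in> K" "a \<noteq> \<zero>\<^bsub>A\<^esub>" using K(2) by blast
      have "a \<in> carrier A" using ideal.Icarr[OF K(1) a(1)] .
      then obtain f where "f \<in> carrier Fr" "a = pr f" unfolding pr_surj[symmetric] by blast
      then show ?thesis using a unfolding kerJ_def by blast
    qed
    obtain f where f: "f \<in> carrier Fr" "pr f \<in> I" "f \<notin> kerJ" using nz[OF I] * by blast
    obtain g where g: "g \<in> carrier Fr" "pr g \<in> J" "g \<notin> kerJ" using nz[OF J] * by blast
    obtain u where u: "u \<in> carrier Fr" "f * u * g \<notin> kerJ" using mult_connect_notin_kerJ[OF f(1,3) g(1,3)] by blast
    have hom: "pr (x * y) = pr x \<otimes>\<^bsub>A\<^esub> pr y" if "x \<in> carrier Fr" "y \<in> carrier Fr" for x y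
      using ring_hom_mult[OF ring_hom_ring.homh[OF hom_pr] that] by simp
    have fu: "f * u \<in> carrier Fr" using f u by (intro nc_closed)
    have "pr u \<in> carrier A" using u(1) pr_surj by blast
    then have "pr (f * u) \<in> I" unfolding hom[OF f(1) u(1)] by (rule ideal.I_r_closed[OF I f(2)])
    then have "pr (f * u) \<otimes>\<^bsub>A\<^esub> pr g \<in> I \<cdot>\<^bsub>A\<^esub> J" using g(2) by (rule ideal_prod.prod)
    then have "pr (f * u * g) = \<zero>\<^bsub>A\<^esub>" unfolding IJ hom[OF fu g(1)] by blast
    then show False using u(2) nc_closed_mult[OF fu g(1)] unfolding kerJ_def by blast
  qed
qed

lemma ent_nc_subst:
  assumes "a \<in> box"
  shows "ent W V (nc_subst f P) a b = mat_eval box (\<lambda>g. ent W V (f g)) P a b"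
proof -
  have "ent W V (of_int c * x) a b = of_int c * ent W V x a b" for c x
    using ent_const_mult[of W V "of_int c" x a b] by (simp add: nc_const_def single_of_int)
  then show ?thesis
    unfolding nc_subst_def mat_eval_def ent_sum
    by (simp add: ent_prod_list[OF assms] comp_def)
qed

lemma nc_eval_eq_0_iff:
  fixes P :: "(nat, int) nc_poly"
  assumes "\<And>w x. w \<in> Poly_Mapping.keys P \<Longrightarrow> x \<in> set (letters w) \<Longrightarrow> f x \<in> carrier Fr \<and> r x = pr (f x)"
  shows "nc_eval A r P = \<zero>\<^bsub>A\<^esub> \<longleftrightarrow> (\<forall>W V. (\<forall>i\<le>n. V i \<noteq> 0) \<longrightarrow>
    (\<forall>a\<in>box. \<forall>b\<in>box. mat_eval box (\<lambda>g. ent W V (f g)) P a b = 0))"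
proof -
  have 1: "nc_eval A r P = pr (nc_subst f P)" by (rule nc_eval_hom(1)[OF hom_pr assms])
  have 2: "nc_subst f P \<in> carrier Fr" by (rule nc_eval_hom(2)[OF hom_pr assms])
  have "nc_eval A r P = \<zero>\<^bsub>A\<^esub> \<longleftrightarrow> nc_subst f P \<in> kerJ" unfolding 1 kerJ_def using 2 by blast
  then show ?thesis unfolding kerJ_iff[OF 2] by (simp add: ent_nc_subst)
qed

end

section \<open>The standard polynomial\<close>

definition std_word :: "nat \<Rightarrow> (nat \<Rightarrow> nat) \<Rightarrow> nat free_monoid"
  where "std_word L \<tau> = Word (map (\<lambda>k. Suc (\<tau> k)) [0..<L])"

definition standard_poly :: "nat \<Rightarrow> (nat, int) nc_poly"
  where "standard_poly L = (\<Sum>\<tau> | \<tau> permutes {..<L}. Poly_Mapping.single (std_word L \<tau>) (sign \<tau>))"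

lemma std_word_inj: "inj_on (std_word L) {\<tau>. \<tau> permutes {..<L}}"
proof (rule inj_onI)
  fix \<tau> \<sigma> assume "\<tau> \<in> {\<tau>. \<tau> permutes {..<L}}" "\<sigma> \<in> {\<tau>. \<tau> permutes {..<L}}" and eq: "std_word L \<tau> = std_word L \<sigma>"
  then have p: "\<tau> permutes {..<L}" "\<sigma> permutes {..<L}" by auto
  show "\<tau> = \<sigma>"
  proof
    fix k
    show "\<tau> k = \<sigma> k"
    proof (cases "k < L")
      case True
      have "\<forall>k\<in>{0..<L}. \<tau> k = \<sigma> k" using eq by (simp add: std_word_def)
      then show ?thesis using True by simp
    next
      case False
      then show ?thesis using permutes_not_in[OF p(1), of k] permutes_not_in[OF p(2), of k] by simp
    qed
  qed
qed

lemma lookup_standard_poly: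
  assumes "\<tau> permutes {..<L}"
  shows "Poly_Mapping.lookup (standard_poly L) (std_word L \<tau>) = sign \<tau>"
proof -
  have "Poly_Mapping.lookup (standard_poly L) (std_word L \<tau>) =
      (\<Sum>\<sigma> | \<sigma> permutes {..<L}. if \<sigma> = \<tau> then sign \<sigma> else 0)"
    unfolding standard_poly_def lookup_sum
  proof (rule sum.cong[OF refl])
    fix \<sigma> assume "\<sigma> \<in> {\<sigma>. \<sigma> permutes {..<L}}"
    then have "std_word L \<sigma> = std_word L \<tau> \<longleftrightarrow> \<sigma> = \<tau>"
      using inj_onD[OF std_word_inj, of L \<sigma> \<tau>] assms by auto
    then show "Poly_Mapping.lookup (Poly_Mapping.single (std_word L \<sigma>) (sign \<sigma>)) (std_word L \<tau>) =
        (if \<sigma> = \<tau> then sign \<sigma> else 0)" by (simp add: lookup_single when_def)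
  qed
  then show ?thesis using assms by (simp add: sum.delta finite_permutations)
qed

lemma keys_standard_poly: "Poly_Mapping.keys (standard_poly L) = std_word L ` {\<tau>. \<tau> permutes {..<L}}"
proof (intro equalityI subsetI)
  fix w assume "w \<in> Poly_Mapping.keys (standard_poly L)"
  then have "(\<Sum>\<sigma> | \<sigma> permutes {..<L}. Poly_Mapping.lookup (Poly_Mapping.single (std_word L \<sigma>) (sign \<sigma>)) w) \<noteq> 0"
    by (simp add: in_keys_iff standard_poly_def lookup_sum)
  then obtain \<sigma> where "\<sigma> \<in> {\<sigma>. \<sigma> permutes {..<L}}"
    "Poly_Mapping.lookup (Poly_Mapping.single (std_word L \<sigma>) (sign \<sigma>)) w \<noteq> 0"
    by (rule sum.not_neutral_contains_not_neutral)
  then show "w \<in> std_word L ` {\<tau>. \<tau> permutes {..<L}}"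
    by (auto simp: lookup_single when_def split: if_splits)
next
  fix w assume "w \<in> std_word L ` {\<tau>. \<tau> permutes {..<L}}"
  then show "w \<in> Poly_Mapping.keys (standard_poly L)" by (auto simp: in_keys_iff lookup_standard_poly)
qed

lemma standard_poly_monic: "nc_degree (standard_poly L) = L" "nc_monic (standard_poly L)"
proof -
  have len: "length (letters (std_word L \<tau>)) = L" for \<tau> by (simp add: std_word_def)
  have id: "id \<in> {\<tau>. \<tau> permutes {..<L}}" by (simp add: permutes_id)
  have "(\<lambda>w. length (letters w)) ` Poly_Mapping.keys (standard_poly L) = {L}"
    unfolding keys_standard_poly image_image len using id by blast
  then show deg: "nc_degree (standard_poly L) = L" by (simp add: nc_degree_def)
  show "nc_monic (standard_poly L)"
    unfolding nc_monic_def deg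
    by (rule exI[of _ "std_word L id"]) (simp add: len lookup_standard_poly permutes_id)
qed

text \<open>The \<open>Suc\<close> in \<open>std_word\<close> turns positions counted from 0 into
  variables counted from 1.\<close>

lemma standard_poly_carrier: "standard_poly L \<in> carrier (free_algebra {1..L})"
  unfolding carrier_free_algebra keys_standard_poly
proof
  fix w assume "w \<in> std_word L ` {\<tau>. \<tau> permutes {..<L}}"
  then obtain \<tau> where \<tau>: "\<tau> permutes {..<L}" "w = std_word L \<tau>" by blast
  have "\<tau> k < L" if "k < L" for k using permutes_in_image[OF \<tau>(1), of k] that by simp
  then show "set (letters w) \<subseteq> {1..L}" using \<tau>(2) by (auto simp: std_word_def Suc_le_eq)
qed

lemma mat_eval_standard_poly:
  assumes "finite B" "a \<in> B" "b \<in> B"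
  shows "mat_eval B r (standard_poly (2 * card B)) a b = (0 :: 'k::comm_ring_1)"
proof -
  let ?L = "2 * card B"
  have "mat_eval B r (standard_poly ?L) a b =
      (\<Sum>\<tau> | \<tau> permutes {..<?L}. of_int (sign \<tau>) * mat_prod B (map (\<lambda>k. r (Suc (\<tau> k))) [0..<?L]) a b)"
    unfolding mat_eval_def keys_standard_poly sum.reindex[OF std_word_inj] o_def
    by (rule sum.cong[OF refl]) (simp add: lookup_standard_poly, simp add: std_word_def o_def)
  also have "\<dots> = 0" using amitsur_levitzki[OF assms, of "\<lambda>k. r (Suc k)"] by simp
  finally show ?thesis .
qed

context euclidean_factor
begin

lemma satisfies_standard_identity: "satisfies_monic_identity A (2 * card box)"
proof -
  let ?L = "2 * card box"
  have "nc_eval A r (standard_poly ?L) = \<zero>\<^bsub>A\<^esub>" if r: "r \<in> {1..?L} \<rightarrow> carrier A" for r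
  proof -
    have "\<forall>g\<in>{1..?L}. \<exists>f. f \<in> carrier Fr \<and> r g = pr f"
      using r unfolding pr_surj[symmetric] by blast
    then obtain f where f: "\<And>g. g \<in> {1..?L} \<Longrightarrow> f g \<in> carrier Fr \<and> r g = pr (f g)"
      unfolding bchoice_iff by blast
    have "nc_eval A r (standard_poly ?L) = \<zero>\<^bsub>A\<^esub> \<longleftrightarrow> (\<forall>W V. (\<forall>i\<le>n. V i \<noteq> 0) \<longrightarrow>
      (\<forall>a\<in>box. \<forall>b\<in>box. mat_eval box (\<lambda>g. ent W V (f g)) (standard_poly ?L) a b = 0))"
    proof (rule nc_eval_eq_0_iff)
      fix w x assume "w \<in> Poly_Mapping.keys (standard_poly ?L)" "x \<in> set (letters w)"
      then have "x \<in> {1..?L}" using standard_poly_carrier[of ?L] unfolding carrier_free_algebra by blast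
      then show "f x \<in> carrier Fr \<and> r x = pr (f x)" by (rule f)
    qed
    then show ?thesis using mat_eval_standard_poly[OF finite_box] by blast
  qed
  then show ?thesis
    unfolding satisfies_monic_identity_def using standard_poly_carrier standard_poly_monic by blast
qed

lemma monic_identity_degree:
  assumes "satisfies_monic_identity A d"
  shows "2 * card box \<le> d"
proof (rule ccontr)
  assume "\<not> ?thesis"
  obtain k P where P: "P \<in> carrier (free_algebra {1..k::nat})" "nc_monic P" "nc_degree P = d"
    and zero: "\<And>r. r \<in> {1..k} \<rightarrow> carrier A \<Longrightarrow> nc_eval A r P = \<zero>\<^bsub>A\<^esub>"
    using assms unfolding satisfies_monic_identity_def by blast
  have "nc_degree P < 2 * card box" using P(3) \<open>\<not> _\<close> by simp
  then obtain M :: "nat \<Rightarrow> (nat \<Rightarrow> int) \<Rightarrow> (nat \<Rightarrow> int) \<Rightarrow> 'k" and a b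
    where M: "a \<in> box" "b \<in> box" "mat_eval box M P a b \<noteq> 0"
    by (rule no_small_matrix_identity[OF finite_box P(2)])
  \<comment> \<open>With all parameters equal to 1 the representation is onto, so the matrices
    \<open>M g\<close> that violate the identity lift to elements of the factor algebra.\<close>
  let ?e = "ent (\<lambda>_. 1) (\<lambda>_. 1)"
  have "\<exists>f. f \<in> carrier Fr \<and> (\<forall>x\<in>box. \<forall>y\<in>box. ?e f x y = M g x y)" for g
    using ent_surjective[of "\<lambda>_. 1" "\<lambda>_. 1" "M g"] by auto
  then obtain f where f: "\<And>g. f g \<in> carrier Fr" "\<And>g x y. x \<in> box \<Longrightarrow> y \<in> box \<Longrightarrow> ?e (f g) x y = M g x y"
    by metis
  have "pr (f g) \<in> carrier A" for g using f(1) pr_surj by blast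
  then have "nc_eval A (\<lambda>g. pr (f g)) P = \<zero>\<^bsub>A\<^esub>" by (intro zero) auto
  moreover have "nc_eval A (\<lambda>g. pr (f g)) P = \<zero>\<^bsub>A\<^esub> \<longleftrightarrow> (\<forall>W V. (\<forall>i\<le>n. V i \<noteq> 0) \<longrightarrow>
      (\<forall>a\<in>box. \<forall>b\<in>box. mat_eval box (\<lambda>g. ent W V (f g)) P a b = 0))"
    by (rule nc_eval_eq_0_iff) (simp add: f)
  ultimately have "mat_eval box (\<lambda>g. ?e (f g)) P a b = 0" using M(1,2) by simp
  moreover have "mat_prod box (map (\<lambda>g. ?e (f g)) ws) x b = mat_prod box (map M ws) x b" if "x \<in> box" for ws x
    using that by (induction ws arbitrary: x) (simp_all add: f(2))
  ultimately show False using M by (simp add: mat_eval_def)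
qed

lemma PI_min_degree_A: "PI_min_degree A = 2 * m ^ (n - 2)"
  unfolding PI_min_degree_def card_box[symmetric]
proof (rule Least_equality)
  show "satisfies_monic_identity A (2 * card box)" by (rule satisfies_standard_identity)
qed (rule monic_identity_degree)

lemma prime_and_PI_degree: "prime_ring A \<and> PI_ring A \<and> PI_degree A = of_nat (m ^ (n - 2))"
  using prime_A ring_A satisfies_standard_identity PI_min_degree_A
  by (auto simp: PI_ring_def PI_degree_def)

end

theorem theoremA:
  fixes q :: "'k::alg_closed_field" and m n p :: nat
  assumes "m > 1" and "odd m"
    and "q \<noteq> 0" and "primitive_root_of_unity m q"
    and "2 \<le> p" and "p \<le> n - 1"
  shows "prime_ring (omega_factor q n p) \<and> PI_ring (omega_factor q n p) \<and>
    PI_degree (omega_factor q n p) = of_nat (m ^ (n - 2))"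
proof -
  \<comment> \<open>Although the subtraction is truncated, \<open>p \<le> n - 1\<close> gives
    \<open>p < n\<close> because \<open>p\<close> is positive.\<close>
  have "euclidean_factor q m n p" by (rule euclidean_factor.intro) (use assms in auto)
  then show ?thesis by (rule euclidean_factor.prime_and_PI_degree)
qed

end
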